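(* Let $\ell_0>4\pi$ and $T>0$, and let $\Phi_0\in H^m_\sharp(\ell_0)$ be $\ell_0$-periodic. Let $\Phi$ be the $\ell_0$-periodic solution on $[0,T]$ of the Kuramoto–Sivashinsky equation $$\Phi_\tau+4\Phi_{\eta\eta\eta\eta}+\Phi_{\eta\eta}+\tfrac12(\Phi_\eta)^2=0,\qquad \Phi(0,\cdot)=\Phi_0 .$$ If $m$ is large enough, then there exists $\varepsilon_0=\varepsilon_0(T)\in(0,1)$ with the following property. For every $0<\varepsilon\le\varepsilon_0$, set $\alpha=1+\varepsilon$ and $\ell=\ell_0/\sqrt\varepsilon$. Then the problem $$\frac{d}{dt}\mathscr B\varphi=\mathscr S\varphi+\mathscr F((\varphi_y)^2)$$ has a unique classical solution $\varphi$ on $[0,T/\varepsilon^2]$. This solution is $\ell_0/\sqrt\varepsilon$-periodic in $y$ and satisfies $\varphi(0,y)=\varepsilon\Phi_0(y\sqrt\varepsilon)$ for $|y|\le \ell_0/(2\sqrt\varepsilon)$. Moreover, there is $C>0$, independent of $\varepsilon\in(0,\varepsilon_0]$, such that $$|\varphi(t,y)-\varepsilon\Phi(t\varepsilon^2,y\sqrt\varepsilon)|\le C\varepsilon^2,\qquad 0\le t\le T/\varepsilon^2,\ |y|\le\frac{\ell_0}{2\sqrt\varepsilon}.$$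
   Context: For a period $\ell>0$, let $\{w_k\}_{k\ge0}$ be an orthonormal basis of $L^2(-\ell/2,\ell/2)$ of eigenfunctions of $D_{yy}$ with periodic boundary conditions: $D_{yy}w_k=-\lambda_kw_k$, with $\lambda_0=0$ and $\lambda_{2j-1}=\lambda_{2j}=4\pi^2j^2/\ell^2$ for $j\ge1$. Write $\widehat f(k)$ for the coefficients. $H^s_\sharp(\ell)$ is the Sobolev space of $\ell$-periodic functions. An operator with symbol $(c_k)$ acts by $\widehat{(\mathscr Cf)}(k)=c_k\widehat f(k)$. With $X_k=\sqrt{1+4\lambda_k}$, the operators $\mathscr B,\mathscr S,\mathscr F$ (depending on $\alpha$ and $\ell$) have symbols $$b_k=X_k^2+\alpha X_k-\alpha,\qquad s_k=-4\lambda_k^2+(\alpha-1)\lambda_k,\qquad f_k=\tfrac14(X_k^3-3X_k^2-4\alpha X_k+4\alpha).$$ *)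

theory Defs
  imports "HOL-Analysis.Analysis"
begin

text \<open>Index j associated with k: w_0 is constant, w_{2j-1}, w_{2j} belong to frequency j.\<close>
definition freq :: "nat \<Rightarrow> nat" where
  "freq k = (k + 1) div 2"

definition lam :: "real \<Rightarrow> nat \<Rightarrow> real" where
  "lam l k = 4 * pi^2 * (real (freq k))^2 / l^2"

text \<open>Orthonormal basis of L^2(-l/2,l/2) of eigenfunctions of D_yy (periodic b.c.).\<close>
definition wb :: "real \<Rightarrow> nat \<Rightarrow> real \<Rightarrow> real" where
  "wb l k y = (if k = 0 then 1 / sqrt l
     else if odd k then sqrt (2 / l) * cos (2 * pi * real (freq k) * y / l)
     else sqrt (2 / l) * sin (2 * pi * real (freq k) * y / l))"

definition fc :: "real \<Rightarrow> (real \<Rightarrow> real) \<Rightarrow> nat \<Rightarrow> real" where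
  "fc l f k = integral {-l/2..l/2} (\<lambda>y. f y * wb l k y)"

definition periodic_on_R :: "real \<Rightarrow> (real \<Rightarrow> real) \<Rightarrow> bool" where
  "periodic_on_R l f \<longleftrightarrow> (\<forall>y. f (y + l) = f y)"

definition Hsharp :: "nat \<Rightarrow> real \<Rightarrow> (real \<Rightarrow> real) set" where
  "Hsharp s l = {f. periodic_on_R l f
      \<and> f integrable_on {-l/2..l/2}
      \<and> (\<lambda>y. (f y)^2) integrable_on {-l/2..l/2}
      \<and> summable (\<lambda>k. (1 + lam l k) ^ s * (fc l f k)^2)}"

definition Xs :: "real \<Rightarrow> nat \<Rightarrow> real" where
  "Xs l k = sqrt (1 + 4 * lam l k)"

definition bsym :: "real \<Rightarrow> real \<Rightarrow> nat \<Rightarrow> real" where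
  "bsym \<alpha> l k = (Xs l k)^2 + \<alpha> * Xs l k - \<alpha>"

definition ssym :: "real \<Rightarrow> real \<Rightarrow> nat \<Rightarrow> real" where
  "ssym \<alpha> l k = - 4 * (lam l k)^2 + (\<alpha> - 1) * lam l k"

definition fsym :: "real \<Rightarrow> real \<Rightarrow> nat \<Rightarrow> real" where
  "fsym \<alpha> l k = ((Xs l k)^3 - 3 * (Xs l k)^2 - 4 * \<alpha> * Xs l k + 4 * \<alpha>) / 4"

definition classical_reg :: "real \<Rightarrow> (real \<Rightarrow> real \<Rightarrow> real) \<Rightarrow> (real \<Rightarrow> real \<Rightarrow> real) \<Rightarrow> bool" where
  "classical_reg T u ut \<longleftrightarrow>
     (\<forall>t\<in>{0..T}. \<forall>j<4. \<forall>y.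
        ((deriv ^^ j) (u t) has_real_derivative (deriv ^^ Suc j) (u t) y) (at y))
   \<and> (\<forall>j\<le>4. continuous_on ({0..T} \<times> UNIV) (\<lambda>(t,y). (deriv ^^ j) (u t) y))
   \<and> continuous_on ({0..T} \<times> UNIV) (\<lambda>(t,y). ut t y)
   \<and> (\<forall>t\<in>{0..T}. \<forall>y. ((\<lambda>s. u s y) has_real_derivative ut t y) (at t within {0..T}))"

text \<open>Classical l-periodic solution on [0,T] of  d/dt B phi = S phi + F((phi_y)^2),
  the operator identity being expressed (equivalently, in L^2) through the
  Fourier coefficients of both sides: d/dt (b_k hat phi(t,k)) = s_k hat phi(t,k) + f_k hat{(phi_y)^2}(t,k).\<close>
definition classical_sol :: "real \<Rightarrow> real \<Rightarrow> real \<Rightarrow> (real \<Rightarrow> real \<Rightarrow> real) \<Rightarrow> bool" where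
  "classical_sol \<alpha> l T \<phi> \<longleftrightarrow>
     (\<forall>t\<in>{0..T}. periodic_on_R l (\<phi> t))
   \<and> (\<exists>\<phi>t. classical_reg T \<phi> \<phi>t)
   \<and> (\<forall>t\<in>{0..T}. \<forall>k.
        ((\<lambda>s. bsym \<alpha> l k * fc l (\<phi> s) k) has_real_derivative
           (ssym \<alpha> l k * fc l (\<phi> t) k
            + fsym \<alpha> l k * fc l (\<lambda>y. (deriv (\<phi> t) y)^2) k)) (at t within {0..T}))"

definition ks_sol :: "real \<Rightarrow> real \<Rightarrow> (real \<Rightarrow> real) \<Rightarrow> (real \<Rightarrow> real \<Rightarrow> real) \<Rightarrow> bool" where
  "ks_sol l0 T \<Phi>0 \<Phi> \<longleftrightarrow>
     (\<forall>t\<in>{0..T}. periodic_on_R l0 (\<Phi> t))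
   \<and> (\<forall>y. \<Phi> 0 y = \<Phi>0 y)
   \<and> (\<exists>\<Phi>t. classical_reg T \<Phi> \<Phi>t
        \<and> (\<forall>t\<in>{0..T}. \<forall>y.
             \<Phi>t t y + 4 * (deriv ^^ 4) (\<Phi> t) y + (deriv ^^ 2) (\<Phi> t) y
               + (1/2) * ((deriv (\<Phi> t) y)^2) = 0))"

end

theory Submission
  imports Defs
begin

text \<open>Under the scaling \<open>\<phi>(t, y) = \<epsilon> \<Psi>(\<epsilon>\<^sup>2 t, y sqrt \<epsilon>)\<close> the problem becomes
  \<open>b \<Psi>\<^sub>t = (\<Lambda> - 4 \<Lambda>\<^sup>2) \<Psi> + f (\<Psi>\<^sub>\<eta>\<^sup>2)\<close> on the fixed period, with Fourier symbols \<open>b \<rightarrow> 1\<close> and \<open>f \<rightarrow> - 1/2\<close>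
  as \<open>\<epsilon> \<rightarrow> 0\<close>: formally the Kuramoto--Sivashinsky equation. The Fourier coefficients of the remainder
  \<open>R = \<Psi> - \<Phi>\<close> solve scalar linear equations driven by convolutions, and all estimates are made frequency by
  frequency in norms \<open>sup\<^sub>j\<^sub>,\<^sub>t exp(- \<gamma> t) (1 + \<bar>j\<bar>)^p \<bar>R\<^sub>j(t)\<bar>\<close>. There parabolic smoothing is an
  elementary bound for one equation, and powers of \<open>1 + \<bar>j\<bar>\<close> of order at least 2 are stable under convolution.
  The nonlinearity is of the same order as the linear part for fixed \<open>\<epsilon>\<close>, but with a small constant; hence for
  large \<open>\<gamma>\<close> and small \<open>\<epsilon>\<close> the equation for \<open>R\<close> is a contraction on a ball of radius \<open>O(\<epsilon>)\<close>, the size of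
  the residual of \<open>\<Phi>\<close>. The same contraction, applied on short time steps, gives uniqueness among all classical
  solutions. The regularity of \<open>\<Phi>\<close> needed for the residual follows from that of \<open>\<Phi>0\<close> by bootstrapping the
  decay of its Fourier coefficients.\<close>

section \<open>Sums and convolutions over the integers\<close>

text \<open>The obstacle is that \<open>b\<close>, the linear rate and \<open>f\<close> all grow
  with the frequency, so that for fixed \<epsilon> the quadratic term is no lower order
  perturbation. After division by \<open>b\<close> the smoothing is only of second order, but
  \<open>f\<close> is weakened by the same factor. What counts is the quotient of |f|, times one
  power of the frequency, by the rate plus \<gamma>: it can be made small uniformly in frequency and
  \<epsilon>. How small it has to be depends only on the decay constant of \<Phi> and on the period,
  so there is no circularity: this threshold comes from \<Phi>, then \<gamma> from the threshold,
  and \<epsilon> last. The weight costs a factor exp(\<gamma> T), harmless because T is fixed in the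
  slow time. The exponents come from a budget. A remainder with decay 6 has four continuous space
  derivatives and, since the rate has order at most four, a time derivative with summable
  coefficients. The residual of \<Phi> costs at most six powers, so \<Phi> is brought to decay 10,
  and this is the regularity asked of the initial datum.\<close>

lemma summable_diff_on:
  fixes f g :: "'a \<Rightarrow> 'b::real_normed_vector"
  assumes "f summable_on A" "g summable_on A"
  shows "(\<lambda>i. f i - g i) summable_on A" "infsum (\<lambda>i. f i - g i) A = infsum f A - infsum g A"
proof -
  have "((\<lambda>i. f i + - g i) has_sum (infsum f A + - infsum g A)) A"
    using assms by (intro has_sum_add) (auto simp: has_sum_uminus)
  then show "(\<lambda>i. f i - g i) summable_on A" "infsum (\<lambda>i. f i - g i) A = infsum f A - infsum g A"
    by (auto simp: has_sum_imp_summable infsumI)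
qed

lemma infsum_dominated:
  fixes f :: "'a \<Rightarrow> 'b::banach"
  assumes "\<And>i. norm (f i) \<le> M i" "M summable_on UNIV"
  shows "f summable_on UNIV" "norm (infsum f UNIV) \<le> infsum M UNIV"
proof -
  show s: "f summable_on UNIV"
    by (rule abs_summable_summable, rule Infinite_Sum.abs_summable_on_comparison_test'[OF assms(2)])
      (use assms(1) in auto)
  show "norm (infsum f UNIV) \<le> infsum M UNIV"
    by (rule norm_infsum_le[OF has_sum_infsum[OF s] has_sum_infsum[OF assms(2)]]) (rule assms(1))
qed

lemma continuous_on_infsum:
  fixes f :: "'a \<Rightarrow> 'c::topological_space \<Rightarrow> 'b::banach"
  assumes "\<And>i. continuous_on S (f i)" "\<And>i x. x \<in> S \<Longrightarrow> norm (f i x) \<le> M i" "M summable_on UNIV"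
  shows "continuous_on S (\<lambda>x. \<Sum>\<^sub>\<infinity>i. f i x)"
proof (rule uniform_limit_theorem)
  show "uniform_limit S (\<lambda>X y. \<Sum>x\<in>X. f x y) (\<lambda>y. \<Sum>\<^sub>\<infinity>i. f i y) (finite_subsets_at_top UNIV)"
    by (rule Weierstrass_m_test_general[OF _ assms(3)]) (use assms in auto)
qed (auto intro!: always_eventually continuous_on_sum assms(1))

text \<open>The M-test gives uniform convergence along the filter of finite index sets, and
  integrals pass to uniform limits; no enumeration of the index type is involved.\<close>

lemma integral_infsum:
  fixes f :: "'a \<Rightarrow> real \<Rightarrow> 'b::banach"
  assumes "\<And>i. continuous_on {a..b} (f i)" "\<And>i x. x \<in> {a..b} \<Longrightarrow> norm (f i x) \<le> M i" "M summable_on UNIV"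
  shows "((\<lambda>i. integral {a..b} (f i)) has_sum integral {a..b} (\<lambda>x. \<Sum>\<^sub>\<infinity>i. f i x)) UNIV"
proof -
  have u: "uniform_limit {a..b} (\<lambda>X y. \<Sum>x\<in>X. f x y) (\<lambda>y. \<Sum>\<^sub>\<infinity>i. f i y) (finite_subsets_at_top UNIV)"
    by (rule Weierstrass_m_test_general[OF _ assms(3)]) (use assms in auto)
  obtain I J where I: "\<And>X. ((\<lambda>y. \<Sum>x\<in>X. f x y) has_integral I X) {a..b}"
    and J: "((\<lambda>y. \<Sum>\<^sub>\<infinity>i. f i y) has_integral J) {a..b}" and lim: "(I \<longlongrightarrow> J) (finite_subsets_at_top UNIV)"
    by (rule uniform_limit_integral[OF u]) (auto intro!: continuous_on_sum assms(1))
  have "I X = (\<Sum>i\<in>X. integral {a..b} (f i))" if "finite X" for X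
    using integral_unique[OF I, of X] that
    by (subst (asm) integral_sum) (auto intro!: integrable_continuous_interval assms(1))
  then have "\<forall>\<^sub>F X in finite_subsets_at_top UNIV. I X = (\<Sum>i\<in>X. integral {a..b} (f i))"
    by (intro eventually_finite_subsets_at_top_weakI) auto
  then show ?thesis
    unfolding has_sum_def using lim J by (simp add: integral_unique tendsto_cong)
qed

text \<open>Termwise differentiation is obtained by integrating the series of derivatives.\<close>

lemma has_vector_derivative_infsum:
  fixes f f' :: "'a \<Rightarrow> real \<Rightarrow> 'b::banach"
  assumes ab: "a < b" and x: "x \<in> {a..b}"
    and d: "\<And>i x. x \<in> {a..b} \<Longrightarrow> (f i has_vector_derivative f' i x) (at x within {a..b})"
    and c: "\<And>i. continuous_on {a..b} (f' i)"
    and M': "\<And>i x. x \<in> {a..b} \<Longrightarrow> norm (f' i x) \<le> M' i" "M' summable_on UNIV"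
    and s: "\<And>x. x \<in> {a..b} \<Longrightarrow> (\<lambda>i. f i x) summable_on UNIV"
  shows "((\<lambda>x. \<Sum>\<^sub>\<infinity>i. f i x) has_vector_derivative (\<Sum>\<^sub>\<infinity>i. f' i x)) (at x within {a..b})"
proof -
  let ?g = "\<lambda>x. \<Sum>\<^sub>\<infinity>i. f' i x"
  have g: "continuous_on {a..b} ?g"
    by (rule continuous_on_infsum[OF c M'])
  have eq: "(\<Sum>\<^sub>\<infinity>i. f i x) = (\<Sum>\<^sub>\<infinity>i. f i a) + integral {a..x} ?g" if x: "x \<in> {a..b}" for x
  proof -
    have 1: "integral {a..x} (f' i) = f i x - f i a" for i
    proof (rule integral_unique, rule fundamental_theorem_of_calculus)
      show "a \<le> x" using x by simp
      fix y assume "y \<in> {a..x}"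
      then show "(f i has_vector_derivative f' i y) (at y within {a..x})"
        using d[of y i] x by (auto intro: has_vector_derivative_within_subset)
    qed
    have "((\<lambda>i. integral {a..x} (f' i)) has_sum integral {a..x} ?g) UNIV"
      using x by (intro integral_infsum[OF _ _ M'(2)] continuous_on_subset[OF c] M'(1)) auto
    then have "infsum (\<lambda>i. f i x - f i a) UNIV = integral {a..x} ?g"
      by (simp add: 1 infsumI)
    moreover have "infsum (\<lambda>i. (f i x - f i a) + f i a) UNIV = infsum (\<lambda>i. f i x - f i a) UNIV + infsum (\<lambda>i. f i a) UNIV"
      by (rule infsum_add) (use s[OF x] s[of a] ab in \<open>auto intro!: summable_diff_on\<close>)
    ultimately show ?thesis by simp
  qed
  have "((\<lambda>x. (\<Sum>\<^sub>\<infinity>i. f i a) + integral {a..x} ?g) has_vector_derivative 0 + ?g x) (at x within {a..b})"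
    by (intro has_vector_derivative_add has_vector_derivative_const integral_has_vector_derivative[OF g x])
  then have "((\<lambda>x. (\<Sum>\<^sub>\<infinity>i. f i a) + integral {a..x} ?g) has_vector_derivative ?g x) (at x within {a..b})"
    by simp
  then show ?thesis
    by (rule has_vector_derivative_transform[rotated 2]) (rule x, rule eq)
qed

text \<open>The shift by 1 keeps the weight at least 1 even at the zero mode, where the symbol of
  the derivative vanishes, so division is always safe and decay bounds weaken monotonically with the
  exponent.\<close>

definition wt :: "int \<Rightarrow> real" where "wt j = 1 + \<bar>real_of_int j\<bar>"

lemma wt_ge1: "1 \<le> wt j" and wt_pos: "0 < wt j" and wt_0: "wt 0 = 1" and wt_minus: "wt (- j) = wt j"
  by (auto simp: wt_def)

lemma wt_add: "wt (i + j) \<le> wt i + wt j" by (simp add: wt_def)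

lemma wt_powr_mono: "p \<le> q \<Longrightarrow> 1 / wt j ^ q \<le> 1 / wt j ^ p"
  by (intro divide_left_mono power_increasing mult_pos_pos zero_less_power wt_pos wt_ge1) auto

lemma wt_summable: 
  assumes "2 \<le> q" shows "(\<lambda>j. 1 / wt j ^ q) summable_on UNIV"
proof -
  have "summable (\<lambda>n. inverse (real (Suc n)) ^ 2)"
    using inverse_power_summable[of 2, where 'a=real] summable_Suc_iff[of "\<lambda>n. inverse (real n) ^ 2"] by (simp add: power_inverse)
  then have 1: "(\<lambda>n. inverse (real (Suc n)) ^ 2) summable_on UNIV"
    by (intro summable_nonneg_imp_summable_on) auto
  \<comment> \<open>The sign \<open>s\<close> treats both half lines of integers at once. They
    overlap at 0, which does not matter for summability on their union.\<close>
  have e: "(\<lambda>j. 1 / wt j ^ 2) \<circ> (\<lambda>n. s * int n) = (\<lambda>n. inverse (real (Suc n)) ^ 2)" if "\<bar>s\<bar> = 1" for s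
    using that by (auto simp: wt_def fun_eq_iff field_simps abs_mult simp flip: of_int_abs)
  have 2: "(\<lambda>j. 1 / wt j ^ 2) summable_on range (\<lambda>n. s * int n)" if "\<bar>s\<bar> = 1" for s
    using that 1 by (subst summable_on_reindex) (auto simp: inj_on_def e simp del: of_nat_Suc)
  have "UNIV = range (\<lambda>n. 1 * int n) \<union> range (\<lambda>n. - 1 * int n)"
    using int_cases2 by (auto simp: image_iff) metis
  then have "(\<lambda>j. 1 / wt j ^ 2) summable_on UNIV"
    using summable_on_union[OF 2[of 1] 2[of "-1"]] by simp
  then show ?thesis
    by (rule summable_on_comparison_test) (use assms wt_powr_mono in \<open>auto simp: less_imp_le[OF wt_pos]\<close>)
qed

section \<open>Convolution of coefficient sequences with polynomial decay\<close>

definition conv :: "(int \<Rightarrow> complex) \<Rightarrow> (int \<Rightarrow> complex) \<Rightarrow> int \<Rightarrow> complex" where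
  "conv U V j = (\<Sum>\<^sub>\<infinity>i. U (j - i) * V i)"

text \<open>The factor \<open>2 ^ q\<close> comes from \<open>wt_conv_term\<close>; one more factor
  2 counts its two summands, whose sums over i agree after a shift.\<close>

definition conv_const :: "nat \<Rightarrow> real" where
  "conv_const q = 2 ^ Suc q * (\<Sum>\<^sub>\<infinity>j. 1 / wt j ^ 2)"

lemma conv_const_pos: "0 < conv_const q"
proof -
  have "(\<Sum>i\<in>{0}. 1 / wt i ^ 2) \<le> (\<Sum>\<^sub>\<infinity>j. 1 / wt j ^ 2)"
    by (rule finite_sum_le_infsum) (auto simp: wt_summable)
  then show ?thesis by (simp add: conv_const_def wt_0)
qed

text \<open>As \<open>wt j\<close> is at most the sum of the two weights, the larger of them is at
  least half of \<open>wt j\<close> and supplies the whole decay in j. The smaller one keeps two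
  powers, which suffice for summation over i.\<close>

lemma wt_conv_term:
  assumes "2 \<le> q"
  shows "1 / wt (j - i) ^ q * (1 / wt i ^ q) \<le> 2 ^ q / wt j ^ q * (1 / wt i ^ 2 + 1 / wt (j - i) ^ 2)"
proof -
  have *: "1 / a ^ q * (1 / b ^ q) \<le> 2 ^ q / wt j ^ q * (1 / a\<^sup>2 + 1 / b\<^sup>2)"
    if "1 \<le> a" "1 \<le> b" "wt j \<le> a + b" "a \<le> b" for a b
  proof -
    have "wt j ^ q \<le> (2 * b) ^ q"
      using that wt_pos[of j] by (intro power_mono) auto
    then have "1 / b ^ q \<le> 2 ^ q / wt j ^ q"
      using that wt_pos[of j] by (simp add: field_simps power_mult_distrib)
    moreover have "1 / a ^ q \<le> 1 / a\<^sup>2"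
      using that assms by (intro divide_left_mono power_increasing) auto
    ultimately have "1 / a ^ q * (1 / b ^ q) \<le> 1 / a\<^sup>2 * (2 ^ q / wt j ^ q)"
      using that by (intro mult_mono) auto
    also have "\<dots> \<le> 2 ^ q / wt j ^ q * (1 / a\<^sup>2 + 1 / b\<^sup>2)"
      using wt_pos[of j] by (simp add: algebra_simps)
    finally show ?thesis .
  qed
  show ?thesis
    using *[of "wt (j-i)" "wt i"] *[of "wt i" "wt (j-i)"] wt_add[of "j-i" i] wt_ge1[of i] wt_ge1[of "j-i"]
    by (cases "wt i \<le> wt (j-i)") (simp_all add: algebra_simps)
qed

lemma summable_shift: "(f :: int \<Rightarrow> real) summable_on UNIV \<Longrightarrow> (\<lambda>i. f (j - i)) summable_on UNIV"
  and infsum_shift: "infsum (\<lambda>i. f (j - i)) UNIV = infsum f (UNIV :: int set)"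
proof -
  have b: "bij_betw (\<lambda>i. j - i) UNIV (UNIV :: int set)"
    by (rule bij_betwI[where g = "\<lambda>i. j - i"]) auto
  show "infsum (\<lambda>i. f (j - i)) UNIV = infsum f (UNIV :: int set)"
    by (rule infsum_reindex_bij_betw[OF b])
  show "f summable_on UNIV \<Longrightarrow> (\<lambda>i. f (j - i)) summable_on UNIV"
    using summable_on_reindex_bij_betw[OF b, of f] by simp
qed

lemma conv_dominated:
  fixes U V :: "int \<Rightarrow> complex"
  assumes q: "2 \<le> q" and U: "\<And>i. norm (U i) \<le> A / wt i ^ q" and V: "\<And>i. norm (V i) \<le> B / wt i ^ q"
  shows "norm (U (j - i) * V i) \<le> A * B * (2 ^ q / wt j ^ q * (1 / wt i ^ 2 + 1 / wt (j - i) ^ 2))"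
    and "(\<lambda>i. A * B * (2 ^ q / wt j ^ q * (1 / wt i ^ 2 + 1 / wt (j - i) ^ 2))) summable_on UNIV"
proof -
  have AB: "0 \<le> A" "0 \<le> B"
    using order_trans[OF norm_ge_zero U[of 0]] order_trans[OF norm_ge_zero V[of 0]] by (auto simp: wt_0)
  have "norm (U (j - i) * V i) \<le> (A / wt (j-i) ^ q) * (B / wt i ^ q)"
    unfolding norm_mult by (intro mult_mono U V) (use AB wt_pos[of "j-i"] in auto)
  also have "\<dots> = A * B * (1 / wt (j-i) ^ q * (1 / wt i ^ q))" by simp
  also have "\<dots> \<le> A * B * (2 ^ q / wt j ^ q * (1 / wt i ^ 2 + 1 / wt (j - i) ^ 2))"
    by (intro mult_left_mono wt_conv_term q mult_nonneg_nonneg AB)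
  finally show "norm (U (j - i) * V i) \<le> A * B * (2 ^ q / wt j ^ q * (1 / wt i ^ 2 + 1 / wt (j - i) ^ 2))" .
  show "(\<lambda>i. A * B * (2 ^ q / wt j ^ q * (1 / wt i ^ 2 + 1 / wt (j - i) ^ 2))) summable_on UNIV"
    by (intro summable_on_cmult_right summable_on_add wt_summable summable_shift[where f="\<lambda>i. 1 / wt i ^ 2"]) auto
qed

lemma conv_summable:
  fixes U V :: "int \<Rightarrow> complex"
  assumes "2 \<le> q" "\<And>i. norm (U i) \<le> A / wt i ^ q" "\<And>i. norm (V i) \<le> B / wt i ^ q"
  shows "(\<lambda>i. U (j - i) * V i) summable_on UNIV"
  by (rule infsum_dominated(1)[OF conv_dominated[OF assms]])

lemma conv_bound:
  assumes q: "2 \<le> q" and U: "\<And>i. norm (U i) \<le> A / wt i ^ q" and V: "\<And>i. norm (V i) \<le> B / wt i ^ q"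
  shows "norm (conv U V j) \<le> conv_const q * A * B / wt j ^ q"
proof -
  have s: "(\<lambda>i. 1 / wt i ^ 2) summable_on UNIV" by (rule wt_summable) simp
  have "norm (conv U V j) \<le> (\<Sum>\<^sub>\<infinity>i. A * B * (2 ^ q / wt j ^ q * (1 / wt i ^ 2 + 1 / wt (j - i) ^ 2)))"
    unfolding conv_def by (rule infsum_dominated(2)[OF conv_dominated[OF assms]])
  also have "\<dots> = A * B * (2 ^ q / wt j ^ q * (infsum (\<lambda>i. 1 / wt i ^ 2) UNIV + infsum (\<lambda>i. 1 / wt i ^ 2) UNIV))"
    unfolding infsum_cmult_right'
    by (subst infsum_add) (simp_all only: s summable_shift[where f="\<lambda>i. 1 / wt i ^ 2"] infsum_shift[where f="\<lambda>i. 1 / wt i ^ 2"])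
  also have "\<dots> = conv_const q * A * B / wt j ^ q"
    by (simp add: conv_const_def)
  finally show ?thesis .
qed

lemma conv_diff:
  assumes q: "2 \<le> q" and b: "\<And>i. norm (U i) \<le> A / wt i ^ q" "\<And>i. norm (U' i) \<le> A' / wt i ^ q"
    "\<And>i. norm (V i) \<le> B / wt i ^ q" "\<And>i. norm (V' i) \<le> B' / wt i ^ q"
  shows "conv U V j - conv U' V' j = conv (\<lambda>i. U i - U' i) V j + conv U' (\<lambda>i. V i - V' i) j"
proof -
  have "conv (\<lambda>i. U i - U' i) V j = conv U V j - conv U' V j"
    unfolding conv_def left_diff_distrib
    by (rule summable_diff_on(2)) (rule conv_summable[OF q] b)+
  moreover have "conv U' (\<lambda>i. V i - V' i) j = conv U' V j - conv U' V' j"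
    unfolding conv_def right_diff_distrib
    by (rule summable_diff_on(2)) (rule conv_summable[OF q] b)+
  ultimately show ?thesis by simp
qed

lemma conv_add_right:
  assumes q: "2 \<le> q" and b: "\<And>i. norm (U i) \<le> A / wt i ^ q"
    "\<And>i. norm (V i) \<le> B / wt i ^ q" "\<And>i. norm (V' i) \<le> B' / wt i ^ q"
  shows "conv U (\<lambda>i. V i + V' i) j = conv U V j + conv U V' j"
  unfolding conv_def distrib_left
    by (rule infsum_add) (rule conv_summable[OF q] b)+

lemma conv_add_left:
  assumes q: "2 \<le> q" and b: "\<And>i. norm (U i) \<le> A / wt i ^ q" "\<And>i. norm (U' i) \<le> A' / wt i ^ q"
    "\<And>i. norm (V i) \<le> B / wt i ^ q"
  shows "conv (\<lambda>i. U i + U' i) V j = conv U V j + conv U' V j"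
  unfolding conv_def distrib_right
    by (rule infsum_add) (rule conv_summable[OF q] b)+

lemma conv_commute: "conv U V j = conv V U j"
proof -
  have b: "bij_betw (\<lambda>i. j - i) UNIV (UNIV :: int set)"
    by (rule bij_betwI[where g = "\<lambda>i. j - i"]) auto
  show ?thesis
    unfolding conv_def by (subst infsum_reindex_bij_betw[OF b, symmetric]) (simp add: mult.commute)
qed

lemma conv_cmult: "conv U (\<lambda>i. c * V i) j = c * conv U V j"
  unfolding conv_def by (subst infsum_cmult_right'[symmetric]) (simp add: mult_ac)

lemma conv_cnj:
  assumes "\<And>i. U (- i) = cnj (U i)" "\<And>i. V (- i) = cnj (V i)"
  shows "conv U V (- j) = cnj (conv U V j)"
proof -
  have b: "bij_betw (\<lambda>i. - i) UNIV (UNIV :: int set)"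
    by (rule bij_betwI[where g = "\<lambda>i. - i"]) auto
  have "U (- j + i) = cnj (U (j - i))" for i
    using assms(1)[of "j - i"] by (simp add: algebra_simps)
  then have "conv U V (- j) = (\<Sum>\<^sub>\<infinity>i. cnj (U (j - i) * V i))"
    unfolding conv_def
    by (subst infsum_reindex_bij_betw[OF b, symmetric]) (simp add: assms(2))
  then show ?thesis by (simp only: conv_def infsum_cnj)
qed

lemma conv_continuous:
  fixes U V :: "'t::topological_space \<Rightarrow> int \<Rightarrow> complex"
  assumes q: "2 \<le> q" and b: "\<And>t i. t \<in> S \<Longrightarrow> norm (U t i) \<le> A / wt i ^ q"
    "\<And>t i. t \<in> S \<Longrightarrow> norm (V t i) \<le> B / wt i ^ q"
    and c: "\<And>i. continuous_on S (\<lambda>t. U t i)" "\<And>i. continuous_on S (\<lambda>t. V t i)"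
  shows "continuous_on S (\<lambda>t. conv (U t) (V t) j)"
\<comment> \<open>Summability of the majorant is derived from actual bounds at some point of
  \<open>S\<close>, so the empty set is treated apart.\<close>
proof (cases "S = {}")
  case False
  then obtain t0 where t0: "t0 \<in> S" by blast
  show ?thesis
    unfolding conv_def
  proof (rule continuous_on_infsum)
    show "continuous_on S (\<lambda>t. U t (j - i) * V t i)" for i
      by (intro continuous_intros c)
    show "(\<lambda>i. A * B * (2 ^ q / wt j ^ q * (1 / wt i ^ 2 + 1 / wt (j - i) ^ 2))) summable_on UNIV"
      by (rule conv_dominated(2)[OF q b(1)[OF t0] b(2)[OF t0]])
    show "norm (U t (j - i) * V t i) \<le> A * B * (2 ^ q / wt j ^ q * (1 / wt i ^ 2 + 1 / wt (j - i) ^ 2))"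
      if "t \<in> S" for i t by (rule conv_dominated(1)[OF q b(1)[OF that] b(2)[OF that]])
  qed
qed simp

section \<open>Fourier coefficients\<close>

definition fexp :: "real \<Rightarrow> int \<Rightarrow> real \<Rightarrow> complex" where
  "fexp l j y = cis (2 * pi * real_of_int j / l * y)"

text \<open>With the factor 1/l the coefficients are invariant under rescaling of the period and
  products become convolutions without constants. In the real basis \<open>wb\<close> a product
  would split into sine and cosine cases.\<close>

definition fcoeff :: "real \<Rightarrow> (real \<Rightarrow> real) \<Rightarrow> int \<Rightarrow> complex" where
  "fcoeff l f j = integral {-l/2..l/2} (\<lambda>y. of_real (f y) * fexp l (- j) y) / of_real l"

definition fderiv :: "real \<Rightarrow> (int \<Rightarrow> complex) \<Rightarrow> int \<Rightarrow> complex" where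
  "fderiv l U j = \<i> * of_real (2 * pi * real_of_int j / l) * U j"

lemma fexp_add: "fexp l (i + j) y = fexp l i y * fexp l j y"
  by (simp add: fexp_def cis_mult ring_distribs add_divide_distrib)

lemma fexp_0 [simp]: "fexp l 0 y = 1" by (simp add: fexp_def)

lemma norm_fexp [simp]: "norm (fexp l j y) = 1" by (simp add: fexp_def)

lemma cnj_fexp: "cnj (fexp l j y) = fexp l (- j) y" by (simp add: fexp_def cis_cnj)

lemma continuous_on_fexp [continuous_intros]: "continuous_on S f \<Longrightarrow> continuous_on S (\<lambda>x. fexp l j (f x))"
  unfolding fexp_def by (intro continuous_intros)

lemma fexp_periodic: "l \<noteq> 0 \<Longrightarrow> fexp l j (y + l) = fexp l j y"
  using cis_multiple_2pi[of "real_of_int j"]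
  by (simp add: fexp_def distrib_left flip: cis_mult)

lemma fexp_ends: "l \<noteq> 0 \<Longrightarrow> fexp l j (l / 2) = fexp l j (- l / 2)"
  using fexp_periodic[of l j "- l / 2"] by simp

lemma fexp_deriv: "(fexp l j has_vector_derivative \<i> * of_real (2 * pi * real_of_int j / l) * fexp l j y) (at y within S)"
proof -
  have "((\<lambda>y. cis (w * y)) has_vector_derivative \<i> * of_real w * cis (w * y)) (at y within S)" for w
    unfolding has_vector_derivative_def
    by (auto intro!: derivative_eq_intros simp: scaleR_conv_of_real algebra_simps)
  then show ?thesis
    unfolding fexp_def[abs_def] .
qed

lemma integral_fexp:
  assumes "l > 0" shows "integral {-l/2..l/2} (fexp l j) = (if j = 0 then of_real l else 0)"
proof (cases "j = 0")
  case True
  have "fexp l j = (\<lambda>y. 1)" using True by (auto simp: fun_eq_iff)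
  then show ?thesis using True assms by (simp add: scaleR_conv_of_real)
next
  case False
  let ?c = "\<i> * of_real (2 * pi * real_of_int j / l) :: complex"
  have c: "?c \<noteq> 0" using False assms by simp
  have "(fexp l j has_integral (fexp l j (l/2) / ?c - fexp l j (-l/2) / ?c)) {-l/2..l/2}"
  proof (rule fundamental_theorem_of_calculus)
    show "((\<lambda>y. fexp l j y / ?c) has_vector_derivative fexp l j y) (at y within {-l/2..l/2})" for y
      using bounded_linear.has_vector_derivative[OF bounded_linear_divide[of ?c] fexp_deriv[of l j y "{-l/2..l/2}"]] c
      by simp
  qed (use assms in auto)
  then show ?thesis using assms False by (simp add: fexp_ends integral_unique)
qed

lemma fcoeff_integrable:
  assumes "continuous_on {-l/2..l/2} f"
  shows "(\<lambda>y. of_real (f y) * fexp l j y) integrable_on {-l/2..l/2}"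
  by (intro integrable_continuous_interval continuous_intros assms)

lemma fcoeff_add:
  assumes "continuous_on {-l/2..l/2} f" "continuous_on {-l/2..l/2} g"
  shows "fcoeff l (\<lambda>y. f y + g y) j = fcoeff l f j + fcoeff l g j"
  unfolding fcoeff_def of_real_add distrib_right
  by (subst integral_add) (rule fcoeff_integrable assms | simp add: add_divide_distrib)+

lemma fcoeff_cmult: "fcoeff l (\<lambda>y. c * f y) j = of_real c * fcoeff l f j"
  unfolding fcoeff_def of_real_mult mult.assoc by (subst Henstock_Kurzweil_Integration.integral_mult_right) simp

lemma fcoeff_minus: "fcoeff l (\<lambda>y. - f y) j = - fcoeff l f j"
  using fcoeff_cmult[of l "-1" f j] by simp

lemma fcoeff_diff:
  assumes "continuous_on {-l/2..l/2} f" "continuous_on {-l/2..l/2} g"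
  shows "fcoeff l (\<lambda>y. f y - g y) j = fcoeff l f j - fcoeff l g j"
  using fcoeff_add[of l f "\<lambda>y. - g y" j] assms by (simp add: fcoeff_minus continuous_on_minus)

lemma fcoeff_cnj: 
  assumes "continuous_on {-l/2..l/2} f"
  shows "fcoeff l f (- j) = cnj (fcoeff l f j)"
  unfolding fcoeff_def by (simp add: cnj_fexp Henstock_Kurzweil_Integration.integral_cnj)

lemma fcoeff_bound:
  assumes l: "l > 0" and f: "continuous_on {-l/2..l/2} f" and B: "\<And>y. y \<in> {-l/2..l/2} \<Longrightarrow> \<bar>f y\<bar> \<le> B"
  shows "norm (fcoeff l f j) \<le> B"
proof -
  have "norm (integral {-l/2..l/2} (\<lambda>y. of_real (f y) * fexp l (- j) y)) \<le> B * (l/2 - (-l/2))"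
    by (rule integral_bound) (use l B f in \<open>auto intro!: continuous_intros simp: norm_mult\<close>)
  then show ?thesis using l by (simp add: fcoeff_def norm_divide field_simps)
qed

lemma fcoeff_deriv:
  assumes l: "l > 0" and f: "\<And>y. (f has_real_derivative f' y) (at y)" and c: "continuous_on UNIV f'"
    and e: "f (- l / 2) = f (l / 2)"
  shows "fcoeff l f' j = fderiv l (fcoeff l f) j"
proof -
  let ?w = "\<i> * of_real (2 * pi * real_of_int (- j) / l) :: complex"
  let ?h = "\<lambda>y. of_real (f y) * fexp l (- j) y"
  have cf: "continuous_on S f" for S
    using f by (meson DERIV_continuous continuous_at_imp_continuous_on)
  have "((\<lambda>y. of_real (f y) * (?w * fexp l (- j) y) + of_real (f' y) * fexp l (- j) y) has_integral ?h (l/2) - ?h (-l/2)) {-l/2..l/2}"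
  proof (rule fundamental_theorem_of_calculus)
    fix y
    have "((\<lambda>y. of_real (f y)) has_vector_derivative (of_real (f' y) :: complex)) (at y within {-l/2..l/2})"
      using has_vector_derivative_of_real[OF has_field_derivative_at_within[OF f]] .
    then show "(?h has_vector_derivative of_real (f y) * (?w * fexp l (- j) y) + of_real (f' y) * fexp l (- j) y) (at y within {-l/2..l/2})"
      by (intro has_vector_derivative_mult fexp_deriv)
  qed (use l in auto)
  moreover have "?h (l/2) - ?h (-l/2) = 0" using e l fexp_ends[of l "- j"] by simp
  ultimately have "integral {-l/2..l/2} (\<lambda>y. ?w * ?h y + of_real (f' y) * fexp l (- j) y) = 0"
    by (simp add: integral_unique mult_ac)
  also have "integral {-l/2..l/2} (\<lambda>y. ?w * ?h y + of_real (f' y) * fexp l (- j) y) =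
     ?w * integral {-l/2..l/2} ?h + integral {-l/2..l/2} (\<lambda>y. of_real (f' y) * fexp l (- j) y)"
    by (subst integral_add)
      (use l in \<open>auto intro!: integrable_continuous_interval continuous_intros cf continuous_on_subset[OF c] simp del: of_real_mult\<close>)
  finally have "integral {-l/2..l/2} (\<lambda>y. of_real (f' y) * fexp l (- j) y) = - ?w * integral {-l/2..l/2} ?h"
    by (simp add: add_eq_0_iff2)
  then show ?thesis
    unfolding fcoeff_def fderiv_def by simp
qed

section \<open>Continuous functions are determined by their Fourier coefficients\<close>

lemma fcoeff_zero_power:
  assumes f: "continuous_on {-l/2..l/2} f" and z: "\<And>j. fcoeff l f j = 0"
  shows "fcoeff l (\<lambda>y. f y * (cos (2 * pi / l * (y - y0)) + c) ^ n) j = 0"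
proof (induction n arbitrary: j)
  case (Suc n)
  let ?p = "\<lambda>y. cos (2 * pi / l * (y - y0)) + c"
  let ?g = "\<lambda>y. f y * ?p y ^ n"
  have p: "of_real (?p y) = 1/2 * (fexp l (-1) y0 * fexp l 1 y + fexp l 1 y0 * fexp l (-1) y) + of_real c" for y
    by (simp add: complex_eq_iff fexp_def cos_diff right_diff_distrib)
  have g: "continuous_on {-l/2..l/2} ?g" by (intro continuous_intros f)
  let ?J = "\<lambda>j. integral {-l/2..l/2} (\<lambda>y. of_real (?g y) * fexp l j y)"
  have J: "?J j = 0" for j
  proof (cases "l = 0")
    case False then show ?thesis using Suc.IH[of "- j"] by (simp add: fcoeff_def del: of_real_mult)
  qed simp
  \<comment> \<open>Multiplication by the cosine shifts frequencies by one in both directions, so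
    each moment of the power \<open>Suc n\<close> combines three moments of the power n.\<close>
  have e: "of_real (f y * ?p y ^ Suc n) * fexp l (-j) y =
      (1/2 * fexp l (-1) y0) * (of_real (?g y) * fexp l (1 - j) y) + (1/2 * fexp l 1 y0) * (of_real (?g y) * fexp l (-1 - j) y)
      + of_real c * (of_real (?g y) * fexp l (-j) y)" for y
  proof -
    have "of_real (f y * ?p y ^ Suc n) * fexp l (-j) y = of_real (?p y) * (of_real (?g y) * fexp l (-j) y)"
      by simp
    moreover have "fexp l (1 - j) y = fexp l 1 y * fexp l (-j) y" "fexp l (-1 - j) y = fexp l (-1) y * fexp l (-j) y"
      by (simp_all flip: fexp_add)
    ultimately show ?thesis unfolding p by (simp add: algebra_simps)
  qed
  have i: "(\<lambda>y. a * (of_real (?g y) * fexp l i y)) integrable_on {-l/2..l/2}" for a i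
    by (intro integrable_continuous_interval continuous_intros f)
  have "integral {-l/2..l/2} (\<lambda>y. of_real (f y * ?p y ^ Suc n) * fexp l (-j) y) =
     (1/2 * fexp l (-1) y0) * ?J (1 - j) + (1/2 * fexp l 1 y0) * ?J (-1 - j) + of_real c * ?J (-j)"
    unfolding e by (simp only: integral_add[OF integrable_add[OF i i] i] integral_add[OF i i] Henstock_Kurzweil_Integration.integral_mult_right)
  then have "integral {-l/2..l/2} (\<lambda>y. of_real (f y * ?p y ^ Suc n) * fexp l (-j) y) = 0"
    by (simp only: J) simp
  then show ?case by (simp only: fcoeff_def) simp
qed (simp add: z)

lemma cos_le_cos_between:
  assumes "0 \<le> a" "a \<le> x" "x \<le> 2 * pi - a"
  shows "cos x \<le> cos a"
proof (cases "x \<le> pi")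
  case True then show ?thesis using assms by (intro cos_monotone_0_pi_le) auto
next
  case False
  then have "cos (2 * pi - x) \<le> cos a" using assms by (intro cos_monotone_0_pi_le) auto
  then show ?thesis by simp
qed

text \<open>The powers of cos + c concentrate at y0, while all their moments against f vanish.\<close>

lemma fcoeff_inj_aux:
  assumes l: "l > 0" and f: "continuous_on {-l/2..l/2} f" and z: "\<And>j. fcoeff l f j = 0"
    and y0: "\<bar>y0\<bar> < l/2"
  shows "f y0 \<le> 0"
proof (rule ccontr)
  assume "\<not> f y0 \<le> 0"
  then have f0: "f y0 > 0" by simp
  let ?I = "{-l/2..l/2}"
  define m where "m = f y0 / 2"
  have m: "m > 0" using f0 by (simp add: m_def)
  have y0I: "y0 \<in> ?I" using y0 by auto
  obtain d1 where d1: "d1 > 0" "\<And>y. y \<in> ?I \<Longrightarrow> \<bar>y - y0\<bar> < d1 \<Longrightarrow> \<bar>f y - f y0\<bar> < m"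
    using f y0I m unfolding continuous_on_iff dist_real_def by metis
  \<comment> \<open>The bound l/4 makes the angle \<open>th\<close> at most pi/2; the bound by the
    distance to the endpoints keeps the neighbourhood inside one period and leaves |y - y0| at most
    l - d on the interval.\<close>
  define d where "d = min (d1 / 2) (min (l/4) (l/2 - \<bar>y0\<bar>))"
  have d: "d > 0" "d < d1" "d \<le> l/4" "d \<le> l/2 - \<bar>y0\<bar>" using d1 y0 l by (auto simp: d_def min_def)
  have fm: "m \<le> f y" if "\<bar>y - y0\<bar> \<le> d" for y
  proof -
    have "y \<in> ?I" using that d by auto
    then have "\<bar>f y - f y0\<bar> < m" using d1(2)[of y] that d by auto
    then show ?thesis unfolding m_def by linarith
  qed
  define th where "th = 2 * pi / l * d"
  have th: "0 < th" "th \<le> pi / 2"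
    using d l by (auto simp: th_def field_simps)
  \<comment> \<open>With this choice \<open>cos + c\<close> has modulus at most 1 at distance at
    least d from y0, but equals 1 + c > 1 at y0 itself.\<close>
  define c where "c = 1 - cos th"
  have c: "0 < c" "c \<le> 1"
    using th cos_monotone_0_pi[of 0 th] cos_ge_zero[of th] by (auto simp: c_def)
  define p where "p y = cos (2 * pi / l * (y - y0)) + c" for y
  have pc: "continuous_on S p" for S unfolding p_def by (intro continuous_intros)
  obtain d2 where d2: "d2 > 0" "\<And>y. \<bar>y - y0\<bar> < d2 \<Longrightarrow> \<bar>p y - p y0\<bar> < c / 2"
    using pc[of UNIV] c unfolding continuous_on_iff dist_real_def by (metis UNIV_I half_gt_zero)
  define d' where "d' = min (d2 / 2) d"
  have d': "d' > 0" "d' < d2" "d' \<le> d" using d2 d by (auto simp: d'_def)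
  have p1: "1 + c / 2 \<le> p y" if "\<bar>y - y0\<bar> \<le> d'" for y
  proof -
    have "\<bar>p y - p y0\<bar> < c / 2" using d2(2)[of y] that d' by auto
    then show ?thesis by (simp add: p_def abs_less_iff)
  qed
  have arg: "cos (2 * pi / l * (y - y0)) = cos (2 * pi / l * \<bar>y - y0\<bar>)" for y
    using cos_abs_real[of "2 * pi / l * (y - y0)"] l by (simp add: abs_mult)
  have p2: "0 \<le> p y" if "\<bar>y - y0\<bar> \<le> d" for y
  proof -
    have "2 * pi / l * \<bar>y - y0\<bar> \<le> th" unfolding th_def using that l by (intro mult_left_mono) auto
    then have "0 \<le> cos (2 * pi / l * \<bar>y - y0\<bar>)" 
      using th l order_trans[of 0 "pi/2"] by (intro cos_ge_zero) (auto intro: order_trans[of _ 0])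
    then show ?thesis using c arg[of y] by (simp add: p_def)
  qed
  have p3: "\<bar>p y\<bar> \<le> 1" if "y \<in> ?I" "\<bar>y - y0\<bar> \<ge> d" for y
  proof -
    have "\<bar>y - y0\<bar> \<le> l - d" using that d by (auto simp: abs_le_iff)
    then have "2 * pi / l * \<bar>y - y0\<bar> \<le> 2 * pi / l * (l - d)" using l by (intro mult_left_mono) auto
    moreover have "2 * pi / l * (l - d) = 2 * pi - th" using l by (simp add: th_def right_diff_distrib)
    moreover have "th \<le> 2 * pi / l * \<bar>y - y0\<bar>" unfolding th_def using l that by (intro mult_left_mono) auto
    ultimately have "cos (2 * pi / l * (y - y0)) \<le> cos th"
      unfolding arg using th by (intro cos_le_cos_between) auto
    moreover have "-1 \<le> cos (2 * pi / l * (y - y0))" by simp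
    ultimately show ?thesis using c by (simp add: p_def c_def abs_le_iff del: cos_ge_minus_one)
  qed
  obtain B where B: "\<And>y. y \<in> ?I \<Longrightarrow> \<bar>f y\<bar> \<le> B" and B0: "B > 0"
    using compact_imp_bounded[OF compact_continuous_image[OF f compact_Icc]] unfolding bounded_pos by fastforce
  \<comment> \<open>Three zones: near y0 the product grows like (1 + c/2)^n, up to distance d it is
    nonnegative, and beyond that it is bounded by \<open>B\<close>. Since its integral vanishes for
    every n, the growth is contradictory.\<close>
  have low: "(if y \<in> {y0 - d'..y0 + d'} then m * (1 + c/2) ^ n else 0) - B \<le> f y * p y ^ n" if y: "y \<in> ?I" for y n
  proof (cases "\<bar>y - y0\<bar> \<le> d'")
    case True
    have "m * (1 + c/2) ^ n \<le> f y * p y ^ n"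
      using True d' c m p1[of y] fm[of y] by (intro mult_mono power_mono) auto
    then show ?thesis using True B0 by (auto simp: abs_le_iff)
  next
    case F: False
    then have n: "y \<notin> {y0 - d'..y0 + d'}" by (auto simp: abs_le_iff)
    show ?thesis
    proof (cases "\<bar>y - y0\<bar> \<le> d")
      case True
      have "0 \<le> f y * p y ^ n" using True fm[of y] p2[of y] m by (intro mult_nonneg_nonneg) auto
      then show ?thesis using n B0 by auto
    next
      case False
      have "\<bar>f y * p y ^ n\<bar> \<le> B * 1 ^ n" unfolding abs_mult power_abs
        using B[OF y] p3[OF y] False B0 by (intro mult_mono power_mono) auto
      then show ?thesis using n by (auto simp: abs_le_iff)
    qed
  qed
  have sub: "{y0 - d'..y0 + d'} \<subseteq> ?I"
    unfolding atLeastatMost_subset_iff using d d' abs_ge_self[of y0] abs_ge_minus_self[of y0] by linarith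
  have key: "2 * d' * m * (1 + c/2) ^ n \<le> B * l" for n
  proof -
    have "fcoeff l (\<lambda>y. f y * p y ^ n) 0 = 0"
      unfolding p_def by (rule fcoeff_zero_power[OF f z])
    then have z0: "integral ?I (\<lambda>y. of_real (f y * p y ^ n) :: complex) = 0" using l by (simp add: fcoeff_def)
    have i1: "(\<lambda>y. f y * p y ^ n) integrable_on ?I"
      by (intro integrable_continuous_interval continuous_intros f pc)
    have "((\<lambda>y. of_real (f y * p y ^ n) :: complex) has_integral of_real (integral ?I (\<lambda>y. f y * p y ^ n))) ?I"
      by (rule has_integral_of_real[OF integrable_integral[OF i1]])
    then have "complex_of_real (integral ?I (\<lambda>y. f y * p y ^ n)) = 0"
      by (rule integral_unique[THEN trans[OF sym], OF _ z0])
    then have i0: "((\<lambda>y. f y * p y ^ n) has_integral 0) ?I"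
      using integrable_integral[OF i1] by simp
    have "((\<lambda>y. m * (1 + c/2) ^ n) has_integral (m * (1 + c/2) ^ n * (2 * d'))) {y0 - d'..y0 + d'}"
      using has_integral_const_real[of "m * (1 + c/2) ^ n" "y0 - d'" "y0 + d'"] d' by (simp add: mult.commute)
    then have "((\<lambda>y. if y \<in> {y0 - d'..y0 + d'} then m * (1 + c/2) ^ n else 0) has_integral (m * (1 + c/2) ^ n * (2 * d'))) ?I"
      by (rule iffD2[OF has_integral_restrict[OF sub]])
    moreover have "((\<lambda>y. B) has_integral (B * l)) ?I"
      using has_integral_const_real[of B "-l/2" "l/2"] l by (simp add: mult.commute)
    ultimately have "((\<lambda>y. (if y \<in> {y0 - d'..y0 + d'} then m * (1 + c/2) ^ n else 0) - B) has_integral (m * (1 + c/2) ^ n * (2 * d') - B * l)) ?I"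
      by (rule has_integral_diff)
    from has_integral_le[OF this i0] low show ?thesis by (simp add: mult_ac)
  qed
  obtain n where "B * l / (2 * d' * m) < (1 + c/2) ^ n"
    using real_arch_pow[of "1 + c/2" "B * l / (2 * d' * m)"] c by auto
  then show False using key[of n] d' m by (simp add: field_simps)
qed

lemma fcoeff_inj:
  assumes l: "l > 0" and f: "continuous_on {-l/2..l/2} f" and z: "\<And>j. fcoeff l f j = 0" and y: "y \<in> {-l/2..l/2}"
  shows "f y = 0"
proof -
  have int: "f y = 0" if "y \<in> {-l/2<..<l/2}" for y
  proof (rule antisym)
    show "f y \<le> 0" by (rule fcoeff_inj_aux[OF l f z]) (use that in auto)
    have "- f y \<le> 0"
      by (rule fcoeff_inj_aux[OF l continuous_on_minus[OF f]]) (use that z in \<open>auto simp: fcoeff_minus\<close>)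
    then show "0 \<le> f y" by simp
  qed
  \<comment> \<open>The concentration argument needs an interior point; continuity supplies the two
    endpoints.\<close>
  have "closure {-l/2<..<l/2} = {-l/2..l/2}" using l by (intro closure_greaterThanLessThan) auto
  then show ?thesis
    using continuous_constant_on_closure[of "{-l/2<..<l/2}" f 0 y] f y int by auto
qed

section \<open>Periodic functions and their Fourier series\<close>

lemma periodic_on_R_int:
  assumes "periodic_on_R l f" shows "f (y + of_int k * l) = f y"
proof -
  have n: "f (y + of_nat n * l) = f y" for n :: nat and y
  proof (induction n)
    case (Suc n)
    have "f ((y + of_nat n * l) + l) = f (y + of_nat n * l)"
      using assms unfolding periodic_on_R_def by blast
    then show ?case using Suc by (simp add: algebra_simps)
  qed simp
  show ?thesis
  proof (cases "k \<ge> 0")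
    case True then show ?thesis using n[of y "nat k"] by simp
  next
    case False then show ?thesis using n[of "y + of_int k * l" "nat (- k)"] by (simp add: algebra_simps)
  qed
qed

lemma periodic_on_R_reduce:
  fixes y l :: real
  assumes "l > 0"
  obtains k :: int where "y + of_int k * l \<in> {-l/2..l/2}"
proof -
  define k where "k = \<lfloor>y / l + 1/2\<rfloor>"
  have "of_int k \<le> y / l + 1/2" "y / l + 1/2 < of_int k + 1" unfolding k_def by linarith+
  then have "y + of_int (- k) * l \<in> {-l/2..l/2}"
    using assms by (auto simp: field_simps)
  then show ?thesis by (rule that)
qed

lemma periodic_on_R_eqI:
  assumes "l > 0" "periodic_on_R l f" "periodic_on_R l g" "\<And>y. y \<in> {-l/2..l/2} \<Longrightarrow> f y = g y"
  shows "f y = g y"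
  using periodic_on_R_reduce[OF assms(1), of y] periodic_on_R_int[OF assms(2)] periodic_on_R_int[OF assms(3)] assms(4)
  by metis

text \<open>Taking the real part makes the synthesis a real function without side conditions.
  Nothing is lost for conjugate symmetric coefficients, by \<open>fseries_complex\<close>.\<close>

definition fseries :: "real \<Rightarrow> (int \<Rightarrow> complex) \<Rightarrow> real \<Rightarrow> real" where
  "fseries l U y = Re (\<Sum>\<^sub>\<infinity>i. U i * fexp l i y)"

lemma wt_dominated_summable:
  assumes "2 \<le> q" shows "(\<lambda>i. A / wt i ^ q) summable_on UNIV"
  using summable_on_cmult_right[OF wt_summable[OF assms], of A] by simp

lemma fseries_summable:
  assumes "2 \<le> q" "\<And>i. norm (U i) \<le> A / wt i ^ q"
  shows "(\<lambda>i. U i * fexp l i y) summable_on UNIV"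
  by (rule infsum_dominated(1)[OF _ wt_dominated_summable[OF assms(1)]]) (use assms in \<open>auto simp: norm_mult\<close>)

lemma fseries_complex:
  assumes q: "2 \<le> q" and U: "\<And>i. norm (U i) \<le> A / wt i ^ q" and s: "\<And>i. U (- i) = cnj (U i)"
  shows "of_real (fseries l U y) = (\<Sum>\<^sub>\<infinity>i. U i * fexp l i y)"
proof -
  have b: "bij_betw (\<lambda>i. - i) UNIV (UNIV :: int set)"
    by (rule bij_betwI[where g = "\<lambda>i. - i"]) auto
  have "cnj (\<Sum>\<^sub>\<infinity>i. U i * fexp l i y) = (\<Sum>\<^sub>\<infinity>i. cnj (U i * fexp l i y))"
    by (simp only: infsum_cnj)
  also have "\<dots> = (\<Sum>\<^sub>\<infinity>i. U (- i) * fexp l (- i) y)" by (simp add: cnj_fexp s)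
  also have "\<dots> = (\<Sum>\<^sub>\<infinity>i. U i * fexp l i y)"
    by (rule infsum_reindex_bij_betw[OF b])
  finally show ?thesis unfolding fseries_def
    by (simp add: Reals_cnj_iff)
qed

lemma fseries_bound:
  assumes "\<And>i. norm (U i) \<le> A / wt i ^ 2"
  shows "\<bar>fseries l U y\<bar> \<le> A * conv_const 2"
proof -
  have "norm (\<Sum>\<^sub>\<infinity>i. U i * fexp l i y) \<le> (\<Sum>\<^sub>\<infinity>i. A / wt i ^ 2)"
    by (rule infsum_dominated(2)[OF _ wt_dominated_summable]) (use assms in \<open>auto simp: norm_mult\<close>)
  also have "\<dots> = A * (\<Sum>\<^sub>\<infinity>i. 1 / wt i ^ 2)"
    using infsum_cmult_right'[of A "\<lambda>i. 1 / wt i ^ 2" UNIV] by simp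
  \<comment> \<open>The sum is enlarged by 8 to reuse \<open>conv_const 2\<close> instead of
    introducing another constant.\<close>
  also have "\<dots> \<le> A * (8 * (\<Sum>\<^sub>\<infinity>i. 1 / wt i ^ 2))"
  proof (intro mult_left_mono)
    show "0 \<le> A" using order_trans[OF norm_ge_zero assms[of 0]] by (simp add: wt_0)
    have "0 \<le> (\<Sum>\<^sub>\<infinity>i. 1 / wt i ^ 2)" by (intro infsum_nonneg) auto
    then show "(\<Sum>\<^sub>\<infinity>i. 1 / (wt i)\<^sup>2) \<le> 8 * (\<Sum>\<^sub>\<infinity>i. 1 / (wt i)\<^sup>2)" by linarith
  qed
  also have "\<dots> = A * conv_const 2" by (simp add: conv_const_def)
  finally show ?thesis unfolding fseries_def using abs_Re_le_cmod order_trans by blast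
qed

lemma fseries_periodic: "l > 0 \<Longrightarrow> periodic_on_R l (fseries l U)"
  by (simp add: periodic_on_R_def fseries_def fexp_periodic)

lemma fseries_continuous:
  fixes U :: "'t::topological_space \<Rightarrow> int \<Rightarrow> complex"
  assumes "2 \<le> q" "\<And>x i. x \<in> S \<Longrightarrow> norm (U x i) \<le> A / wt i ^ q" "\<And>i. continuous_on S (\<lambda>x. U x i)" "continuous_on S g"
  shows "continuous_on S (\<lambda>x. fseries l (U x) (g x))"
  unfolding fseries_def
  by (intro continuous_on_Re continuous_on_infsum[OF _ _ wt_dominated_summable[OF assms(1)]] continuous_intros assms)
    (use assms in \<open>auto simp: norm_mult\<close>)

lemma fseries_continuous_y:
  assumes "2 \<le> q" "\<And>i. norm (U i) \<le> A / wt i ^ q"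
  shows "continuous_on S (fseries l U)"
  using fseries_continuous[OF assms(1), of S "\<lambda>_. U" A "\<lambda>x. x"] assms(2) by simp

text \<open>Orthogonality of the exponentials, integrated term by term. Conjugate symmetry enters
  because \<open>fseries\<close> keeps only the real part of the sum.\<close>

lemma fcoeff_fseries:
  assumes l: "l > 0" and q: "2 \<le> q" and U: "\<And>i. norm (U i) \<le> A / wt i ^ q" and s: "\<And>i. U (- i) = cnj (U i)"
  shows "fcoeff l (fseries l U) j = U j"
proof -
  have e: "of_real (fseries l U y) * fexp l (- j) y = (\<Sum>\<^sub>\<infinity>i. U i * fexp l (i - j) y)" for y
    unfolding fseries_complex[OF q U s]
    by (subst infsum_cmult_left'[symmetric]) (simp add: mult.assoc flip: fexp_add)
  have "((\<lambda>i. integral {-l/2..l/2} (\<lambda>y. U i * fexp l (i - j) y)) has_sum integral {-l/2..l/2} (\<lambda>y. of_real (fseries l U y) * fexp l (- j) y)) UNIV"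
    unfolding e by (rule integral_infsum[OF _ _ wt_dominated_summable[OF q, of A]])
      (use U in \<open>auto simp: norm_mult intro!: continuous_intros\<close>)
  moreover have "integral {-l/2..l/2} (\<lambda>y. U i * fexp l (i - j) y) = (if i = j then U j * of_real l else 0)" for i
    using integral_fexp[OF l, of "i - j"] by (auto simp: fun_eq_iff)
  moreover have "((\<lambda>i. if i = j then U j * of_real l else 0) has_sum U j * of_real l) UNIV"
    by (rule has_sum_finite_neutralI[where B = "{j}"]) auto
  ultimately have "integral {-l/2..l/2} (\<lambda>y. of_real (fseries l U y) * fexp l (- j) y) = U j * of_real l"
    using has_sum_unique by fastforce
  then show ?thesis using l by (simp add: fcoeff_def)
qed

text \<open>The function and its series have the same coefficients, so \<open>fcoeff_inj\<close>
  identifies them on one period. The assumed decay makes the series converge absolutely, which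
  settles all convergence questions.\<close>

lemma fseries_repr:
  assumes l: "l > 0" and f: "continuous_on UNIV f" "periodic_on_R l f" and q: "2 \<le> q"
    and b: "\<And>i. norm (fcoeff l f i) \<le> A / wt i ^ q"
  shows "f y = fseries l (fcoeff l f) y"
proof (rule periodic_on_R_eqI[OF l f(2) fseries_periodic[OF l]])
  fix y assume y: "y \<in> {-l/2..l/2}"
  have c: "continuous_on {-l/2..l/2} f" using f(1) continuous_on_subset by blast
  have s: "fcoeff l f (- i) = cnj (fcoeff l f i)" for i by (rule fcoeff_cnj[OF c])
  have "fcoeff l (\<lambda>y. f y - fseries l (fcoeff l f) y) j = 0" for j
    by (subst fcoeff_diff[OF c fseries_continuous_y[OF q b]]) (simp add: fcoeff_fseries[OF l q b s])
  then have "f y - fseries l (fcoeff l f) y = 0"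
    by (intro fcoeff_inj[OF l _ _ y, of "\<lambda>y. f y - fseries l (fcoeff l f) y"] continuous_intros c fseries_continuous_y[OF q b]) auto
  then show "f y = fseries l (fcoeff l f) y" by simp
qed

text \<open>Only \<open>g\<close> is expanded in its series, hence the asymmetric hypotheses;
  integrating \<open>f\<close> against each shifted exponential then returns a coefficient of
  \<open>f\<close>.\<close>

lemma fcoeff_mult:
  assumes l: "l > 0" and f: "continuous_on UNIV f" and g: "continuous_on UNIV g" "periodic_on_R l g"
    and q: "2 \<le> q" and b: "\<And>i. norm (fcoeff l g i) \<le> A / wt i ^ q"
  shows "fcoeff l (\<lambda>y. f y * g y) j = conv (fcoeff l f) (fcoeff l g) j"
proof -
  have c: "continuous_on {-l/2..l/2} f" "continuous_on {-l/2..l/2} g"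
    using f g(1) continuous_on_subset by blast+
  have s: "fcoeff l g (- i) = cnj (fcoeff l g i)" for i by (rule fcoeff_cnj[OF c(2)])
  obtain B where B: "\<And>y. y \<in> {-l/2..l/2} \<Longrightarrow> norm (f y) \<le> B"
    using compact_imp_bounded[OF compact_continuous_image[OF c(1) compact_Icc]] unfolding bounded_iff by fastforce
  have B0: "0 \<le> B" using order_trans[OF norm_ge_zero B[of 0]] l by simp
  have e: "of_real (f y * g y) * fexp l (- j) y = (\<Sum>\<^sub>\<infinity>i. of_real (f y) * fcoeff l g i * fexp l (i - j) y)" for y
  proof -
    have "of_real (g y) = (\<Sum>\<^sub>\<infinity>i. fcoeff l g i * fexp l i y)"
      using fseries_repr[OF l g q b] fseries_complex[OF q b s] by metis
    then have "of_real (f y * g y) * fexp l (- j) y = (of_real (f y) * fexp l (- j) y) * (\<Sum>\<^sub>\<infinity>i. fcoeff l g i * fexp l i y)"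
      by simp
    also have "\<dots> = (\<Sum>\<^sub>\<infinity>i. (of_real (f y) * fexp l (- j) y) * (fcoeff l g i * fexp l i y))"
      by (rule infsum_cmult_right'[symmetric])
    finally show ?thesis
      using fexp_add[of l _ "- j" y] by (simp add: mult_ac)
  qed
  have "((\<lambda>i. integral {-l/2..l/2} (\<lambda>y. of_real (f y) * fcoeff l g i * fexp l (i - j) y)) has_sum
      integral {-l/2..l/2} (\<lambda>y. of_real (f y * g y) * fexp l (- j) y)) UNIV"
    unfolding e
  proof (rule integral_infsum[OF _ _ wt_dominated_summable[OF q, of "B * A"]])
    show "continuous_on {-l/2..l/2} (\<lambda>y. of_real (f y) * fcoeff l g i * fexp l (i - j) y)" for i
      by (intro continuous_intros c)
    fix i y assume "y \<in> {-l/2..l/2}"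
    then show "norm (of_real (f y) * fcoeff l g i * fexp l (i - j) y) \<le> B * A / wt i ^ q"
      using mult_mono[OF B[of y] b[of i]] B0 by (simp add: norm_mult)
  qed
  moreover have "integral {-l/2..l/2} (\<lambda>y. of_real (f y) * fcoeff l g i * fexp l (i - j) y) = (fcoeff l f (j - i) * fcoeff l g i) * of_real l" for i
  proof -
    have "integral {-l/2..l/2} (\<lambda>y. of_real (f y) * fcoeff l g i * fexp l (i - j) y) = fcoeff l g i * integral {-l/2..l/2} (\<lambda>y. of_real (f y) * fexp l (i - j) y)"
      by (subst Henstock_Kurzweil_Integration.integral_mult_right[symmetric]) (simp add: mult_ac)
    then show ?thesis using l by (simp add: fcoeff_def)
  qed
  ultimately have "((\<lambda>i. (fcoeff l f (j - i) * fcoeff l g i) * of_real l) has_sum integral {-l/2..l/2} (\<lambda>y. of_real (f y * g y) * fexp l (- j) y)) UNIV"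
    by simp
  then have "(\<Sum>\<^sub>\<infinity>i. (fcoeff l f (j - i) * fcoeff l g i) * of_real l) = integral {-l/2..l/2} (\<lambda>y. of_real (f y * g y) * fexp l (- j) y)"
    by (rule infsumI)
  then have "conv (fcoeff l f) (fcoeff l g) j * of_real l = integral {-l/2..l/2} (\<lambda>y. of_real (f y * g y) * fexp l (- j) y)"
    unfolding conv_def by (simp add: infsum_cmult_left')
  then show ?thesis using l by (simp add: fcoeff_def field_simps)
qed

lemma norm_fderiv: "l > 0 \<Longrightarrow> norm (fderiv l U i) = 2 * pi / l * \<bar>real_of_int i\<bar> * norm (U i)"
  by (simp add: fderiv_def norm_mult norm_divide abs_mult)

lemma fderiv_bound:
  assumes l: "l > 0" and U: "\<And>i. norm (U i) \<le> A / wt i ^ Suc q"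
  shows "norm (fderiv l U i) \<le> (2 * pi / l * A) / wt i ^ q"
proof -
  have "2 * pi / l * \<bar>real_of_int i\<bar> * norm (U i) \<le> 2 * pi / l * wt i * (A / wt i ^ Suc q)"
    using l wt_ge1[of i] by (intro mult_mono U) (auto simp: wt_def)
  also have "\<dots> = (2 * pi / l * A) / wt i ^ q" using wt_pos[of i] by (simp add: field_simps)
  finally show ?thesis using l by (simp add: norm_fderiv)
qed

lemma fderiv_cnj: "(\<And>i. U (- i) = cnj (U i)) \<Longrightarrow> fderiv l U (- i) = cnj (fderiv l U i)"
  by (simp add: fderiv_def)

lemma fderiv_pow_bound:
  assumes l: "l > 0" and U: "\<And>i. norm (U i) \<le> A / wt i ^ (q + m)"
  shows "norm ((fderiv l ^^ m) U i) \<le> ((2 * pi / l) ^ m * A) / wt i ^ q"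
  using U
proof (induction m arbitrary: q i)
  case (Suc m)
  have "norm (fderiv l ((fderiv l ^^ m) U) i) \<le> (2 * pi / l * ((2 * pi / l) ^ m * A)) / wt i ^ q"
    using Suc.prems by (intro fderiv_bound[OF l] Suc.IH) auto
  then show ?case by (simp add: mult_ac)
qed simp

lemma fseries_deriv:
  assumes l: "l > 0" and q: "2 \<le> q" and U: "\<And>i. norm (U i) \<le> A / wt i ^ Suc q"
  shows "(fseries l U has_real_derivative fseries l (fderiv l U) y) (at y)"
proof -
  let ?F = "\<lambda>y. \<Sum>\<^sub>\<infinity>i. U i * fexp l i y"
  let ?F' = "\<lambda>y. \<Sum>\<^sub>\<infinity>i. fderiv l U i * fexp l i y"
  \<comment> \<open>Termwise differentiation is available on compact intervals, so y is placed in
    the interior of one.\<close>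
  have "(?F has_vector_derivative ?F' y) (at y within {y-1..y+1})"
  proof (rule has_vector_derivative_infsum[OF _ _ _ _ _ wt_dominated_summable[OF q, of "2 * pi / l * A"]])
    fix i :: int and x
    show "((\<lambda>y. U i * fexp l i y) has_vector_derivative fderiv l U i * fexp l i x) (at x within {y-1..y+1})"
      using bounded_linear.has_vector_derivative[OF bounded_linear_mult_right fexp_deriv, of "U i" l i x "{y-1..y+1}"]
      by (simp add: fderiv_def mult_ac)
    show "norm (fderiv l U i * fexp l i x) \<le> (2 * pi / l * A) / wt i ^ q"
      using fderiv_bound[OF l U] by (simp add: norm_mult)
    have "q \<le> Suc q" by simp
    then show "(\<lambda>i. U i * fexp l i x) summable_on UNIV"
      using q by (intro fseries_summable[OF _ U]) auto
  qed (auto intro!: continuous_intros)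
  then have "(?F has_vector_derivative ?F' y) (at y)"
    by (subst (asm) at_within_Icc_at) auto
  then have "((\<lambda>y. Re (?F y)) has_vector_derivative Re (?F' y)) (at y)"
    by (rule bounded_linear.has_vector_derivative[OF bounded_linear_Re])
  then show ?thesis
    by (simp add: fseries_def[abs_def] has_real_derivative_iff_has_vector_derivative)
qed

text \<open>Iterated \<open>deriv\<close> is a total operator and says nothing about
  differentiability. A chain of candidate derivatives both identifies the iterates and proves that
  they are derivatives.\<close>

lemma deriv_pow_chain:
  assumes d: "\<And>k y. k < m \<Longrightarrow> (F k has_real_derivative F (Suc k) y) (at y)"
  shows "k \<le> m \<Longrightarrow> (deriv ^^ k) (F 0) = F k"
    and "k < m \<Longrightarrow> ((deriv ^^ k) (F 0) has_real_derivative (deriv ^^ Suc k) (F 0) y) (at y)"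
proof -
  show 1: "(deriv ^^ k) (F 0) = F k" if "k \<le> m" for k
    using that
  proof (induction k)
    case (Suc k)
    then have "(deriv ^^ Suc k) (F 0) = deriv (F k)" by simp
    also have "\<dots> = F (Suc k)" by (rule ext, rule DERIV_imp_deriv, rule d) (use Suc.prems in simp)
    finally show ?case .
  qed simp
  show "((deriv ^^ k) (F 0) has_real_derivative (deriv ^^ Suc k) (F 0) y) (at y)" if "k < m"
    using that d[OF that, of y] 1[of k] 1[of "Suc k"] by simp
qed

lemma fseries_deriv_pow:
  assumes l: "l > 0" and U: "\<And>i. norm (U i) \<le> A / wt i ^ (2 + m)"
  shows "k \<le> m \<Longrightarrow> (deriv ^^ k) (fseries l U) = fseries l ((fderiv l ^^ k) U)"
    and "k < m \<Longrightarrow> ((deriv ^^ k) (fseries l U) has_real_derivative (deriv ^^ Suc k) (fseries l U) y) (at y)"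
proof -
  have 1: "(fseries l ((fderiv l ^^ k) U) has_real_derivative fseries l ((fderiv l ^^ Suc k) U) y) (at y)" if "k < m" for k y
  proof -
    have "norm ((fderiv l ^^ k) U i) \<le> ((2 * pi / l) ^ k * A) / wt i ^ (2 + m - k)" for i
      using that U by (intro fderiv_pow_bound[OF l]) auto
    then have "norm ((fderiv l ^^ k) U i) \<le> ((2 * pi / l) ^ k * A) / wt i ^ (Suc (1 + m - k))" for i
      using that by (simp add: Suc_diff_le)
    from fseries_deriv[OF l _ this] that show ?thesis by simp
  qed
  note chain = deriv_pow_chain[of m "\<lambda>k. fseries l ((fderiv l ^^ k) U)", OF 1]
  show "k \<le> m \<Longrightarrow> (deriv ^^ k) (fseries l U) = fseries l ((fderiv l ^^ k) U)"
    and "k < m \<Longrightarrow> ((deriv ^^ k) (fseries l U) has_real_derivative (deriv ^^ Suc k) (fseries l U) y) (at y)"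
    using chain[of k] by simp_all
qed

lemma fseries_time_deriv:
  assumes T: "T > 0" "t \<in> {0..T}" and q: "2 \<le> q"
    and U: "\<And>t i. t \<in> {0..T} \<Longrightarrow> norm (U t i) \<le> A / wt i ^ q"
    and U': "\<And>t i. t \<in> {0..T} \<Longrightarrow> norm (U' t i) \<le> A' / wt i ^ q"
    and c: "\<And>i. continuous_on {0..T} (\<lambda>t. U' t i)"
    and d: "\<And>t i. t \<in> {0..T} \<Longrightarrow> ((\<lambda>t. U t i) has_vector_derivative U' t i) (at t within {0..T})"
  shows "((\<lambda>t. fseries l (U t) y) has_real_derivative fseries l (U' t) y) (at t within {0..T})"
proof -
  have "((\<lambda>t. \<Sum>\<^sub>\<infinity>i. U t i * fexp l i y) has_vector_derivative (\<Sum>\<^sub>\<infinity>i. U' t i * fexp l i y)) (at t within {0..T})"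
  proof (rule has_vector_derivative_infsum[OF T _ _ _ wt_dominated_summable[OF q, of A']])
    fix i t assume t: "t \<in> {0..T}"
    show "((\<lambda>t. U t i * fexp l i y) has_vector_derivative U' t i * fexp l i y) (at t within {0..T})"
      by (rule bounded_linear.has_vector_derivative[OF bounded_linear_mult_left d[OF t]])
    show "norm (U' t i * fexp l i y) \<le> A' / wt i ^ q" using U'[OF t] by (simp add: norm_mult)
    show "(\<lambda>i. U t i * fexp l i y) summable_on UNIV" by (rule fseries_summable[OF q U[OF t]])
  qed (intro continuous_intros c)
  then have "((\<lambda>t. Re (\<Sum>\<^sub>\<infinity>i. U t i * fexp l i y)) has_vector_derivative Re (\<Sum>\<^sub>\<infinity>i. U' t i * fexp l i y)) (at t within {0..T})"
    by (rule bounded_linear.has_vector_derivative[OF bounded_linear_Re])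
  then show ?thesis
    by (simp add: fseries_def[abs_def] has_real_derivative_iff_has_vector_derivative)
qed

section \<open>Linear decay with forcing and the fixed point\<close>

text \<open>In the norm weighted by \<open>exp (- \<gamma> * t)\<close> the decay rate \<open>a\<close> becomes \<open>a + \<gamma>\<close>, so a possibly negative
  rate is harmless and the solution gains the full factor \<open>1 / (a + \<gamma>)\<close> over the forcing.\<close>

lemma ode_bound:
  fixes z g :: "real \<Rightarrow> complex"
  assumes t: "t \<in> {0..T}"
    and z: "\<And>s. s \<in> {0..T} \<Longrightarrow> (z has_vector_derivative (- of_real a * z s + g s)) (at s within {0..T})"
    and g: "\<And>s. s \<in> {0..T} \<Longrightarrow> norm (g s) \<le> G * exp (\<gamma> * s)" and a: "a + \<gamma> > 0"
  shows "norm (z t) \<le> exp (\<gamma> * t) * (norm (z 0) + G / (a + \<gamma>))"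
proof (cases "t = 0")
  case True
  have "0 \<le> G" using order_trans[OF norm_ge_zero g[of 0]] t by simp
  then show ?thesis using True a by simp
next
  case False
  then have t0: "0 < t" using t by simp
  let ?\<phi> = "\<lambda>s. G / (a + \<gamma>) * exp ((a + \<gamma>) * s)"
  let ?f = "\<lambda>s. exp (a * s) *\<^sub>R z s"
  have G: "0 \<le> G" using order_trans[OF norm_ge_zero g[of 0]] t by simp
  \<comment> \<open>The integrating factor exp(a s) removes the linear term. The mean value
    inequality then compares \<open>?f\<close> with \<open>?\<phi>\<close>, a primitive of the bound
    for the forcing.\<close>
  have "norm (?f t - ?f 0) \<le> ?\<phi> t - ?\<phi> 0"
  proof (rule differentiable_bound_general[OF t0, of _ _ "\<lambda>s. exp (a * s) *\<^sub>R g s" "\<lambda>s. G * exp ((a + \<gamma>) * s)"])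
    have "continuous_on {0..T} z"
      using z has_vector_derivative_continuous continuous_on_eq_continuous_within by blast
    then have "continuous_on {0..t} z" using t continuous_on_subset[of "{0..T}" z "{0..t}"] by auto
    then show "continuous_on {0..t} ?f" by (intro continuous_intros)
    show "continuous_on {0..t} ?\<phi>" by (intro continuous_intros)
    fix s assume s: "0 < s" "s < t"
    then have sT: "s \<in> {0..T}" "s \<in> {0<..<T}" using t by auto
    have "(z has_vector_derivative (- of_real a * z s + g s)) (at s)"
      using z[OF sT(1)] sT(2) by (simp add: at_within_Icc_at)
    then have "(?f has_vector_derivative (exp (a * s) *\<^sub>R (- of_real a * z s + g s) + (exp (a * s) * a) *\<^sub>R z s)) (at s)"
      by (intro has_vector_derivative_scaleR) (auto intro!: derivative_eq_intros)
    then show "(?f has_vector_derivative exp (a * s) *\<^sub>R g s) (at s)"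
      by (simp add: scaleR_conv_of_real algebra_simps)
    show "(?\<phi> has_vector_derivative G * exp ((a + \<gamma>) * s)) (at s)"
      unfolding has_real_derivative_iff_has_vector_derivative[symmetric] using a
      by (auto intro!: derivative_eq_intros)
    have "norm (exp (a * s) *\<^sub>R g s) \<le> exp (a * s) * (G * exp (\<gamma> * s))"
      unfolding norm_scaleR by (simp add: g[OF sT(1)])
    also have "\<dots> = G * exp ((a + \<gamma>) * s)" by (simp add: distrib_right exp_add)
    finally show "norm (exp (a * s) *\<^sub>R g s) \<le> G * exp ((a + \<gamma>) * s)" .
  qed
  then have "norm (?f t) \<le> norm (z 0) + G / (a + \<gamma>) * (exp ((a + \<gamma>) * t) - 1)"
    using norm_triangle_sub[of "?f t" "?f 0"] by (simp add: algebra_simps)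
  also have "\<dots> \<le> exp ((a + \<gamma>) * t) * (norm (z 0) + G / (a + \<gamma>))"
  proof -
    have "1 \<le> exp ((a + \<gamma>) * t)" using a t0 by simp
    then have "norm (z 0) * 1 \<le> norm (z 0) * exp ((a + \<gamma>) * t)" by (intro mult_left_mono) auto
    moreover have "0 \<le> G / (a + \<gamma>)" using G a by simp
    ultimately show ?thesis by (simp add: algebra_simps)
  qed
  also have "\<dots> = exp (a * t) * (exp (\<gamma> * t) * (norm (z 0) + G / (a + \<gamma>)))"
    by (simp add: distrib_right exp_add)
  finally have "exp (a * t) * norm (z t) \<le> exp (a * t) * (exp (\<gamma> * t) * (norm (z 0) + G / (a + \<gamma>)))"
    by simp
  then show ?thesis by (simp only: mult_le_cancel_left_pos exp_gt_zero)
qed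

section \<open>Solution by Duhamel's formula and contraction\<close>

definition duhamel :: "real \<Rightarrow> (real \<Rightarrow> complex) \<Rightarrow> real \<Rightarrow> complex" where
  "duhamel a g t = exp (- a * t) *\<^sub>R integral {0..t} (\<lambda>s. exp (a * s) *\<^sub>R g s)"

lemma duhamel_0: "duhamel a g 0 = 0" by (simp add: duhamel_def)

lemma duhamel_deriv:
  assumes g: "continuous_on {0..T} g" and t: "t \<in> {0..T}"
  shows "(duhamel a g has_vector_derivative (- of_real a * duhamel a g t + g t)) (at t within {0..T})"
proof -
  have "((\<lambda>t. integral {0..t} (\<lambda>s. exp (a * s) *\<^sub>R g s)) has_vector_derivative exp (a * t) *\<^sub>R g t) (at t within {0..T})"
    by (rule integral_has_vector_derivative[OF _ t]) (intro continuous_intros g)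
  then have "((\<lambda>t. exp (- a * t) *\<^sub>R integral {0..t} (\<lambda>s. exp (a * s) *\<^sub>R g s)) has_vector_derivative
      (exp (- a * t) *\<^sub>R (exp (a * t) *\<^sub>R g t) + (exp (- a * t) * (- a)) *\<^sub>R integral {0..t} (\<lambda>s. exp (a * s) *\<^sub>R g s))) (at t within {0..T})"
    by (intro has_vector_derivative_scaleR) (auto intro!: derivative_eq_intros)
  moreover have "exp (- a * t) *\<^sub>R (exp (a * t) *\<^sub>R g t) = g t"
    by (simp flip: exp_add)
  moreover have "(exp (- a * t) * (- a)) *\<^sub>R integral {0..t} (\<lambda>s. exp (a * s) *\<^sub>R g s) = - of_real a * duhamel a g t"
    by (simp add: duhamel_def scaleR_conv_of_real mult_ac)
  moreover have "duhamel a g = (\<lambda>t. exp (- a * t) *\<^sub>R integral {0..t} (\<lambda>s. exp (a * s) *\<^sub>R g s))"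
    by (simp add: duhamel_def fun_eq_iff)
  ultimately show ?thesis by (simp only: add.commute)
qed

text \<open>The slices over single points of a discrete factor are open, so continuity may be
  checked on each of them. This is how a family of coefficients, each continuous in time, becomes
  one continuous function on a product.\<close>

lemma continuous_on_discrete_prod:
  fixes h :: "'a::discrete_topology \<Rightarrow> 'b::topological_space \<Rightarrow> 'c::topological_space"
  assumes "\<And>j. continuous_on UNIV (h j)"
  shows "continuous_on UNIV (\<lambda>x. h (fst x) (snd x))"
proof -
  have "continuous_on (\<Union>j\<in>UNIV. {j} \<times> UNIV) (\<lambda>x. h (fst x) (snd x))"
  proof (rule continuous_on_open_UN)
    show "open ({j} \<times> (UNIV :: 'b set))" for j :: 'a by (intro open_Times open_discrete open_UNIV)
    show "continuous_on ({j} \<times> UNIV) (\<lambda>x. h (fst x) (snd x))" for j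
    proof (subst continuous_on_cong[OF refl])
      show "h (fst x) (snd x) = h j (snd x)" if "x \<in> {j} \<times> UNIV" for x using that by auto
      show "continuous_on ({j} \<times> UNIV) (\<lambda>x. h j (snd x))"
        by (rule continuous_on_compose2[OF assms]) (auto intro!: continuous_intros)
    qed
  qed
  moreover have "(\<Union>j\<in>UNIV. {j} \<times> UNIV) = (UNIV :: ('a \<times> 'b) set)" by auto
  ultimately show ?thesis by metis
qed

text \<open>Each application of \<open>ode_bound\<close> halves the constant in the bound for \<open>w\<close>.\<close>

lemma coefficient_unique:
  fixes a M :: "int \<Rightarrow> real" and Q w :: "real \<Rightarrow> int \<Rightarrow> complex"
  assumes l: "l > 0" and a: "\<And>j. a j + \<gamma> > 0" and M: "\<And>j. \<bar>M j\<bar> * wt j \<le> \<delta> * (a j + \<gamma>)"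
    and small: "conv_const 3 * \<delta> * (2 * pi / l) * K \<le> 1/2" and \<delta>: "0 \<le> \<delta>" and \<gamma>: "0 \<le> \<gamma>"
    and Q: "\<And>t j. t \<in> {0..S} \<Longrightarrow> norm (Q t j) \<le> K / wt j ^ 3"
    and w: "\<And>t j. t \<in> {0..S} \<Longrightarrow> norm (w t j) \<le> B / wt j ^ 4" and w0: "\<And>j. w 0 j = 0"
    and d: "\<And>t j. t \<in> {0..S} \<Longrightarrow> ((\<lambda>s. w s j) has_vector_derivative
      (- of_real (a j) * w t j + of_real (M j) * conv (Q t) (fderiv l (w t)) j)) (at t within {0..S})"
    and t: "t \<in> {0..S}"
  shows "w t j = 0"
proof -
  have B: "0 \<le> B" using order_trans[OF norm_ge_zero w[OF t, of 0]] by (simp add: wt_0)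
  have K: "0 \<le> K" using order_trans[OF norm_ge_zero Q[OF t, of 0]] by (simp add: wt_0)
  define \<omega> where "\<omega> = 2 * pi / l"
  have \<omega>: "0 < \<omega>" using l by (simp add: \<omega>_def)
  have bd: "norm (w t j) \<le> B / 2 ^ k * exp (\<gamma> * t) / wt j ^ 4" if "t \<in> {0..S}" for k t j
    using that
  proof (induction k arbitrary: t j)
    case 0
    have "B / wt j ^ 4 * 1 \<le> B / wt j ^ 4 * exp (\<gamma> * t)"
      using 0 \<gamma> B wt_pos[of j] by (intro mult_left_mono) auto
    then show ?case using w[OF 0, of j] by simp
  next
    case (Suc k)
    define b where "b = B / 2 ^ k"
    have b: "0 \<le> b" using B by (simp add: b_def)
    have "norm (w t j) \<le> exp (\<gamma> * t) * (norm (w 0 j) + (1/2 * b * (a j + \<gamma>) / wt j ^ 4) / (a j + \<gamma>))"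
    proof (rule ode_bound[OF Suc.prems d _ a])
      fix s assume s: "s \<in> {0..S}"
      have IH: "norm (w s i) \<le> b * exp (\<gamma> * s) / wt i ^ Suc 3" for i
        using Suc.IH[OF s, of i] by (simp add: b_def eval_nat_numeral)
      have "norm (of_real (M j) * conv (Q s) (fderiv l (w s)) j) \<le> \<bar>M j\<bar> * (conv_const 3 * K * (\<omega> * (b * exp (\<gamma> * s))) / wt j ^ 3)"
        unfolding norm_mult norm_of_real \<omega>_def
        by (intro mult_left_mono conv_bound Q[OF s] fderiv_bound[OF l IH]) auto
      \<comment> \<open>Differentiation has lowered the decay from 4 to 3. The missing power is lent
        to \<open>M\<close>, whose hypothesis bounds \<open>M\<close> together with one weight by
        the rate.\<close>
      also have "\<dots> = (\<bar>M j\<bar> * wt j) * (conv_const 3 * K * \<omega> * b * exp (\<gamma> * s) / wt j ^ 4)"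
        using wt_pos[of j] by (simp add: field_simps eval_nat_numeral)
      also have "\<dots> \<le> (\<delta> * (a j + \<gamma>)) * (conv_const 3 * K * \<omega> * b * exp (\<gamma> * s) / wt j ^ 4)"
        using conv_const_pos[of 3] K \<omega> b wt_pos[of j] by (intro mult_right_mono M) auto
      also have "\<dots> = (conv_const 3 * \<delta> * \<omega> * K) * ((a j + \<gamma>) * b * exp (\<gamma> * s) / wt j ^ 4)"
        by simp
      also have "\<dots> \<le> 1/2 * ((a j + \<gamma>) * b * exp (\<gamma> * s) / wt j ^ 4)"
        using small a[of j] b wt_pos[of j] by (intro mult_right_mono) (auto simp: \<omega>_def)
      finally show "norm (of_real (M j) * conv (Q s) (fderiv l (w s)) j) \<le> 1/2 * b * (a j + \<gamma>) / wt j ^ 4 * exp (\<gamma> * s)"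
        by (simp add: mult_ac)
    qed
    then show ?case using a[of j] by (simp add: w0 b_def mult_ac)
  qed
  have "(\<lambda>k. B * exp (\<gamma> * t) / wt j ^ 4 * (1 / 2) ^ k) \<longlonglongrightarrow> B * exp (\<gamma> * t) / wt j ^ 4 * 0"
    by (intro tendsto_intros) auto
  moreover have "norm (w t j) \<le> B * exp (\<gamma> * t) / wt j ^ 4 * (1 / 2) ^ k" for k
    using bd[OF t, of j k] by (simp add: field_simps)
  ultimately have "norm (w t j) \<le> 0"
    by (intro LIMSEQ_le_const[of "\<lambda>k. B * exp (\<gamma> * t) / wt j ^ 4 * (1 / 2) ^ k"]) auto
  then show ?thesis by simp
qed

text \<open>Both constraints survive pointwise limits, and convergence in the supremum norm implies
  pointwise convergence. The symmetry is imposed here so that the fixed point is the coefficient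
  family of a real function.\<close>

lemma complete_bcontfun_constraints:
  "complete {r :: (int \<times> real) \<Rightarrow>\<^sub>C complex. (\<forall>x. norm (r x) \<le> C) \<and> (\<forall>j t. r (- j, t) = cnj (r (j, t)))}"
proof (rule completeI)
  fix r :: "nat \<Rightarrow> (int \<times> real) \<Rightarrow>\<^sub>C complex"
  assume r: "\<forall>n. r n \<in> {r. (\<forall>x. norm (apply_bcontfun r x) \<le> C) \<and> (\<forall>j t. apply_bcontfun r (- j, t) = cnj (apply_bcontfun r (j, t)))}"
    and c: "Cauchy r"
  from c obtain g where "uniform_limit UNIV r g sequentially"
    using uniformly_convergent_eq_cauchy[of "\<lambda>_. True" r]
    unfolding Cauchy_def uniform_limit_sequentially_iff
    by (metis dist_fun_lt_imp_dist_val_lt)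
  from uniform_limit_bcontfunE[OF this sequentially_bot]
  obtain L where lim: "r \<longlonglongrightarrow> L" by metis
  have p: "(\<lambda>n. r n x) \<longlonglongrightarrow> L x" for x
    by (rule tendsto_uniform_limitI[OF tendsto_bcontfun_uniform_limit[OF lim]]) simp
  have "norm (L x) \<le> C" for x
    by (rule LIMSEQ_le_const2[OF tendsto_norm[OF p]]) (use r in blast)
  moreover have "L (- j, t) = cnj (L (j, t))" for j t
  proof (rule LIMSEQ_unique[OF p])
    have "(\<lambda>n. cnj (r n (j, t))) \<longlonglongrightarrow> cnj (L (j, t))" by (intro tendsto_cnj p)
    then show "(\<lambda>n. r n (- j, t)) \<longlonglongrightarrow> cnj (L (j, t))" using r by simp
  qed
  ultimately show "\<exists>L\<in>{r. (\<forall>x. norm (apply_bcontfun r x) \<le> C) \<and> (\<forall>j t. apply_bcontfun r (- j, t) = cnj (apply_bcontfun r (j, t)))}. r \<longlonglongrightarrow> L"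
    using lim by blast
qed

text \<open>The Banach space is the bounded continuous functions \<open>r\<close> on \<open>int \<times> real\<close>, where \<open>r (j, t)\<close> is the
  \<open>j\<close>-th coefficient at time \<open>t\<close> multiplied by \<open>exp (- \<gamma> * t) * wt j ^ 6\<close>.\<close>

lemma coefficient_fixpoint:
  fixes a M :: "int \<Rightarrow> real" and P G :: "real \<Rightarrow> int \<Rightarrow> complex"
  assumes l: "l > 0" and T: "T > 0" and \<gamma>: "0 \<le> \<gamma>" and \<delta>: "0 \<le> \<delta>" and \<kappa>: "0 \<le> \<kappa>"
    and a: "\<And>j. a j + \<gamma> > 0" and M: "\<And>j. \<bar>M j\<bar> * wt j \<le> \<delta> * (a j + \<gamma>)"
    and even: "\<And>j. a (- j) = a j" "\<And>j. M (- j) = M j"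
    and P: "\<And>t j. t \<in> {0..T} \<Longrightarrow> norm (P t j) \<le> K / wt j ^ 5" "\<And>j. continuous_on {0..T} (\<lambda>t. P t j)"
      "\<And>t j. t \<in> {0..T} \<Longrightarrow> P t (- j) = cnj (P t j)"
    and G: "\<And>t j. t \<in> {0..T} \<Longrightarrow> norm (G t j) \<le> \<kappa> * (a j + \<gamma>) / wt j ^ 6" "\<And>j. continuous_on {0..T} (\<lambda>t. G t j)"
      "\<And>t j. t \<in> {0..T} \<Longrightarrow> G t (- j) = cnj (G t j)"
    and small: "conv_const 5 * \<delta> * (2 * pi / l) * (2 * K + 4 * \<kappa> * (2 * pi / l) * exp (\<gamma> * T)) \<le> 1/2"
  obtains R :: "real \<Rightarrow> int \<Rightarrow> complex"
  where "\<And>j. R 0 j = 0"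
    "\<And>t j. t \<in> {0..T} \<Longrightarrow> norm (R t j) \<le> 2 * \<kappa> * exp (\<gamma> * T) / wt j ^ 6"
    "\<And>t j. t \<in> {0..T} \<Longrightarrow> R t (- j) = cnj (R t j)"
    "\<And>t j. t \<in> {0..T} \<Longrightarrow> ((\<lambda>s. R s j) has_vector_derivative
      (- of_real (a j) * R t j + (of_real (M j) * conv (\<lambda>i. 2 * P t i + fderiv l (R t) i) (fderiv l (R t)) j + G t j))) (at t within {0..T})"
proof -
  define \<omega> where "\<omega> = 2 * pi / l"
  have \<omega>: "0 < \<omega>" using l by (simp add: \<omega>_def)
  have K: "0 \<le> K" using order_trans[OF norm_ge_zero P(1)[of 0 0]] T by (simp add: wt_0)
  define E where "E = exp (\<gamma> * T)"
  have E: "0 < E" by (simp add: E_def)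
  have E1: "exp (\<gamma> * s) \<le> E" if "s \<in> {0..T}" for s
    using that \<gamma> by (auto simp: E_def intro!: mult_left_mono)
  \<comment> \<open>Bound for the first convolution factor on the ball of radius
    \<open>2 * \<kappa>\<close>: \<open>2 * K\<close> from \<open>2 * P\<close> and
    \<open>2 * \<kappa> * \<omega> * E\<close> from the derivative of the unknown.\<close>
  define Q where "Q = 2 * K + 2 * \<kappa> * \<omega> * E"
  have Q: "0 \<le> Q" using K \<kappa> \<omega> E by (simp add: Q_def)
  define R where "R r t j = of_real (exp (\<gamma> * t) / wt j ^ 6) * apply_bcontfun r (j, t)" for r :: "(int \<times> real) \<Rightarrow>\<^sub>C complex" and t j
  define N where "N r t j = of_real (M j) * conv (\<lambda>i. 2 * P t i + fderiv l (R r t) i) (fderiv l (R r t)) j + G t j" for r t j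
  define S :: "((int \<times> real) \<Rightarrow>\<^sub>C complex) set"
    where "S = {r :: (int \<times> real) \<Rightarrow>\<^sub>C complex. (\<forall>x. norm (r x) \<le> 2 * \<kappa>) \<and> (\<forall>j t. r (- j, t) = cnj (r (j, t)))}"
  \<comment> \<open>Elements of the space are functions of all real times; freezing the time outside
    the interval keeps the image of \<open>\<Gamma>\<close> bounded and continuous there.\<close>
  define cl where "cl t = max 0 (min T t)" for t
  have cl: "cl t \<in> {0..T}" for t using T by (auto simp: cl_def)
  have cl_id: "cl t = t" if "t \<in> {0..T}" for t using that by (auto simp: cl_def)
  have ccl: "continuous_on UNIV cl" unfolding cl_def by (intro continuous_intros)
  define z where "z r j = duhamel (a j) (\<lambda>s. N r s j)" for r j
  define h where "h r j t = of_real (exp (- \<gamma> * cl t) * wt j ^ 6) * z r j (cl t)" for r j t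
  define \<Gamma> where "\<Gamma> r = Bcontfun (\<lambda>x. h r (fst x) (snd x))" for r

  have Rb: "norm (fderiv l (R r s) j) \<le> \<omega> * (exp (\<gamma> * s) * C) / wt j ^ 5" if "\<And>x. norm (apply_bcontfun r x) \<le> C" for r C s j
  proof -
    have "norm (R r s i) \<le> exp (\<gamma> * s) * C / wt i ^ Suc 5" for i
      using that[of "(i, s)"] wt_pos[of i] by (simp add: R_def norm_mult norm_divide norm_power field_simps)
    from fderiv_bound[OF l this] show ?thesis by (simp add: \<omega>_def)
  qed
  have Rb': "norm (fderiv l (R r s) j) \<le> \<omega> * (E * (2 * \<kappa>)) / wt j ^ 5" if "r \<in> S" "s \<in> {0..T}" for r s j
  proof -
    have "norm (fderiv l (R r s) j) \<le> \<omega> * (exp (\<gamma> * s) * (2 * \<kappa>)) / wt j ^ 5"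
      using that by (intro Rb) (auto simp: S_def)
    also have "\<dots> \<le> \<omega> * (E * (2 * \<kappa>)) / wt j ^ 5"
      using E1[OF that(2)] \<omega> \<kappa> wt_pos[of j] by (intro divide_right_mono mult_left_mono mult_right_mono) auto
    finally show ?thesis .
  qed
  have Qb: "norm (2 * P s j + fderiv l (R r s) j) \<le> Q / wt j ^ 5" if "r \<in> S" "s \<in> {0..T}" for r s j
  proof -
    have "norm (2 * P s j) \<le> 2 * (K / wt j ^ 5)" using P(1)[OF that(2), of j] by (simp add: norm_mult)
    then have "norm (2 * P s j + fderiv l (R r s) j) \<le> 2 * (K / wt j ^ 5) + \<omega> * (E * (2 * \<kappa>)) / wt j ^ 5"
      using Rb'[OF that, of j] norm_triangle_mono by blast
    then show ?thesis by (simp add: Q_def add_divide_distrib mult_ac)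
  qed
  have Mstep: "\<bar>M j\<bar> * (c / wt j ^ 5) \<le> \<delta> * c * (a j + \<gamma>) / wt j ^ 6" if "0 \<le> c" for c j
  proof -
    have "\<bar>M j\<bar> * (c / wt j ^ 5) = (\<bar>M j\<bar> * wt j) * (c / wt j ^ 6)"
      using wt_pos[of j] by (simp add: field_simps eval_nat_numeral)
    also have "\<dots> \<le> (\<delta> * (a j + \<gamma>)) * (c / wt j ^ 6)"
      using wt_pos[of j] that by (intro mult_right_mono M) auto
    finally show ?thesis by (simp add: mult_ac)
  qed
  \<comment> \<open>In the difference of two quadratic terms one summand carries a factor bounded by
    \<open>Q\<close>, the other the derivative of a single iterate, bounded by
    \<open>2 * \<kappa> * \<omega> * E\<close>.\<close>
  have small': "conv_const 5 * \<delta> * \<omega> * (Q + 2 * \<kappa> * \<omega> * E) \<le> 1/2"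
    using small by (simp add: Q_def \<omega>_def E_def algebra_simps)
  have Q1: "conv_const 5 * \<delta> * \<omega> * Q \<le> 1/2"
  proof -
    have "conv_const 5 * \<delta> * \<omega> * Q \<le> conv_const 5 * \<delta> * \<omega> * (Q + 2 * \<kappa> * \<omega> * E)"
      using conv_const_pos[of 5] \<delta> \<omega> \<kappa> E by (intro mult_left_mono) auto
    then show ?thesis using small' by linarith
  qed
  have cR: "continuous_on {0..T} (\<lambda>s. R r s i)" for r i
    unfolding R_def using wt_pos[of i]
    by (intro continuous_intros continuous_on_compose2[OF continuous_on_apply_bcontfun[of UNIV r]]) auto
  have cdR: "continuous_on {0..T} (\<lambda>s. fderiv l (R r s) i)" for r i
    unfolding fderiv_def by (intro continuous_intros cR)
  have cN: "continuous_on {0..T} (\<lambda>s. N r s j)" if "r \<in> S" for r j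
    unfolding N_def
    by (intro continuous_intros G conv_continuous[where q=5, OF _ Qb[OF that] Rb'[OF that]] cdR P) auto
  \<comment> \<open>The radius \<open>2 * \<kappa>\<close> is shared: the quadratic term takes at
    most half of it, by \<open>Q1\<close>, and the forcing \<open>G\<close> the other half.\<close>
  have Nb: "norm (N r s j) \<le> 2 * \<kappa> * (a j + \<gamma>) / wt j ^ 6 * exp (\<gamma> * s)" if "r \<in> S" "s \<in> {0..T}" for r s j
  proof -
    have "norm (of_real (M j) * conv (\<lambda>i. 2 * P s i + fderiv l (R r s) i) (fderiv l (R r s)) j)
       \<le> \<bar>M j\<bar> * (conv_const 5 * Q * (\<omega> * (exp (\<gamma> * s) * (2 * \<kappa>))) / wt j ^ 5)"
      unfolding norm_mult norm_of_real using that
      by (intro mult_left_mono conv_bound Qb Rb) (auto simp: S_def)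
    also have "\<dots> \<le> \<delta> * (conv_const 5 * Q * (\<omega> * (exp (\<gamma> * s) * (2 * \<kappa>)))) * (a j + \<gamma>) / wt j ^ 6"
      using conv_const_pos[of 5] Q \<omega> \<kappa> by (intro Mstep) auto
    also have "\<dots> = (conv_const 5 * \<delta> * \<omega> * Q) * (exp (\<gamma> * s) * (2 * \<kappa>) * (a j + \<gamma>) / wt j ^ 6)"
      by simp
    also have "\<dots> \<le> 1/2 * (exp (\<gamma> * s) * (2 * \<kappa>) * (a j + \<gamma>) / wt j ^ 6)"
      using \<kappa> a[of j] wt_pos[of j] by (intro mult_right_mono Q1) auto
    also have "\<dots> = \<kappa> * (a j + \<gamma>) / wt j ^ 6 * exp (\<gamma> * s)" by simp
    finally have 1: "norm (of_real (M j) * conv (\<lambda>i. 2 * P s i + fderiv l (R r s) i) (fderiv l (R r s)) j) \<le> \<kappa> * (a j + \<gamma>) / wt j ^ 6 * exp (\<gamma> * s)" .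
    have "1 \<le> exp (\<gamma> * s)" using \<gamma> that by simp
    then have "\<kappa> * (a j + \<gamma>) / wt j ^ 6 * 1 \<le> \<kappa> * (a j + \<gamma>) / wt j ^ 6 * exp (\<gamma> * s)"
      using \<kappa> a[of j] wt_pos[of j] by (intro mult_left_mono) auto
    then have 2: "norm (G s j) \<le> \<kappa> * (a j + \<gamma>) / wt j ^ 6 * exp (\<gamma> * s)"
      using G(1)[OF that(2), of j] by linarith
    show ?thesis unfolding N_def using norm_triangle_mono[OF 1 2] by (simp add: algebra_simps)
  qed
  have zd: "(z r j has_vector_derivative (- of_real (a j) * z r j t + N r t j)) (at t within {0..T})"
    if "r \<in> S" "t \<in> {0..T}" for r j t
    unfolding z_def by (rule duhamel_deriv[OF cN[OF that(1)] that(2)])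
  have cancel: "c * (a j + \<gamma>) / wt j ^ 6 / (a j + \<gamma>) = c / wt j ^ 6" for c j
    using a[of j] by simp
  have z0: "z r j 0 = 0" for r j by (simp add: z_def duhamel_0)
  have zb: "norm (z r j t) \<le> exp (\<gamma> * t) * (2 * \<kappa> / wt j ^ 6)" if "r \<in> S" "t \<in> {0..T}" for r j t
    using ode_bound[OF that(2) zd[OF that(1)] Nb[OF that(1)] a, of j] unfolding cancel by (simp add: z0)
  have zc: "continuous_on {0..T} (z r j)" if "r \<in> S" for r j
    using zd[OF that] has_vector_derivative_continuous continuous_on_eq_continuous_within by blast
  \<comment> \<open>With c = 0 this bounds the image of an iterate; with c equal to the image of a
    second iterate it turns an estimate for the difference of the solutions into one in the weighted
    supremum norm.\<close>
  have hz: "norm (h r j t - c) \<le> B"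
    if "norm (z r j (cl t) - of_real (exp (\<gamma> * cl t) / wt j ^ 6) * c) \<le> exp (\<gamma> * cl t) * (B / wt j ^ 6)" for r j t c B
  proof -
    have "h r j t - c = of_real (exp (- \<gamma> * cl t) * wt j ^ 6) * (z r j (cl t) - of_real (exp (\<gamma> * cl t) / wt j ^ 6) * c)"
      using wt_pos[of j] by (simp add: h_def right_diff_distrib exp_minus)
    then have "norm (h r j t - c) = exp (- \<gamma> * cl t) * wt j ^ 6 * norm (z r j (cl t) - of_real (exp (\<gamma> * cl t) / wt j ^ 6) * c)"
      using wt_pos[of j] by (simp only: norm_mult norm_of_real) simp
    also have "\<dots> \<le> exp (- \<gamma> * cl t) * wt j ^ 6 * (exp (\<gamma> * cl t) * (B / wt j ^ 6))"
      using wt_pos[of j] by (intro mult_left_mono that) auto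
    also have "\<dots> = B" using wt_pos[of j] by (simp add: exp_minus)
    finally show ?thesis .
  qed
  have hb: "norm (h r j t) \<le> 2 * \<kappa>" if "r \<in> S" for r j t
    using hz[of r j t 0 "2 * \<kappa>"] zb[OF that cl] by simp
  have hc: "continuous_on UNIV (h r j)" if "r \<in> S" for r j
    unfolding h_def by (intro continuous_intros ccl continuous_on_compose2[OF zc[OF that] ccl]) (use cl in auto)
  have \<Gamma>: "apply_bcontfun (\<Gamma> r) (j, t) = h r j t" if "r \<in> S" for r j t
  proof -
    have "(\<lambda>x. h r (fst x) (snd x)) \<in> bcontfun"
      by (rule bcontfun_normI[of _ "2 * \<kappa>"]) (use hb hc that in \<open>auto intro: continuous_on_discrete_prod\<close>)
    then show ?thesis by (simp add: \<Gamma>_def Bcontfun_inverse)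
  qed
  have sym: "R r t (- j) = cnj (R r t j)" if "r \<in> S" for r t j
    using that by (simp add: R_def S_def wt_minus)
  have Nsym: "N r s (- j) = cnj (N r s j)" if "r \<in> S" "s \<in> {0..T}" for r s j
  proof -
    have "conv (\<lambda>i. 2 * P s i + fderiv l (R r s) i) (fderiv l (R r s)) (- j) = cnj (conv (\<lambda>i. 2 * P s i + fderiv l (R r s) i) (fderiv l (R r s)) j)"
      by (rule conv_cnj) (simp_all add: fderiv_cnj sym[OF that(1)] P(3)[OF that(2)])
    then show ?thesis by (simp add: N_def even G(3)[OF that(2)])
  qed
  have zsym: "z r (- j) t = cnj (z r j t)" if "r \<in> S" "t \<in> {0..T}" for r j t
  proof -
    have "integral {0..t} (\<lambda>s. exp (a (- j) * s) *\<^sub>R N r s (- j)) = integral {0..t} (\<lambda>s. cnj (exp (a j * s) *\<^sub>R N r s j))"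
      by (rule Henstock_Kurzweil_Integration.integral_cong) (use that in \<open>auto simp: Nsym even\<close>)
    then show ?thesis
      by (simp add: z_def duhamel_def even Henstock_Kurzweil_Integration.integral_cnj)
  qed
  have \<Gamma>S: "\<Gamma> r \<in> S" if "r \<in> S" for r
  proof -
    have "norm (apply_bcontfun (\<Gamma> r) x) \<le> 2 * \<kappa>" for x
      by (cases x) (simp add: \<Gamma>[OF that] hb[OF that])
    moreover have "h r (- j) t = cnj (h r j t)" for j t
      by (simp add: h_def zsym[OF that cl] wt_minus)
    ultimately show ?thesis using hb[OF that] by (simp add: S_def \<Gamma>[OF that])
  qed
  \<comment> \<open>The difference of two images solves the same linear equation with zero initial
    value, and by \<open>conv_diff\<close> its forcing is linear in the difference \<open>D\<close>
    of the iterates.\<close>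
  have contr: "dist (\<Gamma> r) (\<Gamma> r') \<le> 1/2 * dist r r'" if r: "r \<in> S" "r' \<in> S" for r r'
  proof (rule dist_bound)
    fix x :: "int \<times> real"
    obtain j t where x: "x = (j, t)" by (cases x)
    define d where "d = dist r r'"
    have d: "0 \<le> d" by (simp add: d_def)
    define D where "D = r - r'"
    have D: "norm (apply_bcontfun D x) \<le> d" for x
      using dist_bounded[of r x r'] by (simp add: D_def d_def dist_norm)
    have RD: "R D s i = R r s i - R r' s i" for s i by (simp add: R_def D_def right_diff_distrib)
    have dRD: "(\<lambda>i. fderiv l (R r s) i - fderiv l (R r' s) i) = fderiv l (R D s)" for s
      by (auto simp: fderiv_def RD right_diff_distrib fun_eq_iff)
    let ?g = "\<lambda>s. of_real (M j) * (conv (fderiv l (R D s)) (fderiv l (R r s)) j + conv (\<lambda>i. 2 * P s i + fderiv l (R r' s) i) (fderiv l (R D s)) j)"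
    have Nd: "N r s j - N r' s j = ?g s" if s: "s \<in> {0..T}" for s
    proof -
      have "conv (\<lambda>i. 2 * P s i + fderiv l (R r s) i) (fderiv l (R r s)) j - conv (\<lambda>i. 2 * P s i + fderiv l (R r' s) i) (fderiv l (R r' s)) j
        = conv (\<lambda>i. fderiv l (R r s) i - fderiv l (R r' s) i) (fderiv l (R r s)) j + conv (\<lambda>i. 2 * P s i + fderiv l (R r' s) i) (\<lambda>i. fderiv l (R r s) i - fderiv l (R r' s) i) j"
        using conv_diff[where q=5, OF _ Qb[OF r(1) s] Qb[OF r(2) s] Rb'[OF r(1) s] Rb'[OF r(2) s], of j] by simp
      then show ?thesis unfolding dRD N_def by (simp flip: right_diff_distrib)
    qed
    have gb: "norm (?g s) \<le> 1/2 * d * (a j + \<gamma>) / wt j ^ 6 * exp (\<gamma> * s)" if s: "s \<in> {0..T}" for s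
    proof -
      have "norm (?g s) \<le> \<bar>M j\<bar> * (conv_const 5 * (\<omega> * (exp (\<gamma> * s) * d)) * (\<omega> * (E * (2 * \<kappa>))) / wt j ^ 5 + conv_const 5 * Q * (\<omega> * (exp (\<gamma> * s) * d)) / wt j ^ 5)"
        unfolding norm_mult norm_of_real
        by (intro mult_left_mono norm_triangle_mono conv_bound Rb[OF D] Rb'[OF r(1) s] Qb[OF r(2) s]) auto
      also have "\<dots> = \<bar>M j\<bar> * (conv_const 5 * \<omega> * (exp (\<gamma> * s) * d) * (Q + 2 * \<kappa> * \<omega> * E) / wt j ^ 5)"
        by (simp add: add_divide_distrib[symmetric] algebra_simps)
      also have "\<dots> \<le> \<delta> * (conv_const 5 * \<omega> * (exp (\<gamma> * s) * d) * (Q + 2 * \<kappa> * \<omega> * E)) * (a j + \<gamma>) / wt j ^ 6"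
        using conv_const_pos[of 5] Q \<omega> \<kappa> E d by (intro Mstep) auto
      also have "\<dots> = (conv_const 5 * \<delta> * \<omega> * (Q + 2 * \<kappa> * \<omega> * E)) * (exp (\<gamma> * s) * d * (a j + \<gamma>) / wt j ^ 6)"
        by simp
      also have "\<dots> \<le> 1/2 * (exp (\<gamma> * s) * d * (a j + \<gamma>) / wt j ^ 6)"
        using d a[of j] wt_pos[of j] by (intro mult_right_mono small') auto
      finally show ?thesis by (simp add: mult_ac)
    qed
    have zd': "((\<lambda>s. z r j s - z r' j s) has_vector_derivative (- of_real (a j) * (z r j s - z r' j s) + ?g s)) (at s within {0..T})"
      if s: "s \<in> {0..T}" for s
      using has_vector_derivative_diff[OF zd[OF r(1) s, of j] zd[OF r(2) s, of j]] Nd[OF s]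
      by (simp add: algebra_simps)
    have "norm (z r j (cl t) - z r' j (cl t)) \<le> exp (\<gamma> * cl t) * (1/2 * d / wt j ^ 6)"
      using ode_bound[OF cl zd' gb a, of t] unfolding cancel by (simp add: z0)
    moreover have "z r' j (cl t) = of_real (exp (\<gamma> * cl t) / wt j ^ 6) * h r' j t"
      using wt_pos[of j] by (simp add: h_def exp_minus)
    ultimately have "norm (h r j t - h r' j t) \<le> 1/2 * d"
      by (intro hz) simp
    then show "dist (apply_bcontfun (\<Gamma> r) x) (apply_bcontfun (\<Gamma> r') x) \<le> 1/2 * dist r r'"
      by (simp add: x \<Gamma> r dist_norm d_def)
  qed
  have "\<exists>!r\<in>S. \<Gamma> r = r"
  proof (rule Banach_fix[of S "1/2"])
    show "complete S" unfolding S_def by (rule complete_bcontfun_constraints)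
    have "0 \<in> S" using \<kappa> by (simp add: S_def)
    then show "S \<noteq> {}" by auto
  qed (use \<Gamma>S contr in auto)
  then obtain r where r: "r \<in> S" "\<Gamma> r = r" by blast
  have Rz: "R r t j = z r j t" if "t \<in> {0..T}" for t j
  proof -
    have "apply_bcontfun r (j, t) = h r j t" using \<Gamma>[OF r(1), of j t] r(2) by simp
    then show ?thesis using wt_pos[of j] by (simp add: R_def h_def cl_id[OF that] exp_minus)
  qed
  show ?thesis
  proof (rule that[of "R r"])
    show "R r 0 j = 0" for j using Rz[of 0 j] T by (simp add: z0)
    fix t j assume t: "t \<in> {0..T}"
    have "norm (R r t j) \<le> exp (\<gamma> * t) * (2 * \<kappa> / wt j ^ 6)" using zb[OF r(1) t, of j] by (simp add: Rz[OF t])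
    also have "\<dots> \<le> E * (2 * \<kappa> / wt j ^ 6)"
      using E1[OF t] \<kappa> wt_pos[of j] by (intro mult_right_mono) auto
    finally show "norm (R r t j) \<le> 2 * \<kappa> * exp (\<gamma> * T) / wt j ^ 6" by (simp add: E_def mult_ac)
    show "R r t (- j) = cnj (R r t j)" by (rule sym[OF r(1)])
    have "((\<lambda>s. R r s j) has_vector_derivative (- of_real (a j) * R r t j + N r t j)) (at t within {0..T})"
      by (rule has_vector_derivative_transform[OF t _ zd[OF r(1) t, of j, folded Rz[OF t]]]) (simp add: Rz)
    then show "((\<lambda>s. R r s j) has_vector_derivative
      (- of_real (a j) * R r t j + (of_real (M j) * conv (\<lambda>i. 2 * P t i + fderiv l (R r t) i) (fderiv l (R r t)) j + G t j))) (at t within {0..T})"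
      by (simp add: N_def)
  qed
qed

section \<open>Symbols\<close>

definition Lam :: "real \<Rightarrow> int \<Rightarrow> real" where
  "Lam l j = (2 * pi * real_of_int j / l)\<^sup>2"

text \<open>With \<open>\<alpha> = 1 + \<epsilon>\<close> and period \<open>l / sqrt \<epsilon>\<close>, the eigenvalue at frequency \<open>j\<close> is \<open>\<epsilon> * Lam l j\<close>
  and the symbol of \<open>\<S>\<close> is \<open>- \<epsilon>\<^sup>2 * ks_rate l j\<close>.\<close>

definition X_sym :: "real \<Rightarrow> real \<Rightarrow> int \<Rightarrow> real" where
  "X_sym l \<epsilon> j = sqrt (1 + 4 * \<epsilon> * Lam l j)"

definition b_sym :: "real \<Rightarrow> real \<Rightarrow> int \<Rightarrow> real" where
  "b_sym l \<epsilon> j = (X_sym l \<epsilon> j)\<^sup>2 + (1 + \<epsilon>) * X_sym l \<epsilon> j - (1 + \<epsilon>)"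

definition f_sym :: "real \<Rightarrow> real \<Rightarrow> int \<Rightarrow> real" where
  "f_sym l \<epsilon> j = ((X_sym l \<epsilon> j)^3 - 3 * (X_sym l \<epsilon> j)\<^sup>2 - 4 * (1 + \<epsilon>) * X_sym l \<epsilon> j + 4 * (1 + \<epsilon>)) / 4"

definition ks_rate :: "real \<Rightarrow> int \<Rightarrow> real" where
  "ks_rate l j = 4 * (Lam l j)\<^sup>2 - Lam l j"

lemma symbol_even: "Lam l (- j) = Lam l j" "X_sym l \<epsilon> (- j) = X_sym l \<epsilon> j" "b_sym l \<epsilon> (- j) = b_sym l \<epsilon> j"
  "f_sym l \<epsilon> (- j) = f_sym l \<epsilon> j" "ks_rate l (- j) = ks_rate l j"
  by (simp_all add: Lam_def X_sym_def b_sym_def f_sym_def ks_rate_def)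

lemma Lam_nonneg: "0 \<le> Lam l j" by (simp add: Lam_def)

lemma Lam_le: "Lam l j \<le> (2 * pi / l)\<^sup>2 * wt j ^ 2"
proof -
  have "Lam l j = (2 * pi / l)\<^sup>2 * \<bar>real_of_int j\<bar>\<^sup>2" by (simp add: Lam_def power_mult_distrib power_divide)
  also have "\<dots> \<le> (2 * pi / l)\<^sup>2 * wt j ^ 2" by (intro mult_left_mono power_mono) (auto simp: wt_def)
  finally show ?thesis .
qed

text \<open>Convexity of the fourth power, with equality at |j| = 1. It converts powers of |j|,
  which the derivatives control, into powers of the weight.\<close>

lemma wt_pow4_le: "wt j ^ 4 \<le> 8 * (1 + \<bar>real_of_int j\<bar> ^ 4)"
proof -
  define x where "x = \<bar>real_of_int j\<bar>"
  have "8 * (1 + x ^ 4) - (1 + x) ^ 4 = (x - 1)\<^sup>2 * (7 * x\<^sup>2 + 10 * x + 7)"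
    by algebra
  moreover have "0 \<le> (x - 1)\<^sup>2 * (7 * x\<^sup>2 + 10 * x + 7)" by (intro mult_nonneg_nonneg) (auto simp: x_def)
  ultimately show ?thesis unfolding wt_def x_def[symmetric] by linarith
qed

text \<open>Completing the square absorbs the negative term: \<open>4 * L^2 - L\<close> is
  \<open>3 * L^2 - 1/4\<close> plus \<open>(L - 1/2)^2\<close>. Passing to the weight by
  \<open>wt_pow4_le\<close> costs three further units of \<open>(2 * pi / l) ^ 4\<close>, and half
  of \<gamma> pays for both losses.\<close>

lemma ks_rate_lower:
  assumes l: "l > 0" and \<gamma>: "\<gamma> \<ge> 1/2 + 6 * (2 * pi / l) ^ 4"
  shows "3/8 * (2 * pi / l) ^ 4 * wt j ^ 4 + \<gamma> / 2 \<le> ks_rate l j + \<gamma>"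
proof -
  define w where "w = (2 * pi / l) ^ 4"
  have w: "0 \<le> w" by (simp add: w_def)
  have L2: "(Lam l j)\<^sup>2 = w * \<bar>real_of_int j\<bar> ^ 4"
    by (simp add: Lam_def w_def power_mult_distrib power_divide flip: power_mult)
  have "ks_rate l j = 3 * (Lam l j)\<^sup>2 - 1/4 + (Lam l j - 1/2)\<^sup>2"
    unfolding ks_rate_def by (simp add: power2_eq_square algebra_simps)
  then have "ks_rate l j \<ge> 3 * (w * \<bar>real_of_int j\<bar> ^ 4) - 1/4" by (simp add: L2)
  moreover have "w * wt j ^ 4 \<le> w * (8 * (1 + \<bar>real_of_int j\<bar> ^ 4))"
    by (intro mult_left_mono wt_pow4_le w)
  then have "w * wt j ^ 4 \<le> 8 * w + 8 * (w * \<bar>real_of_int j\<bar> ^ 4)" by (simp add: algebra_simps)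
  ultimately show ?thesis using \<gamma> unfolding w_def[symmetric] by linarith
qed

lemma X_sym_bounds:
  assumes "0 \<le> \<epsilon>"
  shows "1 \<le> X_sym l \<epsilon> j" "(X_sym l \<epsilon> j)\<^sup>2 = 1 + 4 * \<epsilon> * Lam l j" "X_sym l \<epsilon> j - 1 \<le> 2 * \<epsilon> * Lam l j"
proof -
  have n: "0 \<le> \<epsilon> * Lam l j" using assms Lam_nonneg by simp
  show 1: "1 \<le> X_sym l \<epsilon> j" using n by (simp add: X_sym_def)
  show 2: "(X_sym l \<epsilon> j)\<^sup>2 = 1 + 4 * \<epsilon> * Lam l j" using n by (simp add: X_sym_def)
  have "4 * \<epsilon> * Lam l j = (X_sym l \<epsilon> j - 1) * (X_sym l \<epsilon> j + 1)" using 2 by (simp add: power2_eq_square algebra_simps)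
  also have "\<dots> \<ge> (X_sym l \<epsilon> j - 1) * 2" using 1 by (intro mult_left_mono) auto
  finally show "X_sym l \<epsilon> j - 1 \<le> 2 * \<epsilon> * Lam l j" by simp
qed

text \<open>Both summands of \<open>b - 1\<close> are nonnegative and of first order in \<epsilon>,
  at the price of two powers of the frequency, to be paid by the regularity of \<Phi>.\<close>

lemma b_sym_bounds:
  assumes "0 \<le> \<epsilon>" "\<epsilon> \<le> 1"
  shows "1 \<le> b_sym l \<epsilon> j" "\<bar>1 - b_sym l \<epsilon> j\<bar> \<le> 8 * \<epsilon> * Lam l j"
proof -
  note X = X_sym_bounds[OF assms(1), of l j]
  have e: "b_sym l \<epsilon> j - 1 = 4 * \<epsilon> * Lam l j + (1 + \<epsilon>) * (X_sym l \<epsilon> j - 1)"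
    unfolding b_sym_def X(2) by (simp add: algebra_simps)
  have "(1 + \<epsilon>) * (X_sym l \<epsilon> j - 1) \<le> 2 * (2 * \<epsilon> * Lam l j)"
    using assms X by (intro mult_mono) auto
  moreover have "0 \<le> (1 + \<epsilon>) * (X_sym l \<epsilon> j - 1)" using assms X by simp
  moreover have "0 \<le> 4 * \<epsilon> * Lam l j" using assms Lam_nonneg by simp
  ultimately show "1 \<le> b_sym l \<epsilon> j" "\<bar>1 - b_sym l \<epsilon> j\<bar> \<le> 8 * \<epsilon> * Lam l j" using e by linarith+
qed

lemma f_sym_residual:
  assumes "0 \<le> \<epsilon>" "\<epsilon> \<le> 1"
  shows "\<bar>f_sym l \<epsilon> j + 1/2\<bar> \<le> 6 * \<epsilon> * Lam l j * (1 + 4 * Lam l j)"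
proof -
  define X where "X = X_sym l \<epsilon> j"
  note X = X_sym_bounds[OF assms(1), of l j, folded X_def]
  \<comment> \<open>X = 1 is a root of the cubic, and X - 1 is what carries the factor
    \<epsilon>.\<close>
  have "f_sym l \<epsilon> j + 1/2 = (X - 1) * ((X\<^sup>2 - 2 * X - 2) / 4 - (1 + \<epsilon>))"
    unfolding f_sym_def X_def[symmetric] by (simp add: power2_eq_square power3_eq_cube field_simps)
  moreover have "\<bar>(X\<^sup>2 - 2 * X - 2) / 4 - (1 + \<epsilon>)\<bar> \<le> 3 * X\<^sup>2"
  proof -
    have "X \<le> X\<^sup>2" "1 \<le> X\<^sup>2" using X(1) power_increasing[of 1 2 X] by simp_all
    moreover have "\<bar>(s - 2 * x - 2) / 4 - (1 + e)\<bar> \<le> 3 * s" if "x \<le> s" "1 \<le> s" "1 \<le> x" "0 \<le> e" "e \<le> 1" for x s e :: real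
      using that by (simp add: abs_le_iff field_simps)
    ultimately show ?thesis using X(1) assms by blast
  qed
  ultimately have "\<bar>f_sym l \<epsilon> j + 1/2\<bar> \<le> (2 * \<epsilon> * Lam l j) * (3 * X\<^sup>2)"
    unfolding abs_mult using X by (auto intro!: mult_mono simp: abs_mult)
  also have "X\<^sup>2 \<le> 1 + 4 * Lam l j"
    using assms Lam_nonneg[of l j] mult_right_mono[of \<epsilon> 1 "Lam l j"] unfolding X(2) by simp
  then have "(2 * \<epsilon> * Lam l j) * (3 * X\<^sup>2) \<le> (2 * \<epsilon> * Lam l j) * (3 * (1 + 4 * Lam l j))"
    using assms Lam_nonneg by (intro mult_left_mono) auto
  finally show ?thesis by (simp add: algebra_simps)
qed

text \<open>With y the square root of \<open>\<epsilon> * Lam l j\<close>, X is at most 1 + 2y, so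
  its cube splits into a constant and a multiple of y^3. Of the power 3/2 of \<epsilon> contained in
  y^3 only one power is kept.\<close>

lemma f_sym_bound:
  assumes "0 \<le> \<epsilon>" "\<epsilon> \<le> 1" "l > 0"
  shows "\<bar>f_sym l \<epsilon> j\<bar> \<le> 20 + 160 * \<epsilon> * (2 * pi / l) ^ 3 * wt j ^ 3"
proof -
  define X where "X = X_sym l \<epsilon> j"
  note X = X_sym_bounds[OF assms(1), of l j, folded X_def]
  define y where "y = sqrt \<epsilon> * (2 * pi * \<bar>real_of_int j\<bar> / l)"
  have y: "0 \<le> y" "y\<^sup>2 = \<epsilon> * Lam l j"
    using assms by (simp_all add: y_def Lam_def power_mult_distrib power_divide)
  have "X \<le> 1 + 2 * y"
  proof (rule power2_le_imp_le)
    show "X\<^sup>2 \<le> (1 + 2 * y)\<^sup>2" unfolding X(2) using y by (simp add: power2_eq_square algebra_simps)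
  qed (use y in auto)
  then have "X ^ 3 \<le> (1 + 2 * y) ^ 3" using X(1) by (intro power_mono) auto
  also have "\<dots> \<le> 4 * (1 + (2 * y) ^ 3)"
  proof -
    have "4 * (1 + u ^ 3) - (1 + u) ^ 3 = 3 * (u - 1)\<^sup>2 * (u + 1)" for u :: real by algebra
    moreover have "0 \<le> 3 * (2 * y - 1)\<^sup>2 * (2 * y + 1)" using y by simp
    ultimately show ?thesis by (metis diff_ge_0_iff_ge)
  qed
  finally have X3: "X ^ 3 \<le> 4 + 32 * y ^ 3" by (simp add: power_mult_distrib)
  have X12: "1 \<le> X ^ 3" "X \<le> X ^ 3" "X\<^sup>2 \<le> X ^ 3"
    using X(1) power_increasing[of 1 3 X] power_increasing[of 2 3 X] by auto
  have "(1 + \<epsilon>) * (X - 1) \<le> 2 * (X - 1)" "0 \<le> (1 + \<epsilon>) * (X - 1)"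
    using X(1) assms by (intro mult_right_mono mult_nonneg_nonneg; simp)+
  moreover have "f_sym l \<epsilon> j = X ^ 3 / 4 - 3/4 * X\<^sup>2 - (1 + \<epsilon>) * (X - 1)"
    unfolding f_sym_def X_def[symmetric] by (simp add: field_simps)
  moreover have "0 \<le> X\<^sup>2" by simp
  moreover have "\<bar>u / 4 - 3/4 * s - c\<bar> \<le> 5 * u"
    if "c \<le> 2 * (x - 1)" "0 \<le> c" "0 \<le> s" "1 \<le> u" "x \<le> u" "s \<le> u" for u s c x :: real
    using that by (simp add: abs_le_iff field_simps)
  ultimately have "\<bar>f_sym l \<epsilon> j\<bar> \<le> 5 * X ^ 3" using X12 by metis
  also have "\<dots> \<le> 20 + 160 * y ^ 3" using X3 by simp
  also have "y ^ 3 \<le> \<epsilon> * ((2 * pi / l) ^ 3 * wt j ^ 3)"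
  proof -
    have "sqrt \<epsilon> ^ 3 = \<epsilon> * sqrt \<epsilon>" using assms by (simp add: power3_eq_cube)
    also have "\<dots> \<le> \<epsilon> * 1" using assms by (intro mult_left_mono) auto
    finally have s: "sqrt \<epsilon> ^ 3 \<le> \<epsilon>" by simp
    have "y ^ 3 = sqrt \<epsilon> ^ 3 * ((2 * pi / l) ^ 3 * \<bar>real_of_int j\<bar> ^ 3)"
      by (simp add: y_def power_mult_distrib power_divide)
    also have "\<dots> \<le> \<epsilon> * ((2 * pi / l) ^ 3 * wt j ^ 3)"
      using assms s by (intro mult_mono power_mono) (auto simp: wt_def)
    finally show ?thesis .
  qed
  finally show ?thesis by simp
qed

text \<open>The nonlinearity loses one derivative and multiplies by \<open>f_sym\<close>, of size \<open>\<epsilon> powr (3/2) * \<bar>j\<bar> ^ 3\<close>: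
  at high frequencies it has the order of \<open>ks_rate\<close>, with a small factor, and the low ones are absorbed by \<open>\<gamma>\<close>.\<close>

lemma f_sym_dominated:
  assumes l: "l > 0" and \<delta>: "\<delta> > 0"
  obtains \<gamma>0 \<epsilon>0 where "0 < \<epsilon>0" "\<epsilon>0 < 1"
    "\<And>\<gamma> \<epsilon> j. \<gamma>0 \<le> \<gamma> \<Longrightarrow> 0 \<le> \<epsilon> \<Longrightarrow> \<epsilon> \<le> \<epsilon>0 \<Longrightarrow> \<bar>f_sym l \<epsilon> j\<bar> * wt j \<le> \<delta> * (ks_rate l j + \<gamma>)"
proof -
  define w where "w = 2 * pi / l"
  have w: "0 < w" using l by (simp add: w_def)
  define c where "c = 3/8 * w ^ 4"
  have c: "0 < c" using w by (simp add: c_def)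
  \<comment> \<open>With this \<eta> the low order part \<open>20 * n\<close> uses half of
    \<open>\<delta> * c * n ^ 4\<close>; the cubic part gets the other half from the choice of
    \<open>\<epsilon>0\<close>. The second entry of \<open>\<gamma>0\<close> makes
    \<open>20 / \<eta>\<close> at most \<open>\<delta> * \<gamma> / 2\<close>.\<close>
  define \<eta> where "\<eta> = min 1 (\<delta> * c / 40)"
  have \<eta>: "0 < \<eta>" "\<eta> \<le> 1" "\<eta> \<le> \<delta> * c / 40" using c \<delta> by (auto simp: \<eta>_def)
  define \<epsilon>0 where "\<epsilon>0 = min (1/2) (\<delta> * c / (2 * 160 * w ^ 3))"
  define \<gamma>0 where "\<gamma>0 = max (1/2 + 6 * w ^ 4) (40 / (\<eta> * \<delta>))"
  show ?thesis
  proof (rule that[of \<epsilon>0 \<gamma>0])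
    show "0 < \<epsilon>0" "\<epsilon>0 < 1" using \<delta> c w by (auto simp: \<epsilon>0_def)
    fix \<gamma> \<epsilon> j assume h: "\<gamma>0 \<le> \<gamma>" "0 \<le> \<epsilon>" "\<epsilon> \<le> \<epsilon>0"
    define n where "n = wt j"
    have n: "1 \<le> n" by (simp add: n_def wt_ge1)
    have e1: "\<epsilon> \<le> 1" using h by (auto simp: \<epsilon>0_def)
    have low: "c * n ^ 4 + \<gamma> / 2 \<le> ks_rate l j + \<gamma>"
      using ks_rate_lower[OF l, of \<gamma> j] h by (simp add: \<gamma>0_def c_def w_def n_def)
    \<comment> \<open>An interpolation between the powers 0 and 4: either n is at most
      \<open>1 / \<eta>\<close>, or one factor \<open>\<eta> * n\<close> exceeds 1.\<close>
    have n1: "n \<le> \<eta> * n ^ 4 + 1 / \<eta>"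
    proof (cases "\<eta> * n \<le> 1")
      case True
      then have "n \<le> 1 / \<eta>" using \<eta> by (simp add: field_simps)
      moreover have "0 \<le> \<eta> * n ^ 4" using \<eta> by simp
      ultimately show ?thesis by linarith
    next
      case False
      have "n \<le> n ^ 3" using n power_increasing[of 1 3 n] by simp
      also have "\<dots> \<le> \<eta> * n * n ^ 3" using False n mult_right_mono[of 1 "\<eta> * n" "n ^ 3"] by simp
      also have "\<dots> = \<eta> * n ^ 4" by (simp add: eval_nat_numeral)
      finally show ?thesis using \<eta> by (smt (verit) divide_pos_pos)
    qed
    have "\<bar>f_sym l \<epsilon> j\<bar> * n \<le> (20 + 160 * \<epsilon> * w ^ 3 * n ^ 3) * n"
      using f_sym_bound[OF h(2) e1 l, of j] n by (intro mult_right_mono) (auto simp: w_def n_def)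
    also have "\<dots> = 20 * n + 160 * \<epsilon> * w ^ 3 * n ^ 4" by (simp add: eval_nat_numeral algebra_simps)
    also have "\<dots> \<le> (20 * \<eta> * n ^ 4 + 20 / \<eta>) + \<delta> * c / 2 * n ^ 4"
    proof (intro add_mono)
      show "20 * n \<le> 20 * \<eta> * n ^ 4 + 20 / \<eta>" using n1 by simp
      have "160 * \<epsilon> * w ^ 3 \<le> 160 * (\<delta> * c / (2 * 160 * w ^ 3)) * w ^ 3"
        using h w by (intro mult_right_mono mult_left_mono) (auto simp: \<epsilon>0_def)
      also have "\<dots> = \<delta> * c / 2" using w by simp
      finally show "160 * \<epsilon> * w ^ 3 * n ^ 4 \<le> \<delta> * c / 2 * n ^ 4" using n by (intro mult_right_mono) auto
    qed
    also have "\<dots> \<le> (\<delta> * c / 2 * n ^ 4 + \<delta> * \<gamma> / 2) + \<delta> * c / 2 * n ^ 4"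
    proof (intro add_mono)
      show "20 * \<eta> * n ^ 4 \<le> \<delta> * c / 2 * n ^ 4" using \<eta> n by (intro mult_right_mono) auto
      have "40 / (\<eta> * \<delta>) \<le> \<gamma>" using h by (simp add: \<gamma>0_def)
      then show "20 / \<eta> \<le> \<delta> * \<gamma> / 2" using \<eta> \<delta> by (simp add: field_simps)
    qed simp
    also have "\<dots> = \<delta> * (c * n ^ 4 + \<gamma> / 2)" by (simp add: algebra_simps)
    also have "\<dots> \<le> \<delta> * (ks_rate l j + \<gamma>)" using low \<delta> by (intro mult_left_mono) auto
    finally show "\<bar>f_sym l \<epsilon> j\<bar> * wt j \<le> \<delta> * (ks_rate l j + \<gamma>)" by (simp add: n_def)
  qed
qed

section \<open>Fourier coefficients of classical solutions\<close>

lemma fderiv_pow: "(fderiv l ^^ k) U j = (\<i> * of_real (2 * pi * real_of_int j / l)) ^ k * U j"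
  by (induction k) (simp_all add: fderiv_def mult_ac)

lemma fderiv_pow2: "(fderiv l ^^ 2) U j = - of_real (Lam l j) * U j"
proof -
  have "(\<i> * complex_of_real a)\<^sup>2 = - of_real (a\<^sup>2)" for a
    by (simp add: power_mult_distrib)
  then show ?thesis by (simp only: fderiv_pow Lam_def)
qed

lemma fderiv_pow4: "(fderiv l ^^ 4) U j = of_real ((Lam l j)\<^sup>2) * U j"
proof -
  have "(fderiv l ^^ 4) U j = (fderiv l ^^ 2) ((fderiv l ^^ 2) U) j"
    by (simp add: eval_nat_numeral)
  then show ?thesis by (simp add: fderiv_pow2 power2_eq_square)
qed

lemma Lam_sq: "(Lam l j)\<^sup>2 = (2 * pi / l) ^ 4 * \<bar>real_of_int j\<bar> ^ 4"
  by (simp add: Lam_def power_mult_distrib power_divide flip: power_mult)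

lemma continuous_on_slice:
  assumes "continuous_on (X \<times> UNIV) (\<lambda>(t, y). g t y)" "t \<in> X"
  shows "continuous_on S (g t)"
proof -
  have "continuous_on S (\<lambda>y. (t, y))" by (intro continuous_intros)
  from continuous_on_compose2[OF assms(1) this] show ?thesis using assms(2) by auto
qed

text \<open>The bound on \<open>U\<close> itself covers the zero mode, which the fourth derivative
  does not see; the latter supplies the four powers of |j|.\<close>

lemma wt_pow4_bound:
  assumes l: "l > 0" and B: "norm (U j) \<le> B" "norm ((fderiv l ^^ 4) U j) \<le> B"
  shows "norm (U j) \<le> 8 * (1 + 1 / (2 * pi / l) ^ 4) * B / wt j ^ 4"
proof -
  define w where "w = (2 * pi / l) ^ 4"
  have w: "0 < w" using l by (simp add: w_def)
  have "w * (\<bar>real_of_int j\<bar> ^ 4 * norm (U j)) = norm ((fderiv l ^^ 4) U j)"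
    by (simp only: fderiv_pow4 norm_mult norm_of_real Lam_sq w_def) (simp add: abs_mult)
  then have "\<bar>real_of_int j\<bar> ^ 4 * norm (U j) \<le> B / w"
    using B w by (simp add: field_simps)
  then have "(1 + \<bar>real_of_int j\<bar> ^ 4) * norm (U j) \<le> B + B / w"
    using B by (simp add: distrib_right)
  moreover have "wt j ^ 4 * norm (U j) \<le> 8 * (1 + \<bar>real_of_int j\<bar> ^ 4) * norm (U j)"
    by (intro mult_right_mono wt_pow4_le) auto
  ultimately have "wt j ^ 4 * norm (U j) \<le> 8 * (B + B / w)"
    unfolding mult.assoc by (meson mult_left_mono order_trans zero_le_numeral)
  then show ?thesis using wt_pos[of j] unfolding w_def[symmetric]
    by (simp add: field_simps)
qed

lemma periodic_deriv:
  assumes "\<And>y. (f has_real_derivative f' y) (at y)" "periodic_on_R l f"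
  shows "periodic_on_R l f'"
  unfolding periodic_on_R_def
proof
  fix y
  have "((\<lambda>x. f (x + l)) has_real_derivative f' (y + l)) (at y)"
    using assms(1)[of "y + l"] by (simp add: DERIV_shift)
  moreover have "(\<lambda>x. f (x + l)) = f" using assms(2) by (simp add: periodic_on_R_def fun_eq_iff)
  ultimately show "f' (y + l) = f' y" using DERIV_unique[OF _ assms(1)] by metis
qed

lemma periodic_bounded:
  fixes g :: "real \<Rightarrow> real \<Rightarrow> real"
  assumes l: "l > 0" and g: "continuous_on ({0..T} \<times> UNIV) (\<lambda>(t, y). g t y)" "\<And>t. t \<in> {0..T} \<Longrightarrow> periodic_on_R l (g t)"
  obtains B where "\<And>t y. t \<in> {0..T} \<Longrightarrow> \<bar>g t y\<bar> \<le> B" "0 \<le> B"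
proof -
  have "compact ((\<lambda>(t, y). g t y) ` ({0..T} \<times> {-l/2..l/2}))"
    by (intro compact_continuous_image continuous_on_subset[OF g(1)] compact_Times) auto
  then have "bounded ((\<lambda>(t, y). g t y) ` ({0..T} \<times> {-l/2..l/2}))" by (rule compact_imp_bounded)
  then obtain B where B0: "0 < B" and *: "\<forall>x \<in> (\<lambda>(t, y). g t y) ` ({0..T} \<times> {-l/2..l/2}). norm x \<le> B"
    unfolding bounded_pos by blast
  have B: "\<bar>g t y\<bar> \<le> B" if "t \<in> {0..T}" "y \<in> {-l/2..l/2}" for t y
    using bspec[OF *, of "g t y"] image_eqI[of "g t y" "\<lambda>(t, y). g t y" "(t, y)"] that by simp
  have "\<bar>g t y\<bar> \<le> B" if "t \<in> {0..T}" for t y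
  proof -
    obtain k where "y + of_int k * l \<in> {-l/2..l/2}" by (rule periodic_on_R_reduce[OF l])
    from B[OF that this] show ?thesis by (simp add: periodic_on_R_int[OF g(2)[OF that]])
  qed
  then show ?thesis using that[of B] B0 by auto
qed

lemma periodic_uniformly_continuous:
  fixes g :: "real \<Rightarrow> real \<Rightarrow> real"
  assumes l: "l > 0" and g: "continuous_on ({0..T} \<times> UNIV) (\<lambda>(t, y). g t y)" "\<And>t. t \<in> {0..T} \<Longrightarrow> periodic_on_R l (g t)"
    and e: "e > 0"
  obtains h where "h > 0" "\<And>t s y. t \<in> {0..T} \<Longrightarrow> s \<in> {0..T} \<Longrightarrow> \<bar>t - s\<bar> < h \<Longrightarrow> \<bar>g t y - g s y\<bar> < e"
proof -
  have "uniformly_continuous_on ({0..T} \<times> {-l/2..l/2}) (\<lambda>(t, y). g t y)"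
    by (intro compact_uniformly_continuous continuous_on_subset[OF g(1)] compact_Times) auto
  then obtain h where h: "h > 0" "\<And>x x'. x \<in> {0..T} \<times> {-l/2..l/2} \<Longrightarrow> x' \<in> {0..T} \<times> {-l/2..l/2} \<Longrightarrow>
      dist x' x < h \<Longrightarrow> dist (case x' of (t, y) \<Rightarrow> g t y) (case x of (t, y) \<Rightarrow> g t y) < e"
    using e unfolding uniformly_continuous_on_def by metis
  show ?thesis
  proof (rule that[OF h(1)])
    fix t s y assume ts: "t \<in> {0..T}" "s \<in> {0..T}" "\<bar>t - s\<bar> < h"
    obtain k where k: "y + of_int k * l \<in> {-l/2..l/2}" by (rule periodic_on_R_reduce[OF l])
    have "\<bar>g t (y + of_int k * l) - g s (y + of_int k * l)\<bar> < e"
      using h(2)[of "(s, y + of_int k * l)" "(t, y + of_int k * l)"] ts k by (simp add: dist_Pair_Pair dist_real_def)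
    then show "\<bar>g t y - g s y\<bar> < e"
      using periodic_on_R_int[OF g(2)] ts by simp
  qed
qed

section \<open>Coefficients of classically regular periodic functions\<close>

context
  fixes l T :: real and u ut :: "real \<Rightarrow> real \<Rightarrow> real"
  assumes l: "l > 0" and per: "\<And>t. t \<in> {0..T} \<Longrightarrow> periodic_on_R l (u t)" and reg: "classical_reg T u ut"
begin

lemma reg_deriv: "t \<in> {0..T} \<Longrightarrow> k < 4 \<Longrightarrow> ((deriv ^^ k) (u t) has_real_derivative (deriv ^^ Suc k) (u t) y) (at y)"
  using reg unfolding classical_reg_def by blast

lemma reg_joint: "k \<le> 4 \<Longrightarrow> continuous_on ({0..T} \<times> UNIV) (\<lambda>(t, y). (deriv ^^ k) (u t) y)"
  using reg unfolding classical_reg_def by blast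

lemma reg_cont: 
  assumes "t \<in> {0..T}" "k \<le> 4" shows "continuous_on S ((deriv ^^ k) (u t))"
  by (rule continuous_on_slice[OF reg_joint[OF assms(2)] assms(1)])

lemma reg_periodic: "t \<in> {0..T} \<Longrightarrow> k \<le> 4 \<Longrightarrow> periodic_on_R l ((deriv ^^ k) (u t))"
proof (induction k)
  case (Suc k)
  show ?case
    by (rule periodic_deriv[OF reg_deriv[OF Suc.prems(1)] Suc.IH]) (use Suc.prems in auto)
qed (simp add: per)

lemma reg_fcoeff: "t \<in> {0..T} \<Longrightarrow> k \<le> 4 \<Longrightarrow> fcoeff l ((deriv ^^ k) (u t)) = (fderiv l ^^ k) (fcoeff l (u t))"
proof (induction k)
  case (Suc k)
  have p: "(deriv ^^ k) (u t) (- l / 2) = (deriv ^^ k) (u t) (l / 2)"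
    using periodic_on_R_int[OF reg_periodic[OF Suc.prems(1), of k], of "- l / 2" 1] Suc.prems by simp
  have "fcoeff l ((deriv ^^ Suc k) (u t)) j = fderiv l (fcoeff l ((deriv ^^ k) (u t))) j" for j
    by (rule fcoeff_deriv[OF l reg_deriv[OF Suc.prems(1)] reg_cont[OF Suc.prems] p]) (use Suc.prems in auto)
  then have "fcoeff l ((deriv ^^ Suc k) (u t)) = fderiv l (fcoeff l ((deriv ^^ k) (u t)))" by (rule ext)
  then show ?case using Suc by simp
qed simp

text \<open>By compactness of one space-time period, u and its fourth space derivative are bounded
  uniformly in time. This is where the bootstrap of \<Phi> starts.\<close>

lemma reg_decay4:
  obtains A where "\<And>t j. t \<in> {0..T} \<Longrightarrow> norm (fcoeff l (u t) j) \<le> A / wt j ^ 4"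
proof -
  obtain B0 where B0: "\<And>t y. t \<in> {0..T} \<Longrightarrow> \<bar>(deriv ^^ 0) (u t) y\<bar> \<le> B0" "0 \<le> B0"
    using periodic_bounded[OF l reg_joint[of 0] reg_periodic[of _ 0]] by auto
  obtain B4 where B4: "\<And>t y. t \<in> {0..T} \<Longrightarrow> \<bar>(deriv ^^ 4) (u t) y\<bar> \<le> B4" "0 \<le> B4"
    using periodic_bounded[OF l reg_joint[of 4] reg_periodic[of _ 4]] by auto
  show ?thesis
  proof (rule that)
    fix t j assume t: "t \<in> {0..T}"
    show "norm (fcoeff l (u t) j) \<le> (8 * (1 + 1 / (2 * pi / l) ^ 4) * (B0 + B4)) / wt j ^ 4"
    proof (rule wt_pow4_bound[OF l])
      have "norm (fcoeff l (u t) j) \<le> B0"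
        by (rule fcoeff_bound[OF l]) (use B0(1)[OF t] reg_cont[OF t, of 0] in auto)
      then show "norm (fcoeff l (u t) j) \<le> B0 + B4" using B4 by simp
      have "norm (fcoeff l ((deriv ^^ 4) (u t)) j) \<le> B4"
        by (rule fcoeff_bound[OF l]) (use B4(1)[OF t] reg_cont[OF t, of 4] in auto)
      then show "norm ((fderiv l ^^ 4) (fcoeff l (u t)) j) \<le> B0 + B4" using reg_fcoeff[OF t, of 4] B0 by simp
    qed
  qed
qed

text \<open>Uniform continuity of u and of its fourth space derivative gives a modulus in time in
  the norm with four weights. The step length h is the same at all times, so finitely many steps
  will cover the interval.\<close>

lemma reg_fcoeff_uniform:
  assumes e: "e > 0"
  obtains h where "h > 0" "\<And>t s j. t \<in> {0..T} \<Longrightarrow> s \<in> {0..T} \<Longrightarrow> \<bar>t - s\<bar> < h \<Longrightarrow>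
     norm (fcoeff l (u t) j - fcoeff l (u s) j) \<le> e / wt j ^ 4"
proof -
  define c where "c = 8 * (1 + 1 / (2 * pi / l) ^ 4)"
  have c: "0 < c" using l by (auto simp: c_def intro!: add_pos_nonneg)
  define e' where "e' = e / c"
  have e': "0 < e'" using e c by (simp add: e'_def)
  obtain h0 where h0: "h0 > 0" "\<And>t s y. t \<in> {0..T} \<Longrightarrow> s \<in> {0..T} \<Longrightarrow> \<bar>t - s\<bar> < h0 \<Longrightarrow> \<bar>(deriv ^^ 0) (u t) y - (deriv ^^ 0) (u s) y\<bar> < e'"
    using periodic_uniformly_continuous[OF l reg_joint[of 0] reg_periodic[of _ 0] e'] by (metis zero_le_numeral le0)
  obtain h4 where h4: "h4 > 0" "\<And>t s y. t \<in> {0..T} \<Longrightarrow> s \<in> {0..T} \<Longrightarrow> \<bar>t - s\<bar> < h4 \<Longrightarrow> \<bar>(deriv ^^ 4) (u t) y - (deriv ^^ 4) (u s) y\<bar> < e'"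
    using periodic_uniformly_continuous[OF l reg_joint[of 4] reg_periodic[of _ 4] e'] by (metis order_refl)
  show ?thesis
  proof (rule that[of "min h0 h4"])
    fix t s j assume ts: "t \<in> {0..T}" "s \<in> {0..T}" "\<bar>t - s\<bar> < min h0 h4"
    let ?U = "\<lambda>j. fcoeff l (u t) j - fcoeff l (u s) j"
    have d: "norm (fcoeff l ((deriv ^^ k) (u t)) j - fcoeff l ((deriv ^^ k) (u s)) j) \<le> e'"
      if "k \<le> 4" "\<And>y. \<bar>(deriv ^^ k) (u t) y - (deriv ^^ k) (u s) y\<bar> < e'" for k
      unfolding fcoeff_diff[OF reg_cont[OF ts(1) that(1)] reg_cont[OF ts(2) that(1)], symmetric]
      by (rule fcoeff_bound[OF l]) (use that in \<open>auto intro!: continuous_on_diff reg_cont ts intro: less_imp_le\<close>)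
    have "norm (?U j) \<le> c * e' / wt j ^ 4"
      unfolding c_def
    proof (rule wt_pow4_bound[OF l])
      show "norm (?U j) \<le> e'" using d[of 0] h0(2)[OF ts(1,2)] ts(3) by simp
      have "(fderiv l ^^ 4) ?U j = (fderiv l ^^ 4) (fcoeff l (u t)) j - (fderiv l ^^ 4) (fcoeff l (u s)) j"
        by (simp add: fderiv_pow right_diff_distrib)
      then show "norm ((fderiv l ^^ 4) ?U j) \<le> e'"
        using d[of 4] h4(2)[OF ts(1,2)] ts(3) reg_fcoeff[OF ts(1), of 4] reg_fcoeff[OF ts(2), of 4] by simp
    qed
    then show "norm (?U j) \<le> e / wt j ^ 4" using c by (simp add: e'_def)
  qed (use h0 h4 in auto)
qed

lemma reg_fcoeff_time_deriv:
  assumes t: "t \<in> {0..T}"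
  shows "((\<lambda>s. fcoeff l (u s) j) has_vector_derivative fcoeff l (ut t) j) (at t within {0..T})"
    and "continuous_on S (ut t)"
proof -
  have utc: "continuous_on ({0..T} \<times> UNIV) (\<lambda>(t, y). ut t y)"
    and utd: "\<And>t y. t \<in> {0..T} \<Longrightarrow> ((\<lambda>s. u s y) has_real_derivative ut t y) (at t within {0..T})"
    using reg unfolding classical_reg_def by blast+
  show "continuous_on S (ut t)" for S
    by (rule continuous_on_slice[OF utc t])
  have "((\<lambda>s. integral (cbox (-l/2) (l/2)) (\<lambda>y. of_real (u s y) * fexp l (- j) y)) has_vector_derivative
      integral (cbox (-l/2) (l/2)) (\<lambda>y. of_real (ut t y) * fexp l (- j) y)) (at t within {0..T})"
  proof (rule leibniz_rule_vector_derivative[OF _ _ _ t])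
    fix s y assume s: "s \<in> {0..T}"
    have "((\<lambda>s. of_real (u s y)) has_vector_derivative (of_real (ut s y) :: complex)) (at s within {0..T})"
      using utd[OF s, of y] by (rule has_vector_derivative_of_real)
    then show "((\<lambda>s. of_real (u s y) * fexp l (- j) y) has_vector_derivative of_real (ut s y) * fexp l (- j) y) (at s within {0..T})"
      by (rule bounded_linear.has_vector_derivative[OF bounded_linear_mult_left])
    show "(\<lambda>y. of_real (u s y) * fexp l (- j) y) integrable_on cbox (-l/2) (l/2)"
      unfolding cbox_interval using reg_cont[OF s, of 0]
      by (intro integrable_continuous_interval continuous_intros) auto
  next
    show "continuous_on ({0..T} \<times> cbox (-l/2) (l/2)) (\<lambda>(s, y). of_real (ut s y) * fexp l (- j) y)"
      unfolding split_beta
      by (intro continuous_intros continuous_on_compose2[OF utc, unfolded split_beta, of _ "\<lambda>x. x", simplified]) auto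
  qed simp
  then have "((\<lambda>s. integral {-l/2..l/2} (\<lambda>y. of_real (u s y) * fexp l (- j) y) / of_real l) has_vector_derivative
      integral {-l/2..l/2} (\<lambda>y. of_real (ut t y) * fexp l (- j) y) / of_real l) (at t within {0..T})"
    unfolding cbox_interval by (rule bounded_linear.has_vector_derivative[OF bounded_linear_divide])
  then show "((\<lambda>s. fcoeff l (u s) j) has_vector_derivative fcoeff l (ut t) j) (at t within {0..T})"
    unfolding fcoeff_def .
qed

text \<open>Decay 4 of the function leaves decay 3 for its derivative, above the exponent 2 that the
  product formula requires.\<close>

lemma reg_fcoeff_sq:
  assumes t: "t \<in> {0..T}"
  shows "fcoeff l (\<lambda>y. (deriv (u t) y)\<^sup>2) j = conv (fderiv l (fcoeff l (u t))) (fderiv l (fcoeff l (u t))) j"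
proof -
  obtain A where A: "\<And>t j. t \<in> {0..T} \<Longrightarrow> norm (fcoeff l (u t) j) \<le> A / wt j ^ 4" by (rule reg_decay4) (rule that)
  have 1: "fcoeff l (deriv (u t)) = fderiv l (fcoeff l (u t))" using reg_fcoeff[OF t, of 1] by simp
  have b: "norm (fcoeff l (deriv (u t)) i) \<le> (2 * pi / l * A) / wt i ^ 3" for i
    unfolding 1 by (rule fderiv_bound[OF l]) (use A[OF t] in simp)
  show ?thesis
    unfolding power2_eq_square 1[symmetric]
    using reg_cont[OF t, of 1] reg_periodic[OF t, of 1]
    by (intro fcoeff_mult[OF l _ _ _ _ b]) auto
qed

end

section \<open>Decay of the Kuramoto--Sivashinsky coefficients\<close>

context
  fixes l T :: real and \<Phi>0 :: "real \<Rightarrow> real" and \<Phi> :: "real \<Rightarrow> real \<Rightarrow> real"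
  assumes l: "l > 0" and T: "T > 0" and ks: "ks_sol l T \<Phi>0 \<Phi>"
begin

lemma ks_fcoeff_deriv:
  assumes t: "t \<in> {0..T}"
  shows "((\<lambda>s. fcoeff l (\<Phi> s) j) has_vector_derivative
    (- of_real (ks_rate l j) * fcoeff l (\<Phi> t) j + - (1/2) * conv (fderiv l (fcoeff l (\<Phi> t))) (fderiv l (fcoeff l (\<Phi> t))) j)) (at t within {0..T})"
proof -
  obtain \<Phi>t where reg: "classical_reg T \<Phi> \<Phi>t" and per: "\<And>t. t \<in> {0..T} \<Longrightarrow> periodic_on_R l (\<Phi> t)"
    and eq: "\<And>t y. t \<in> {0..T} \<Longrightarrow> \<Phi>t t y + 4 * (deriv ^^ 4) (\<Phi> t) y + (deriv ^^ 2) (\<Phi> t) y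
               + (1/2) * ((deriv (\<Phi> t) y)^2) = 0"
    using ks unfolding ks_sol_def by blast
  have c: "continuous_on S ((deriv ^^ k) (\<Phi> t))" if "k \<le> 4" for k S by (rule reg_cont[OF l per reg t that])
  have c1: "continuous_on S (deriv (\<Phi> t))" for S using c[of 1] by simp
  have e: "\<Phi>t t = (\<lambda>y. (- 4) * (deriv ^^ 4) (\<Phi> t) y + ((- 1) * (deriv ^^ 2) (\<Phi> t) y + (- (1/2)) * ((deriv (\<Phi> t) y)^2)))"
  proof
    fix y show "\<Phi>t t y = (- 4) * (deriv ^^ 4) (\<Phi> t) y + ((- 1) * (deriv ^^ 2) (\<Phi> t) y + (- (1/2)) * ((deriv (\<Phi> t) y)^2))"
      using eq[OF t, of y] by linarith
  qed
  have "fcoeff l (\<Phi>t t) j = of_real (- 4) * fcoeff l ((deriv ^^ 4) (\<Phi> t)) j + (of_real (- 1) * fcoeff l ((deriv ^^ 2) (\<Phi> t)) j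
     + of_real (- (1/2)) * fcoeff l (\<lambda>y. (deriv (\<Phi> t) y)^2) j)"
    unfolding e fcoeff_cmult[symmetric]
    by (subst fcoeff_add[symmetric], (intro continuous_intros c c1; simp), (intro continuous_intros c c1; simp))+ simp
  also have "\<dots> = - of_real (ks_rate l j) * fcoeff l (\<Phi> t) j + - (1/2) * conv (fderiv l (fcoeff l (\<Phi> t))) (fderiv l (fcoeff l (\<Phi> t))) j"
  proof -
    have "fcoeff l ((deriv ^^ 4) (\<Phi> t)) j = of_real ((Lam l j)\<^sup>2) * fcoeff l (\<Phi> t) j"
      using reg_fcoeff[OF l per reg t, of 4] fderiv_pow4 by simp
    moreover have "fcoeff l ((deriv ^^ 2) (\<Phi> t)) j = - of_real (Lam l j) * fcoeff l (\<Phi> t) j"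
      using reg_fcoeff[OF l per reg t, of 2] fderiv_pow2 by simp
    moreover have "fcoeff l (\<lambda>y. (deriv (\<Phi> t) y)\<^sup>2) j = conv (fderiv l (fcoeff l (\<Phi> t))) (fderiv l (fcoeff l (\<Phi> t))) j"
      by (rule reg_fcoeff_sq[OF l per reg t])
    ultimately show ?thesis by (simp add: ks_rate_def algebra_simps)
  qed
  finally show ?thesis using reg_fcoeff_time_deriv(1)[OF l per reg t, of j] by simp
qed

text \<open>Quadratic terms cost one power of the frequency, the fourth order smoothing regains four.\<close>

lemma ks_fcoeff_bootstrap:
  assumes r: "2 \<le> r" "r + 4 \<le> m" and A0: "\<And>j. norm (fcoeff l \<Phi>0 j) \<le> A0 / wt j ^ m"
    and A: "\<And>t j. t \<in> {0..T} \<Longrightarrow> norm (fcoeff l (\<Phi> t) j) \<le> A / wt j ^ Suc r"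
  obtains A' where "\<And>t j. t \<in> {0..T} \<Longrightarrow> norm (fcoeff l (\<Phi> t) j) \<le> A' / wt j ^ (r + 4)"
proof -
  define w where "w = 2 * pi / l"
  have w: "0 < w" using l by (simp add: w_def)
  define \<gamma> where "\<gamma> = 1/2 + 6 * w ^ 4"
  have \<gamma>: "0 < \<gamma>" using w by (simp add: \<gamma>_def add_pos_nonneg)
  define c where "c = 3/8 * w ^ 4"
  have c: "0 < c" using w by (simp add: c_def)
  have low: "c * wt j ^ 4 \<le> ks_rate l j + \<gamma>" "0 < ks_rate l j + \<gamma>" for j
  proof -
    have "c * wt j ^ 4 + \<gamma> / 2 \<le> ks_rate l j + \<gamma>"
      unfolding c_def w_def by (rule ks_rate_lower[OF l]) (simp add: \<gamma>_def w_def)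
    moreover have "0 < c * wt j ^ 4" using c wt_pos[of j] by simp
    ultimately show "c * wt j ^ 4 \<le> ks_rate l j + \<gamma>" "0 < ks_rate l j + \<gamma>" using \<gamma> by linarith+
  qed
  define G where "G = 1/2 * (conv_const r * (w * A) * (w * A))"
  have A00: "0 \<le> A0" using order_trans[OF norm_ge_zero A0[of 0]] by (simp add: wt_0)
  have "0 \<le> A" using order_trans[OF norm_ge_zero A[of 0 0]] T by (simp add: wt_0)
  then have G: "0 \<le> G" using conv_const_pos[of r] w by (simp add: G_def)
  show ?thesis
  proof (rule that)
    fix t j assume t: "t \<in> {0..T}"
    have "norm (fcoeff l (\<Phi> t) j) \<le> exp (\<gamma> * t) * (norm (fcoeff l (\<Phi> 0) j) + (G / wt j ^ r) / (ks_rate l j + \<gamma>))"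
    proof (rule ode_bound[OF t ks_fcoeff_deriv _ low(2)])
      fix s assume s: "s \<in> {0..T}"
      have "norm (conv (fderiv l (fcoeff l (\<Phi> s))) (fderiv l (fcoeff l (\<Phi> s))) j) \<le> conv_const r * (w * A) * (w * A) / wt j ^ r"
        unfolding w_def by (intro conv_bound r fderiv_bound[OF l] A s)
      then have "norm (- (1/2) * conv (fderiv l (fcoeff l (\<Phi> s))) (fderiv l (fcoeff l (\<Phi> s))) j) \<le> G / wt j ^ r * 1"
        by (simp add: norm_mult G_def)
      also have "\<dots> \<le> G / wt j ^ r * exp (\<gamma> * s)"
        using G \<gamma> s wt_pos[of j] by (intro mult_left_mono) auto
      finally show "norm (- (1/2) * conv (fderiv l (fcoeff l (\<Phi> s))) (fderiv l (fcoeff l (\<Phi> s))) j) \<le> G / wt j ^ r * exp (\<gamma> * s)" .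
    qed
    also have "\<dots> \<le> exp (\<gamma> * T) * (A0 / wt j ^ (r + 4) + G / c / wt j ^ (r + 4))"
    proof (intro mult_mono add_mono)
      have "fcoeff l (\<Phi> 0) = fcoeff l \<Phi>0" using ks by (metis ks_sol_def ext)
      then have "norm (fcoeff l (\<Phi> 0) j) \<le> A0 * (1 / wt j ^ m)" using A0[of j] by simp
      also have "\<dots> \<le> A0 * (1 / wt j ^ (r + 4))" by (intro mult_left_mono wt_powr_mono r A00)
      finally show "norm (fcoeff l (\<Phi> 0) j) \<le> A0 / wt j ^ (r + 4)" by simp
      \<comment> \<open>The gain: the factor 1 / (rate + \<gamma>) provided by
        \<open>ode_bound\<close> is worth four powers of the weight.\<close>
      have "(G / wt j ^ r) / (ks_rate l j + \<gamma>) \<le> (G / wt j ^ r) / (c * wt j ^ 4)"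
        using low[of j] G c wt_pos[of j] by (intro divide_left_mono) auto
      then show "(G / wt j ^ r) / (ks_rate l j + \<gamma>) \<le> G / c / wt j ^ (r + 4)"
        by (simp add: power_add mult_ac)
      show "exp (\<gamma> * t) \<le> exp (\<gamma> * T)" using \<gamma> t by simp
    qed (use G low(2)[of j] wt_pos[of j] in auto)
    finally show "norm (fcoeff l (\<Phi> t) j) \<le> (exp (\<gamma> * T) * (A0 + G / c)) / wt j ^ (r + 4)"
      by (simp add: add_divide_distrib distrib_left)
  qed
qed

text \<open>Each round of the bootstrap nets three powers. Two rounds lead from 4, given by
  classical regularity, through 7 to 10, which the decay of the initial datum must reach as
  well.\<close>

lemma ks_fcoeff_decay:
  assumes m: "10 \<le> m" and A0: "\<And>j. norm (fcoeff l \<Phi>0 j) \<le> A0 / wt j ^ m"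
  obtains A where "\<And>t j. t \<in> {0..T} \<Longrightarrow> norm (fcoeff l (\<Phi> t) j) \<le> A / wt j ^ 10"
proof -
  obtain \<Phi>t where reg: "classical_reg T \<Phi> \<Phi>t" and per: "\<And>t. t \<in> {0..T} \<Longrightarrow> periodic_on_R l (\<Phi> t)"
    using ks unfolding ks_sol_def by blast
  obtain A1 where "\<And>t j. t \<in> {0..T} \<Longrightarrow> norm (fcoeff l (\<Phi> t) j) \<le> A1 / wt j ^ 4" by (rule reg_decay4[OF l per reg]) (assumption, rule that)
  then have "\<And>t j. t \<in> {0..T} \<Longrightarrow> norm (fcoeff l (\<Phi> t) j) \<le> A1 / wt j ^ Suc 3" by simp
  then obtain A2 where "\<And>t j. t \<in> {0..T} \<Longrightarrow> norm (fcoeff l (\<Phi> t) j) \<le> A2 / wt j ^ (3 + 4)"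
    using ks_fcoeff_bootstrap[of 3 m A0 A1] m A0 by force
  then have "\<And>t j. t \<in> {0..T} \<Longrightarrow> norm (fcoeff l (\<Phi> t) j) \<le> A2 / wt j ^ Suc 6" by simp
  then obtain A3 where "\<And>t j. t \<in> {0..T} \<Longrightarrow> norm (fcoeff l (\<Phi> t) j) \<le> A3 / wt j ^ (6 + 4)"
    using ks_fcoeff_bootstrap[of 6 m A0 A2] m A0 by force
  then show ?thesis by (intro that) simp
qed

end

section \<open>Real basis and rescaling\<close>

lemma fcoeff_Re_Im:
  assumes f: "continuous_on {-l/2..l/2} f"
  shows "Re (fcoeff l f j) = integral {-l/2..l/2} (\<lambda>y. f y * cos (2 * pi * real_of_int j * y / l)) / l"
    and "Im (fcoeff l f j) = - integral {-l/2..l/2} (\<lambda>y. f y * sin (2 * pi * real_of_int j * y / l)) / l"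
proof -
  let ?h = "\<lambda>y. of_real (f y) * fexp l (- j) y"
  have i: "?h integrable_on {-l/2..l/2}" by (rule fcoeff_integrable[OF f])
  have "integral {-l/2..l/2} (Re \<circ> ?h) = Re (integral {-l/2..l/2} ?h)"
    by (rule integral_linear[OF i bounded_linear_Re])
  moreover have "Re \<circ> ?h = (\<lambda>y. f y * cos (2 * pi * real_of_int j * y / l))"
    by (simp add: fun_eq_iff fexp_def)
  ultimately show "Re (fcoeff l f j) = integral {-l/2..l/2} (\<lambda>y. f y * cos (2 * pi * real_of_int j * y / l)) / l"
    by (simp add: fcoeff_def Re_divide_of_real)
  have "integral {-l/2..l/2} (Im \<circ> ?h) = Im (integral {-l/2..l/2} ?h)"
    by (rule integral_linear[OF i bounded_linear_Im])
  moreover have "Im \<circ> ?h = (\<lambda>y. - (f y * sin (2 * pi * real_of_int j * y / l)))"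
    by (simp add: fun_eq_iff fexp_def)
  ultimately have "Im (integral {-l/2..l/2} ?h) = - integral {-l/2..l/2} (\<lambda>y. f y * sin (2 * pi * real_of_int j * y / l))"
    by (simp only: integral_neg)
  then show "Im (fcoeff l f j) = - integral {-l/2..l/2} (\<lambda>y. f y * sin (2 * pi * real_of_int j * y / l)) / l"
    by (simp add: fcoeff_def Im_divide_of_real)
qed

lemma fc_eq_fcoeff:
  assumes l: "l > 0" and f: "continuous_on {-l/2..l/2} f"
  shows "fc l f 0 = sqrt l * Re (fcoeff l f 0)"
    and "odd k \<Longrightarrow> fc l f k = sqrt (2 / l) * l * Re (fcoeff l f (int (freq k)))"
    and "even k \<Longrightarrow> k \<noteq> 0 \<Longrightarrow> fc l f k = - (sqrt (2 / l) * l * Im (fcoeff l f (int (freq k))))"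
proof -
  have "fc l f 0 = integral {-l/2..l/2} f / sqrt l"
    by (simp add: fc_def wb_def)
  moreover have "integral {-l/2..l/2} f = l * Re (fcoeff l f 0)" using fcoeff_Re_Im(1)[OF f, of 0] l by simp
  ultimately have "fc l f 0 = (l / sqrt l) * Re (fcoeff l f 0)" by simp
  moreover have "l / sqrt l = sqrt l" using l by (simp add: real_div_sqrt)
  ultimately show "fc l f 0 = sqrt l * Re (fcoeff l f 0)" by (simp only:)
next
  assume "odd k"
  moreover from this have "k \<noteq> 0" by (metis even_zero)
  ultimately have "fc l f k = integral {-l/2..l/2} (\<lambda>y. sqrt (2 / l) * (f y * cos (2 * pi * real_of_int (int (freq k)) * y / l)))"
    unfolding fc_def wb_def by (simp add: mult_ac)
  then show "fc l f k = sqrt (2 / l) * l * Re (fcoeff l f (int (freq k)))"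
    using l unfolding fcoeff_Re_Im(1)[OF f] by simp
next
  assume "even k" "k \<noteq> 0"
  then have "fc l f k = integral {-l/2..l/2} (\<lambda>y. sqrt (2 / l) * (f y * sin (2 * pi * real_of_int (int (freq k)) * y / l)))"
    unfolding fc_def wb_def by (simp add: mult_ac)
  then show "fc l f k = - (sqrt (2 / l) * l * Im (fcoeff l f (int (freq k))))"
    using l unfolding fcoeff_Re_Im(2)[OF f] by simp
qed

lemma freq_eqs: "freq 0 = 0" "0 < n \<Longrightarrow> freq (2 * n - Suc 0) = n" "freq (2 * n) = n"
  by (auto simp: freq_def)

lemma fcoeff_eq_fc:
  assumes l: "l > 0" and f: "continuous_on {-l/2..l/2} f"
  shows "fcoeff l f 0 = of_real (fc l f 0 / sqrt l)"
    and "0 < n \<Longrightarrow> fcoeff l f (int n) = of_real (fc l f (2 * n - 1) / (sqrt (2 / l) * l)) - \<i> * of_real (fc l f (2 * n) / (sqrt (2 / l) * l))"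
proof -
  have "Im (fcoeff l f 0) = 0" using fcoeff_Re_Im(2)[OF f, of 0] by simp
  then show "fcoeff l f 0 = of_real (fc l f 0 / sqrt l)"
    using fc_eq_fcoeff(1)[OF l f] l by (simp add: complex_eq_iff)
  assume n: "0 < n"
  then have "odd (2 * n - 1)" by simp
  from fc_eq_fcoeff(2)[OF l f this] fc_eq_fcoeff(3)[OF l f, of "2 * n"] n l
  show "fcoeff l f (int n) = of_real (fc l f (2 * n - 1) / (sqrt (2 / l) * l)) - \<i> * of_real (fc l f (2 * n) / (sqrt (2 / l) * l))"
    by (simp add: complex_eq_iff freq_eqs)
qed

text \<open>Every term of a convergent series with nonnegative terms is bounded by its sum. Reading
  the norm one frequency at a time loses no power of the weight, unlike an embedding through the
  regularity of the function.\<close>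

lemma Hsharp_fcoeff_decay:
  assumes l: "l > 0" and f: "continuous_on {-l/2..l/2} f" and H: "f \<in> Hsharp m l"
  obtains A where "\<And>j. norm (fcoeff l f j) \<le> A / wt j ^ m"
proof -
  define S where "S = (\<Sum>k. (1 + lam l k) ^ m * (fc l f k)\<^sup>2)"
  \<comment> \<open>Chosen for \<open>c * wt^2 \<le> 1 + lam\<close>; the division by 2 comes from
    (1 + x)^2 \<le> 2 (1 + x^2).\<close>
  define c where "c = min 1 ((2 * pi / l)\<^sup>2) / 2"
  have c: "0 < c" using l by (simp add: c_def)
  have lam: "lam l k = (2 * pi / l)\<^sup>2 * (real (freq k))\<^sup>2" for k
    by (simp add: lam_def power_mult_distrib power_divide)
  have t: "(1 + lam l k) ^ m * (fc l f k)\<^sup>2 \<le> S" for k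
  proof -
    have "(\<Sum>i\<in>{k}. (1 + lam l i) ^ m * (fc l f i)\<^sup>2) \<le> S"
      unfolding S_def using H by (intro sum_le_suminf) (auto simp: Hsharp_def lam)
    then show ?thesis by simp
  qed
  define D where "D = sqrt (S / c ^ m)"
  have b: "\<bar>fc l f k\<bar> \<le> D / wt (int (freq k)) ^ m" for k
  proof -
    let ?x = "real (freq k)"
    have "c * wt (int (freq k)) ^ 2 \<le> 1 + lam l k"
    proof -
      have "c * (1 + ?x)\<^sup>2 \<le> c * (2 * (1 + ?x\<^sup>2))"
        using c sum_squares_ge_zero[of "?x - 1" 0]
        by (intro mult_left_mono) (auto simp: power2_eq_square algebra_simps)
      also have "\<dots> = min 1 ((2 * pi / l)\<^sup>2) * 1 + min 1 ((2 * pi / l)\<^sup>2) * ?x\<^sup>2" by (simp add: c_def algebra_simps)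
      also have "\<dots> \<le> 1 * 1 + (2 * pi / l)\<^sup>2 * ?x\<^sup>2" by (intro add_mono mult_right_mono) auto
      finally show ?thesis by (simp add: lam wt_def)
    qed
    then have "(c * wt (int (freq k)) ^ 2) ^ m \<le> (1 + lam l k) ^ m"
      using c by (intro power_mono) auto
    then have "(c * wt (int (freq k)) ^ 2) ^ m * (fc l f k)\<^sup>2 \<le> S"
      using t[of k] mult_right_mono[of "(c * wt (int (freq k)) ^ 2) ^ m" "(1 + lam l k) ^ m" "(fc l f k)\<^sup>2"] by simp
    then have "(wt (int (freq k)) ^ m * \<bar>fc l f k\<bar>)\<^sup>2 \<le> S / c ^ m"
      using c by (simp add: power_mult_distrib field_simps flip: power_mult)
    then have "wt (int (freq k)) ^ m * \<bar>fc l f k\<bar> \<le> D"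
      unfolding D_def by (rule real_le_rsqrt)
    then show ?thesis using wt_pos[of "int (freq k)"] by (simp add: field_simps)
  qed
  have D: "0 \<le> D" using order_trans[OF abs_ge_zero b[of 0]] by (simp add: freq_eqs wt_0)
  define s where "s = sqrt (2 / l) * l"
  have s: "0 < s" using l by (simp add: s_def)
  \<comment> \<open>One constant for both normalisations: \<open>D / sqrt l\<close> for the zero
    mode, \<open>2 * D / s\<close> for the sum of a cosine and a sine coefficient.\<close>
  have pos: "norm (fcoeff l f (int n)) \<le> (D / sqrt l + 2 * D / s) / wt (int n) ^ m" for n
  proof (cases "n = 0")
    case True
    have "norm (fcoeff l f 0) \<le> D / sqrt l" using b[of 0] l
      by (simp add: fcoeff_eq_fc(1)[OF l f] freq_eqs wt_0 norm_divide divide_right_mono)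
    also have "\<dots> \<le> D / sqrt l + 2 * D / s" using D s by simp
    finally show ?thesis using True by (simp add: wt_0)
  next
    case False
    then have n: "0 < n" by simp
    have "norm (fcoeff l f (int n)) \<le> \<bar>fc l f (2 * n - 1)\<bar> / s + \<bar>fc l f (2 * n)\<bar> / s"
      unfolding fcoeff_eq_fc(2)[OF l f n] s_def[symmetric]
      by (rule order_trans[OF norm_triangle_ineq4]) (use s in \<open>simp add: norm_mult norm_divide\<close>)
    also have "\<dots> \<le> D / wt (int n) ^ m / s + D / wt (int n) ^ m / s"
      using b[of "2 * n - 1"] b[of "2 * n"] s n by (intro add_mono divide_right_mono) (auto simp: freq_eqs)
    also have "\<dots> = (2 * D / s) / wt (int n) ^ m" by simp
    also have "\<dots> \<le> (D / sqrt l + 2 * D / s) / wt (int n) ^ m"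
      using D l wt_pos[of "int n"] by (intro divide_right_mono) auto
    finally show ?thesis .
  qed
  show ?thesis
  proof (rule that)
    fix j show "norm (fcoeff l f j) \<le> (D / sqrt l + 2 * D / s) / wt j ^ m"
    proof (cases "j \<ge> 0")
      case True then show ?thesis using pos[of "nat j"] by simp
    next
      case False then show ?thesis using pos[of "nat (- j)"] fcoeff_cnj[OF f, of j] wt_minus[of j] by simp
    qed
  qed
qed

lemma symbol_scale:
  assumes "0 < \<epsilon>" "0 < l"
  shows "bsym (1 + \<epsilon>) (l / sqrt \<epsilon>) k = b_sym l \<epsilon> (int (freq k))"
    "ssym (1 + \<epsilon>) (l / sqrt \<epsilon>) k = - \<epsilon>\<^sup>2 * ks_rate l (int (freq k))"
    "fsym (1 + \<epsilon>) (l / sqrt \<epsilon>) k = f_sym l \<epsilon> (int (freq k))"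
proof -
  have L: "lam (l / sqrt \<epsilon>) k = \<epsilon> * Lam l (int (freq k))"
    using assms by (simp add: lam_def Lam_def power_divide power_mult_distrib)
  then have X: "Xs (l / sqrt \<epsilon>) k = X_sym l \<epsilon> (int (freq k))" by (simp add: Xs_def X_sym_def)
  show "bsym (1 + \<epsilon>) (l / sqrt \<epsilon>) k = b_sym l \<epsilon> (int (freq k))"
    "fsym (1 + \<epsilon>) (l / sqrt \<epsilon>) k = f_sym l \<epsilon> (int (freq k))"
    by (simp_all add: bsym_def b_sym_def fsym_def f_sym_def X)
  show "ssym (1 + \<epsilon>) (l / sqrt \<epsilon>) k = - \<epsilon>\<^sup>2 * ks_rate l (int (freq k))"
    by (simp add: ssym_def ks_rate_def L power2_eq_square algebra_simps)
qed

text \<open>The factor \<mu> depends on the mode only and not on f, so that linear differential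
  equations can be carried over. For sine modes it is imaginary, since Re(i z) = - Im z.\<close>

lemma fc_Re_fcoeff:
  assumes l: "l > 0"
  obtains \<mu> where "\<And>f. continuous_on {-l/2..l/2} f \<Longrightarrow> fc l f k = Re (\<mu> * fcoeff l f (int (freq k)))"
proof -
  define \<mu> where "\<mu> = (if k = 0 then of_real (sqrt l) else if odd k then of_real (sqrt (2 / l) * l)
    else \<i> * of_real (sqrt (2 / l) * l))"
  show ?thesis
    by (rule that[of \<mu>], cases "k = 0"; cases "odd k")
      (use fc_eq_fcoeff[OF l] in \<open>auto simp: \<mu>_def freq_eqs\<close>)
qed

lemma fcoeff_fc_combination:
  assumes l: "l > 0"
  obtains a b k k' where "int (freq k) = \<bar>j\<bar>" "int (freq k') = \<bar>j\<bar>"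
    "\<And>f. continuous_on {-l/2..l/2} f \<Longrightarrow> fcoeff l f j = a * of_real (fc l f k) + b * of_real (fc l f k')"
proof -
  define r where "r = complex_of_real (sqrt (2 / l) * l)"
  show ?thesis
  proof (cases j rule: int_cases3)
    case zero
    then show ?thesis
      using fcoeff_eq_fc(1)[OF l] by (intro that[of 0 0 "1 / of_real (sqrt l)" 0]) (auto simp: freq_eqs)
  next
    case (pos n)
    then show ?thesis
      using fcoeff_eq_fc(2)[OF l, of _ n]
      by (intro that[of "2 * n - 1" "2 * n" "1 / r" "- \<i> / r"]) (auto simp: freq_eqs r_def)
  next
    case (neg n)
    have "fcoeff l f j = cnj (fcoeff l f (int n))" if "continuous_on {-l/2..l/2} f" for f
      using fcoeff_cnj[OF that, of "int n"] neg by simp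
    then show ?thesis
      using fcoeff_eq_fc(2)[OF l, of _ n] neg
      by (intro that[of "2 * n - 1" "2 * n" "1 / r" "\<i> / r"]) (auto simp: freq_eqs r_def)
  qed
qed

text \<open>Evenness makes the symbols agree at j and -j, hence on both real modes of one frequency.
  The real and the complex equations are therefore linear combinations of each other; q stands for
  the nonlinearity, whose form is irrelevant here.\<close>

lemma fc_fcoeff_equation:
  fixes B S F :: "int \<Rightarrow> real" and z :: "real \<Rightarrow> real \<Rightarrow> real"
  assumes l: "l > 0" and t: "t \<in> I" and z: "\<And>s. s \<in> I \<Longrightarrow> continuous_on {-l/2..l/2} (z s)"
    and q: "continuous_on {-l/2..l/2} q"
    and even: "\<And>j. B (- j) = B j" "\<And>j. S (- j) = S j" "\<And>j. F (- j) = F j"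
  shows "(\<forall>k. ((\<lambda>s. B (int (freq k)) * fc l (z s) k) has_real_derivative
        (S (int (freq k)) * fc l (z t) k + F (int (freq k)) * fc l q k)) (at t within I))
    \<longleftrightarrow> (\<forall>j. ((\<lambda>s. of_real (B j) * fcoeff l (z s) j) has_vector_derivative
        (of_real (S j) * fcoeff l (z t) j + of_real (F j) * fcoeff l q j)) (at t within I))"
    (is "?L \<longleftrightarrow> ?R")
proof
  assume L: ?L
  show ?R
  proof
    fix j
    obtain a b k k' where k: "int (freq k) = \<bar>j\<bar>" "int (freq k') = \<bar>j\<bar>"
      and fcoeff: "\<And>f. continuous_on {-l/2..l/2} f \<Longrightarrow> fcoeff l f j = a * of_real (fc l f k) + b * of_real (fc l f k')"
      by (rule fcoeff_fc_combination[OF l, of j]) (rule that)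
    have ev: "B \<bar>j\<bar> = B j" "S \<bar>j\<bar> = S j" "F \<bar>j\<bar> = F j" using even by (simp_all add: abs_if)
    have d: "((\<lambda>s. (of_real (B (int (freq k)) * fc l (z s) k) :: complex)) has_vector_derivative
        of_real (S (int (freq k)) * fc l (z t) k + F (int (freq k)) * fc l q k)) (at t within I)" for k
      using L by (intro has_vector_derivative_of_real) blast
    have "((\<lambda>s. a * of_real (B j * fc l (z s) k) + b * of_real (B j * fc l (z s) k')) has_vector_derivative
        a * of_real (S j * fc l (z t) k + F j * fc l q k) + b * of_real (S j * fc l (z t) k' + F j * fc l q k')) (at t within I)"
      using has_vector_derivative_add[OF bounded_linear.has_vector_derivative[OF bounded_linear_mult_right d[of k]]
          bounded_linear.has_vector_derivative[OF bounded_linear_mult_right d[of k']], of a b]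
      unfolding k ev .
    moreover have "a * of_real (S j * fc l (z t) k + F j * fc l q k) + b * of_real (S j * fc l (z t) k' + F j * fc l q k')
        = of_real (S j) * fcoeff l (z t) j + of_real (F j) * fcoeff l q j"
      unfolding fcoeff[OF z[OF t]] fcoeff[OF q] by (simp add: algebra_simps)
    ultimately have "((\<lambda>s. a * of_real (B j * fc l (z s) k) + b * of_real (B j * fc l (z s) k')) has_vector_derivative
        of_real (S j) * fcoeff l (z t) j + of_real (F j) * fcoeff l q j) (at t within I)" by (simp only:)
    then show "((\<lambda>s. of_real (B j) * fcoeff l (z s) j) has_vector_derivative
        of_real (S j) * fcoeff l (z t) j + of_real (F j) * fcoeff l q j) (at t within I)"
      by (rule has_vector_derivative_transform[OF t, rotated]) (simp add: fcoeff[OF z] algebra_simps)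
  qed
next
  assume R: ?R
  show ?L
  proof
    fix k
    let ?n = "int (freq k)"
    obtain \<mu> where fc: "\<And>f. continuous_on {-l/2..l/2} f \<Longrightarrow> fc l f k = Re (\<mu> * fcoeff l f ?n)"
      by (rule fc_Re_fcoeff[OF l, of k]) (rule that)
    have "((\<lambda>s. Re (\<mu> * (of_real (B ?n) * fcoeff l (z s) ?n))) has_real_derivative
        Re (\<mu> * (of_real (S ?n) * fcoeff l (z t) ?n + of_real (F ?n) * fcoeff l q ?n))) (at t within I)"
      unfolding has_real_derivative_iff_has_vector_derivative
      by (intro bounded_linear.has_vector_derivative[OF bounded_linear_Re]
          bounded_linear.has_vector_derivative[OF bounded_linear_mult_right] R[rule_format])
    moreover have "Re (\<mu> * (of_real (S ?n) * fcoeff l (z t) ?n + of_real (F ?n) * fcoeff l q ?n)) = S ?n * fc l (z t) k + F ?n * fc l q k"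
      unfolding fc[OF z[OF t]] fc[OF q] by (simp add: algebra_simps)
    ultimately have "((\<lambda>s. Re (\<mu> * (of_real (B ?n) * fcoeff l (z s) ?n))) has_real_derivative S ?n * fc l (z t) k + F ?n * fc l q k) (at t within I)"
      by (simp only:)
    then show "((\<lambda>s. B ?n * fc l (z s) k) has_real_derivative (S ?n * fc l (z t) k + F ?n * fc l q k)) (at t within I)"
      by (rule has_field_derivative_transform_within[OF _ zero_less_one t]) (simp add: fc[OF z] algebra_simps)
  qed
qed

section \<open>Rescaling of amplitude, time and space\<close>

lemma fcoeff_scale:
  assumes "\<kappa> > 0" "l > 0" "continuous_on UNIV f"
  shows "fcoeff (l / \<kappa>) (\<lambda>y. f (\<kappa> * y)) j = fcoeff l f j"
proof -
  let ?h = "\<lambda>y. of_real (f y) * fexp l (- j) y"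
  have "(?h has_integral integral {-l/2..l/2} ?h) {-l/2..l/2}"
    using assms by (intro integrable_integral fcoeff_integrable) (auto intro: continuous_on_subset)
  then have "((\<lambda>y. ?h (\<kappa> * y)) has_integral (1 / \<kappa>) *\<^sub>R integral {-l/2..l/2} ?h) ((\<lambda>y. y / \<kappa>) ` {-l/2..l/2})"
    using has_integral_stretch_real[of ?h _ "-l/2" "l/2" \<kappa>] assms by simp
  moreover have "(\<lambda>y. y / \<kappa>) ` {-l/2..l/2} = {- (l / \<kappa>) / 2..(l / \<kappa>) / 2}"
  proof -
    have "(\<lambda>y. y / \<kappa>) ` {-l/2..l/2} = (\<lambda>y. inverse \<kappa> * y) ` {-l/2..l/2}" by (simp add: field_simps)
    then show ?thesis using assms image_mult_atLeastAtMost[of "inverse \<kappa>" "-l/2" "l/2"] by (simp add: field_simps)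
  qed
  moreover have "fexp (l / \<kappa>) (- j) y = fexp l (- j) (\<kappa> * y)" for y
    using assms by (simp add: fexp_def mult_ac)
  ultimately have "integral {- (l / \<kappa>) / 2..(l / \<kappa>) / 2} (\<lambda>y. of_real (f (\<kappa> * y)) * fexp (l / \<kappa>) (- j) y)
      = (1 / \<kappa>) *\<^sub>R integral {-l/2..l/2} ?h"
    by (simp add: integral_unique)
  then show ?thesis unfolding fcoeff_def using assms by (simp add: scaleR_conv_of_real)
qed

lemma deriv_scale:
  assumes "\<And>k y. k < m \<Longrightarrow> ((deriv ^^ k) f has_real_derivative (deriv ^^ Suc k) f y) (at y)"
  shows "k \<le> m \<Longrightarrow> (deriv ^^ k) (\<lambda>y. a * f (\<kappa> * y)) = (\<lambda>y. a * \<kappa> ^ k * (deriv ^^ k) f (\<kappa> * y))"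
    and "k < m \<Longrightarrow> ((deriv ^^ k) (\<lambda>y. a * f (\<kappa> * y)) has_real_derivative (deriv ^^ Suc k) (\<lambda>y. a * f (\<kappa> * y)) y) (at y)"
proof -
  have d: "((\<lambda>y. a * \<kappa> ^ k * (deriv ^^ k) f (\<kappa> * y)) has_real_derivative a * \<kappa> ^ Suc k * (deriv ^^ Suc k) f (\<kappa> * y)) (at y)"
    if "k < m" for k y
  proof -
    have "((\<lambda>y. (deriv ^^ k) f (\<kappa> * y)) has_real_derivative (deriv ^^ Suc k) f (\<kappa> * y) * \<kappa>) (at y)"
      by (rule DERIV_chain2[OF assms[OF that]]) (auto intro!: derivative_eq_intros)
    from DERIV_cmult[OF this, of "a * \<kappa> ^ k"] show ?thesis by (simp add: mult_ac)
  qed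
  note chain = deriv_pow_chain[of m "\<lambda>k y. a * \<kappa> ^ k * (deriv ^^ k) f (\<kappa> * y)", OF d]
  show "k \<le> m \<Longrightarrow> (deriv ^^ k) (\<lambda>y. a * f (\<kappa> * y)) = (\<lambda>y. a * \<kappa> ^ k * (deriv ^^ k) f (\<kappa> * y))"
    and "k < m \<Longrightarrow> ((deriv ^^ k) (\<lambda>y. a * f (\<kappa> * y)) has_real_derivative (deriv ^^ Suc k) (\<lambda>y. a * f (\<kappa> * y)) y) (at y)"
    using chain[of k] by simp_all
qed

lemma classical_reg_scale:
  assumes reg: "classical_reg T u ut" and b: "b > 0"
  shows "classical_reg (T / b) (\<lambda>t y. a * u (b * t) (\<kappa> * y)) (\<lambda>t y. a * b * ut (b * t) (\<kappa> * y))"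
proof -
  have in_T: "b * t \<in> {0..T}" if "t \<in> {0..T / b}" for t using that b by (auto simp: field_simps)
  have d: "((deriv ^^ k) (u t) has_real_derivative (deriv ^^ Suc k) (u t) y) (at y)" if "t \<in> {0..T}" "k < 4" for t k y
    using reg that unfolding classical_reg_def by blast
  have c: "continuous_on ({0..T} \<times> UNIV) (\<lambda>(t, y). (deriv ^^ k) (u t) y)" if "k \<le> 4" for k
    using reg that unfolding classical_reg_def by blast
  have ct: "continuous_on ({0..T} \<times> UNIV) (\<lambda>(t, y). ut t y)"
    using reg unfolding classical_reg_def by blast
  have dt: "((\<lambda>s. u s y) has_real_derivative ut t y) (at t within {0..T})" if "t \<in> {0..T}" for t y
    using reg that unfolding classical_reg_def by blast
  have comp: "continuous_on ({0..T / b} \<times> UNIV) (\<lambda>(t, y). C * g (b * t) (\<kappa> * y))"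
    if "continuous_on ({0..T} \<times> UNIV) (\<lambda>(t, y). g t y)" for g :: "real \<Rightarrow> real \<Rightarrow> real" and C
  proof -
    have "continuous_on ({0..T / b} \<times> UNIV) (\<lambda>p. (b * fst p, \<kappa> * snd p :: real))" by (intro continuous_intros)
    moreover have "(\<lambda>p. (b * fst p, \<kappa> * snd p :: real)) ` ({0..T / b} \<times> UNIV) \<subseteq> {0..T} \<times> UNIV"
      using in_T by auto
    ultimately have "continuous_on ({0..T / b} \<times> UNIV) (\<lambda>p. case (b * fst p, \<kappa> * snd p) of (t, y) \<Rightarrow> g t y)"
      by (rule continuous_on_compose2[OF that])
    then show ?thesis unfolding split_beta by (intro continuous_intros) simp
  qed
  show ?thesis
    unfolding classical_reg_def
  proof (intro conjI ballI allI impI)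
    fix t j y assume t: "t \<in> {0..T / b}" and "(j::nat) < 4"
    then show "((deriv ^^ j) (\<lambda>y. a * u (b * t) (\<kappa> * y)) has_real_derivative (deriv ^^ Suc j) (\<lambda>y. a * u (b * t) (\<kappa> * y)) y) (at y)"
      by (intro deriv_scale(2)[of 4] d in_T)
  next
    fix j :: nat assume j: "j \<le> 4"
    have "continuous_on ({0..T / b} \<times> UNIV) (\<lambda>(t, y). a * \<kappa> ^ j * (deriv ^^ j) (u (b * t)) (\<kappa> * y))"
      by (rule comp[OF c[OF j]])
    then show "continuous_on ({0..T / b} \<times> UNIV) (\<lambda>(t, y). (deriv ^^ j) (\<lambda>y. a * u (b * t) (\<kappa> * y)) y)"
      by (rule continuous_on_eq) (use deriv_scale(1)[of 4 "u (b * _)", OF d[OF in_T] j] in auto)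
  next
    show "continuous_on ({0..T / b} \<times> UNIV) (\<lambda>(t, y). a * b * ut (b * t) (\<kappa> * y))"
      by (rule comp[OF ct])
  next
    fix t y assume t: "t \<in> {0..T / b}"
    have "((\<lambda>s. b * s) ` {0..T / b}) \<subseteq> {0..T}" using in_T by auto
    then have "((\<lambda>s. u s (\<kappa> * y)) has_real_derivative ut (b * t) (\<kappa> * y)) (at (b * t) within ((\<lambda>s. b * s) ` {0..T / b}))"
      by (rule DERIV_subset[OF dt[OF in_T[OF t]]])
    from DERIV_image_chain[OF this, of b] 
    have "((\<lambda>s. u (b * s) (\<kappa> * y)) has_real_derivative ut (b * t) (\<kappa> * y) * b) (at t within {0..T / b})"
      by (auto simp: o_def intro!: derivative_eq_intros)
    from DERIV_cmult[OF this, of a]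
    show "((\<lambda>s. a * u (b * s) (\<kappa> * y)) has_real_derivative a * b * ut (b * t) (\<kappa> * y)) (at t within {0..T / b})"
      by (simp add: mult_ac)
  qed
qed

text \<open>The symbols are parameters so that one predicate covers the original and the rescaled
  problem, and one scaling lemma leads both ways.\<close>

definition spectral_sol :: "real \<Rightarrow> real \<Rightarrow> (int \<Rightarrow> real) \<Rightarrow> (int \<Rightarrow> real) \<Rightarrow> (int \<Rightarrow> real) \<Rightarrow> (real \<Rightarrow> real \<Rightarrow> real) \<Rightarrow> bool" where
  "spectral_sol l T B S F u \<longleftrightarrow> (\<forall>t\<in>{0..T}. periodic_on_R l (u t)) \<and> (\<exists>ut. classical_reg T u ut)
    \<and> (\<forall>t\<in>{0..T}. \<forall>j. ((\<lambda>s. of_real (B j) * fcoeff l (u s) j) has_vector_derivative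
        (of_real (S j) * fcoeff l (u t) j + of_real (F j) * fcoeff l (\<lambda>y. (deriv (u t) y)\<^sup>2) j)) (at t within {0..T}))"

abbreviation rescaled_sol :: "real \<Rightarrow> real \<Rightarrow> real \<Rightarrow> (real \<Rightarrow> real \<Rightarrow> real) \<Rightarrow> bool" where
  "rescaled_sol l T \<epsilon> \<equiv> spectral_sol l T (b_sym l \<epsilon>) (\<lambda>j. - ks_rate l j) (f_sym l \<epsilon>)"

lemma classical_reg_cont:
  assumes "classical_reg T u ut" "t \<in> {0..T}"
  shows "continuous_on S (u t)" "continuous_on S (deriv (u t))"
proof -
  have c: "continuous_on ({0..T} \<times> UNIV) (\<lambda>(t, y). (deriv ^^ k) (u t) y)" if "k \<le> 4" for k
    using assms(1) that unfolding classical_reg_def by blast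
  show "continuous_on S (u t)" "continuous_on S (deriv (u t))"
    using continuous_on_slice[OF c[of 0] assms(2), of S] continuous_on_slice[OF c[of 1] assms(2), of S] by simp_all
qed

lemma classical_sol_iff_spectral_sol:
  assumes e: "0 < \<epsilon>" and l: "0 < l"
  shows "classical_sol (1 + \<epsilon>) (l / sqrt \<epsilon>) T \<phi> \<longleftrightarrow>
    spectral_sol (l / sqrt \<epsilon>) T (b_sym l \<epsilon>) (\<lambda>j. - \<epsilon>\<^sup>2 * ks_rate l j) (f_sym l \<epsilon>) \<phi>"
proof -
  have L: "0 < l / sqrt \<epsilon>" using assms by simp
  have eq: "(\<forall>k. ((\<lambda>s. bsym (1 + \<epsilon>) (l / sqrt \<epsilon>) k * fc (l / sqrt \<epsilon>) (\<phi> s) k) has_real_derivative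
           (ssym (1 + \<epsilon>) (l / sqrt \<epsilon>) k * fc (l / sqrt \<epsilon>) (\<phi> t) k
            + fsym (1 + \<epsilon>) (l / sqrt \<epsilon>) k * fc (l / sqrt \<epsilon>) (\<lambda>y. (deriv (\<phi> t) y)^2) k)) (at t within {0..T}))
    \<longleftrightarrow> (\<forall>j. ((\<lambda>s. of_real (b_sym l \<epsilon> j) * fcoeff (l / sqrt \<epsilon>) (\<phi> s) j) has_vector_derivative
        (of_real (- \<epsilon>\<^sup>2 * ks_rate l j) * fcoeff (l / sqrt \<epsilon>) (\<phi> t) j + of_real (f_sym l \<epsilon> j) * fcoeff (l / sqrt \<epsilon>) (\<lambda>y. (deriv (\<phi> t) y)\<^sup>2) j)) (at t within {0..T}))"
    if reg: "classical_reg T \<phi> \<phi>t" and t: "t \<in> {0..T}" for \<phi>t t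
    unfolding symbol_scale[OF e l]
    by (rule fc_fcoeff_equation[OF L t]) (auto intro!: continuous_intros classical_reg_cont[OF reg] t simp: symbol_even)
  show ?thesis unfolding classical_sol_def spectral_sol_def using eq by blast
qed

text \<open>Time contributes b, and the squared derivative scales like a^2 \<kappa>^2 while the
  linear terms scale like a; hence the factor of \<open>F\<close>. It equals 1 for a = \<epsilon>, b
  = \<epsilon>^2 and \<kappa> = sqrt \<epsilon>, so exactly this scaling leaves \<open>f_sym\<close>
  in place.\<close>

lemma spectral_sol_scale:
  assumes g: "spectral_sol l T B S F u" and pos: "l > 0" "a > 0" "b > 0" "\<kappa> > 0"
  shows "spectral_sol (l / \<kappa>) (T / b) B (\<lambda>j. b * S j) (\<lambda>j. b / (a * \<kappa>\<^sup>2) * F j) (\<lambda>t y. a * u (b * t) (\<kappa> * y))"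
proof -
  have in_T: "b * t \<in> {0..T}" if "t \<in> {0..T / b}" for t using that pos by (auto simp: field_simps)
  obtain ut where reg: "classical_reg T u ut" using g unfolding spectral_sol_def by blast
  have per: "periodic_on_R l (u t)" if "t \<in> {0..T}" for t using g that unfolding spectral_sol_def by blast
  have c: "continuous_on S (u t)" "continuous_on S (deriv (u t))" if "t \<in> {0..T}" for t S
    using classical_reg_cont[OF reg that] by auto
  have ck1: "fcoeff (l / \<kappa>) (\<lambda>y. a * u (b * t) (\<kappa> * y)) j = of_real a * fcoeff l (u (b * t)) j" if "t \<in> {0..T / b}" for t j
    unfolding fcoeff_cmult using fcoeff_scale[OF pos(4,1) c(1)[OF in_T[OF that]], of j] by simp
  have ck2: "fcoeff (l / \<kappa>) (\<lambda>y. (deriv (\<lambda>y. a * u (b * t) (\<kappa> * y)) y)\<^sup>2) j = of_real (a\<^sup>2 * \<kappa>\<^sup>2) * fcoeff l (\<lambda>y. (deriv (u (b * t)) y)\<^sup>2) j"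
    if "t \<in> {0..T / b}" for t j
  proof -
    have "((deriv ^^ k) (u (b * t)) has_real_derivative (deriv ^^ Suc k) (u (b * t)) y) (at y)" if "k < 4" for k y
      using reg in_T[OF \<open>t \<in> {0..T / b}\<close>] that unfolding classical_reg_def by blast
    then have "(deriv ^^ 1) (\<lambda>y. a * u (b * t) (\<kappa> * y)) = (\<lambda>y. a * \<kappa> ^ 1 * (deriv ^^ 1) (u (b * t)) (\<kappa> * y))"
      by (rule deriv_scale(1)) auto
    then have "deriv (\<lambda>y. a * u (b * t) (\<kappa> * y)) = (\<lambda>y. a * \<kappa> * deriv (u (b * t)) (\<kappa> * y))" by simp
    then have "fcoeff (l / \<kappa>) (\<lambda>y. (deriv (\<lambda>y. a * u (b * t) (\<kappa> * y)) y)\<^sup>2) j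
        = fcoeff (l / \<kappa>) (\<lambda>y. (a\<^sup>2 * \<kappa>\<^sup>2) * (\<lambda>y. (deriv (u (b * t)) y)\<^sup>2) (\<kappa> * y)) j"
      by (simp add: power_mult_distrib)
    also have "\<dots> = of_real (a\<^sup>2 * \<kappa>\<^sup>2) * fcoeff l (\<lambda>y. (deriv (u (b * t)) y)\<^sup>2) j"
      unfolding fcoeff_cmult
      by (subst fcoeff_scale[OF pos(4,1)]) (auto intro!: continuous_intros c(2)[OF in_T[OF that]])
    finally show ?thesis .
  qed
  show ?thesis
    unfolding spectral_sol_def
  proof (intro conjI ballI allI)
    fix t assume t: "t \<in> {0..T / b}"
    show "periodic_on_R (l / \<kappa>) (\<lambda>y. a * u (b * t) (\<kappa> * y))"
      using per[OF in_T[OF t]] pos by (simp add: periodic_on_R_def distrib_left)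
    fix j
    have "((\<lambda>s. of_real (B j) * fcoeff l (u s) j) has_vector_derivative
        (of_real (S j) * fcoeff l (u (b * t)) j + of_real (F j) * fcoeff l (\<lambda>y. (deriv (u (b * t)) y)\<^sup>2) j)) (at (b * t) within {0..T})"
      using g in_T[OF t] unfolding spectral_sol_def by blast
    then have "((\<lambda>s. of_real (B j) * fcoeff l (u s) j) has_vector_derivative
        (of_real (S j) * fcoeff l (u (b * t)) j + of_real (F j) * fcoeff l (\<lambda>y. (deriv (u (b * t)) y)\<^sup>2) j)) (at (b * t) within (\<lambda>s. b * s) ` {0..T / b})"
      by (rule has_vector_derivative_within_subset) (use in_T in auto)
    then have "((\<lambda>s. of_real (B j) * fcoeff l (u s) j) \<circ> (\<lambda>s. b * s) has_vector_derivative
        b *\<^sub>R (of_real (S j) * fcoeff l (u (b * t)) j + of_real (F j) * fcoeff l (\<lambda>y. (deriv (u (b * t)) y)\<^sup>2) j)) (at t within {0..T / b})"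
      by (intro vector_diff_chain_within) (auto intro!: derivative_eq_intros simp flip: has_real_derivative_iff_has_vector_derivative)
    from bounded_linear.has_vector_derivative[OF bounded_linear_mult_right this, of "of_real a"]
    have "((\<lambda>s. of_real a * (of_real (B j) * fcoeff l (u (b * s)) j)) has_vector_derivative
        of_real a * (b *\<^sub>R (of_real (S j) * fcoeff l (u (b * t)) j + of_real (F j) * fcoeff l (\<lambda>y. (deriv (u (b * t)) y)\<^sup>2) j))) (at t within {0..T / b})"
      by (simp add: o_def)
    moreover have "of_real a * (b *\<^sub>R (of_real (S j) * fcoeff l (u (b * t)) j + of_real (F j) * fcoeff l (\<lambda>y. (deriv (u (b * t)) y)\<^sup>2) j))
      = of_real (b * S j) * fcoeff (l / \<kappa>) (\<lambda>y. a * u (b * t) (\<kappa> * y)) j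
        + of_real (b / (a * \<kappa>\<^sup>2) * F j) * fcoeff (l / \<kappa>) (\<lambda>y. (deriv (\<lambda>y. a * u (b * t) (\<kappa> * y)) y)\<^sup>2) j"
      unfolding ck1[OF t] ck2[OF t] using pos by (simp add: scaleR_conv_of_real field_simps power2_eq_square)
    ultimately have "((\<lambda>s. of_real a * (of_real (B j) * fcoeff l (u (b * s)) j)) has_vector_derivative
        (of_real (b * S j) * fcoeff (l / \<kappa>) (\<lambda>y. a * u (b * t) (\<kappa> * y)) j
        + of_real (b / (a * \<kappa>\<^sup>2) * F j) * fcoeff (l / \<kappa>) (\<lambda>y. (deriv (\<lambda>y. a * u (b * t) (\<kappa> * y)) y)\<^sup>2) j)) (at t within {0..T / b})"
      by (simp only:)
    then show "((\<lambda>s. of_real (B j) * fcoeff (l / \<kappa>) (\<lambda>y. a * u (b * s) (\<kappa> * y)) j) has_vector_derivative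
        (of_real (b * S j) * fcoeff (l / \<kappa>) (\<lambda>y. a * u (b * t) (\<kappa> * y)) j
        + of_real (b / (a * \<kappa>\<^sup>2) * F j) * fcoeff (l / \<kappa>) (\<lambda>y. (deriv (\<lambda>y. a * u (b * t) (\<kappa> * y)) y)\<^sup>2) j)) (at t within {0..T / b})"
      by (rule has_vector_derivative_transform[OF t, rotated]) (simp only: ck1 mult.left_commute)
  qed (use classical_reg_scale[OF reg pos(3), of a \<kappa>] in blast)
qed

section \<open>Regularity of sums and of series; expansion of the square\<close>

lemma deriv_add_pow:
  assumes "\<And>k y. k < m \<Longrightarrow> ((deriv ^^ k) f has_real_derivative (deriv ^^ Suc k) f y) (at y)"
    and "\<And>k y. k < m \<Longrightarrow> ((deriv ^^ k) g has_real_derivative (deriv ^^ Suc k) g y) (at y)"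
  shows "k \<le> m \<Longrightarrow> (deriv ^^ k) (\<lambda>y. f y + g y) = (\<lambda>y. (deriv ^^ k) f y + (deriv ^^ k) g y)"
    and "k < m \<Longrightarrow> ((deriv ^^ k) (\<lambda>y. f y + g y) has_real_derivative (deriv ^^ Suc k) (\<lambda>y. f y + g y) y) (at y)"
proof -
  have d: "((\<lambda>y. (deriv ^^ k) f y + (deriv ^^ k) g y) has_real_derivative (deriv ^^ Suc k) f y + (deriv ^^ Suc k) g y) (at y)"
    if "k < m" for k y by (rule DERIV_add[OF assms(1)[OF that] assms(2)[OF that]])
  note chain = deriv_pow_chain[of m "\<lambda>k y. (deriv ^^ k) f y + (deriv ^^ k) g y", OF d]
  show "k \<le> m \<Longrightarrow> (deriv ^^ k) (\<lambda>y. f y + g y) = (\<lambda>y. (deriv ^^ k) f y + (deriv ^^ k) g y)"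
    and "k < m \<Longrightarrow> ((deriv ^^ k) (\<lambda>y. f y + g y) has_real_derivative (deriv ^^ Suc k) (\<lambda>y. f y + g y) y) (at y)"
    using chain[of k] by simp_all
qed

lemma classical_reg_add:
  assumes u: "classical_reg T u ut" and v: "classical_reg T v vt"
  shows "classical_reg T (\<lambda>t y. u t y + v t y) (\<lambda>t y. ut t y + vt t y)"
proof -
  have du: "((deriv ^^ k) (u t) has_real_derivative (deriv ^^ Suc k) (u t) y) (at y)"
    and dv: "((deriv ^^ k) (v t) has_real_derivative (deriv ^^ Suc k) (v t) y) (at y)" if "t \<in> {0..T}" "k < 4" for t k y
    using u v that unfolding classical_reg_def by blast+
  show ?thesis
    unfolding classical_reg_def
  proof (intro conjI ballI allI impI)
    fix t j y assume "t \<in> {0..T}" "(j::nat) < 4"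
    then show "((deriv ^^ j) (\<lambda>y. u t y + v t y) has_real_derivative (deriv ^^ Suc j) (\<lambda>y. u t y + v t y) y) (at y)"
      by (intro deriv_add_pow(2)[of 4] du dv)
  next
    fix j :: nat assume j: "j \<le> 4"
    have "continuous_on ({0..T} \<times> UNIV) (\<lambda>p. (case p of (t, y) \<Rightarrow> (deriv ^^ j) (u t) y) + (case p of (t, y) \<Rightarrow> (deriv ^^ j) (v t) y))"
      using u v j unfolding classical_reg_def by (intro continuous_on_add) blast+
    then show "continuous_on ({0..T} \<times> UNIV) (\<lambda>(t, y). (deriv ^^ j) (\<lambda>y. u t y + v t y) y)"
    proof (rule continuous_on_eq)
      fix p assume "p \<in> {0..T} \<times> (UNIV :: real set)"
      then obtain t y where p: "p = (t, y)" "t \<in> {0..T}" by auto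
      show "(case p of (t, y) \<Rightarrow> (deriv ^^ j) (u t) y) + (case p of (t, y) \<Rightarrow> (deriv ^^ j) (v t) y) =
        (case p of (t, y) \<Rightarrow> (deriv ^^ j) (\<lambda>y. u t y + v t y) y)"
        unfolding p(1) by (simp add: deriv_add_pow(1)[of 4, OF du[OF p(2)] dv[OF p(2)] j])
    qed
  next
    have "continuous_on ({0..T} \<times> UNIV) (\<lambda>p. (case p of (t, y) \<Rightarrow> ut t y) + (case p of (t, y) \<Rightarrow> vt t y))"
      using u v unfolding classical_reg_def by (intro continuous_on_add) blast+
    then show "continuous_on ({0..T} \<times> UNIV) (\<lambda>(t, y). ut t y + vt t y)" by (simp add: split_beta)
  next
    fix t y assume "t \<in> {0..T}"
    then show "((\<lambda>s. u s y + v s y) has_real_derivative ut t y + vt t y) (at t within {0..T})"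
      using u v unfolding classical_reg_def by (intro DERIV_add) blast+
  qed
qed

text \<open>Four space derivatives and two powers for absolute convergence add up to 6. The time
  derivative has only to be continuous, for which decay 2 is enough.\<close>

lemma classical_reg_fseries:
  assumes l: "l > 0" and T: "T > 0" and R: "\<And>t i. t \<in> {0..T} \<Longrightarrow> norm (R t i) \<le> A / wt i ^ 6"
    and R': "\<And>t i. t \<in> {0..T} \<Longrightarrow> norm (R' t i) \<le> A' / wt i ^ 2"
    and c: "\<And>i. continuous_on {0..T} (\<lambda>t. R' t i)"
    and d: "\<And>t i. t \<in> {0..T} \<Longrightarrow> ((\<lambda>t. R t i) has_vector_derivative R' t i) (at t within {0..T})"
  shows "classical_reg T (\<lambda>t. fseries l (R t)) (\<lambda>t. fseries l (R' t))"
proof -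
  have A: "0 \<le> A" using order_trans[OF norm_ge_zero R[of 0 0]] T by (simp add: wt_0)
  have Rm: "norm (R t i) \<le> A / wt i ^ (2 + m)" if "t \<in> {0..T}" "m \<le> 4" for t i m
    using R[OF that(1), of i] mult_left_mono[OF wt_powr_mono[of "2 + m" 6 i] A] that(2) by simp
  have R4: "norm (R t i) \<le> A / wt i ^ (2 + 4)" if "t \<in> {0..T}" for t i by (rule Rm[OF that order_refl])
  have Rc: "continuous_on {0..T} (\<lambda>t. R t i)" for i
    using d has_vector_derivative_continuous continuous_on_eq_continuous_within by blast
  have cfst: "continuous_on ({0..T} \<times> UNIV) (\<lambda>p. f (fst p))" if "continuous_on {0..T} f" for f :: "real \<Rightarrow> complex"
    by (rule continuous_on_compose2[OF that]) (auto intro!: continuous_intros)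
  show ?thesis
    unfolding classical_reg_def
  proof (intro conjI ballI allI impI)
    fix t j y assume t: "t \<in> {0..T}" and j: "(j::nat) < 4"
    show "((deriv ^^ j) (fseries l (R t)) has_real_derivative (deriv ^^ Suc j) (fseries l (R t)) y) (at y)"
      by (rule fseries_deriv_pow(2)[OF l R4[OF t] j])
  next
    fix j :: nat assume j: "j \<le> 4"
    have "continuous_on ({0..T} \<times> UNIV) (\<lambda>p. fseries l ((fderiv l ^^ j) (R (fst p))) (snd p))"
    proof (rule fseries_continuous[of 2 _ _ "(2 * pi / l) ^ j * A"])
      show "norm ((fderiv l ^^ j) (R (fst p)) i) \<le> (2 * pi / l) ^ j * A / wt i ^ 2" if "p \<in> {0..T} \<times> (UNIV :: real set)" for p i
        by (rule fderiv_pow_bound[OF l Rm[OF _ j]]) (use that in auto)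
      show "continuous_on ({0..T} \<times> (UNIV :: real set)) (\<lambda>p. (fderiv l ^^ j) (R (fst p)) i)" for i
        unfolding fderiv_pow by (intro continuous_intros cfst[OF Rc])
    qed (auto intro!: continuous_intros)
    then show "continuous_on ({0..T} \<times> UNIV) (\<lambda>(t, y). (deriv ^^ j) (fseries l (R t)) y)"
    proof (rule continuous_on_eq)
      fix p assume "p \<in> {0..T} \<times> (UNIV :: real set)"
      then obtain t y where p: "p = (t, y)" "t \<in> {0..T}" by auto
      show "fseries l ((fderiv l ^^ j) (R (fst p))) (snd p) = (case p of (t, y) \<Rightarrow> (deriv ^^ j) (fseries l (R t)) y)"
        unfolding p(1) by (simp add: fseries_deriv_pow(1)[OF l R4[OF p(2)] j])
    qed
  next
    have "continuous_on ({0..T} \<times> UNIV) (\<lambda>p. fseries l (R' (fst p)) (snd p))"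
      by (rule fseries_continuous[of 2 _ _ A']) (auto intro!: continuous_intros cfst c simp: R')
    then show "continuous_on ({0..T} \<times> UNIV) (\<lambda>(t, y). fseries l (R' t) y)" by (simp add: split_beta)
  next
    fix t y assume t: "t \<in> {0..T}"
    have "norm (R t i) \<le> A / wt i ^ 2" if "t \<in> {0..T}" for t i using Rm[OF that, of 0] by simp
    then show "((\<lambda>s. fseries l (R s) y) has_real_derivative fseries l (R' t) y) (at t within {0..T})"
      by (intro fseries_time_deriv[OF T t _ _ R' c d, where A = A]) auto
  qed
qed

text \<open>The increment of the square is written with \<open>D\<close> as second factor. This is
  the form used by the fixed point, and in the uniqueness argument the first factor can be regarded
  as given, which makes the equation linear.\<close>

lemma conv_square_add:
  assumes q: "2 \<le> q" and P: "\<And>i. norm (P i) \<le> A / wt i ^ q" and D: "\<And>i. norm (D i) \<le> B / wt i ^ q"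
  shows "conv (\<lambda>i. P i + D i) (\<lambda>i. P i + D i) j = conv P P j + conv (\<lambda>i. 2 * P i + D i) D j"
proof -
  have PD: "norm (P i + D i) \<le> (A + B) / wt i ^ q" for i
    using norm_triangle_mono[OF P D] by (simp add: add_divide_distrib)
  have P2: "norm (2 * P i) \<le> 2 * A / wt i ^ q" for i using P[of i] by (simp add: norm_mult)
  have "conv (\<lambda>i. P i + D i) (\<lambda>i. P i + D i) j - conv P P j = conv D (\<lambda>i. P i + D i) j + conv P D j"
    using conv_diff[OF q PD P PD P, of j] by simp
  also have "conv D (\<lambda>i. P i + D i) j = conv D P j + conv D D j"
    by (rule conv_add_right[OF q D P D])
  also have "conv (\<lambda>i. 2 * P i + D i) D j = conv (\<lambda>i. 2 * P i) D j + conv D D j"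
    by (rule conv_add_left[OF q P2 D D])
  moreover have "conv (\<lambda>i. 2 * P i) D j = 2 * conv D P j"
    by (subst conv_commute) (rule conv_cmult)
  ultimately show ?thesis using conv_commute[of P D j] by (simp add: algebra_simps)
qed

section \<open>The rescaled problem near the Kuramoto--Sivashinsky solution\<close>

text \<open>The defect of the Kuramoto--Sivashinsky solution, with coefficients \<open>U\<close>, in the rescaled equation;
  the first bracket is its time derivative.\<close>

definition residual :: "real \<Rightarrow> real \<Rightarrow> (int \<Rightarrow> complex) \<Rightarrow> int \<Rightarrow> complex" where
  "residual l \<epsilon> U j =
    of_real (1 - b_sym l \<epsilon> j) * (- of_real (ks_rate l j) * U j + - (1/2) * conv (fderiv l U) (fderiv l U) j)
    + of_real (f_sym l \<epsilon> j + 1/2) * conv (fderiv l U) (fderiv l U) j"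

text \<open>Division by \<open>b\<close> weakens rate and nonlinearity alike, so the domination of
  \<open>f_sym\<close> persists; the shift \<gamma> stays undivided, which is only favourable
  because b \<ge> 1.\<close>

lemma rate_bounds:
  assumes e: "0 < \<epsilon>" "\<epsilon> \<le> 1" and \<gamma>: "0 \<le> \<gamma>" "\<And>j. 0 < ks_rate l j + \<gamma>" and \<delta>: "0 \<le> \<delta>"
    and f_sym: "\<And>j. \<bar>f_sym l \<epsilon> j\<bar> * wt j \<le> \<delta> * (ks_rate l j + \<gamma>)"
  shows "(ks_rate l j + \<gamma>) / b_sym l \<epsilon> j \<le> ks_rate l j / b_sym l \<epsilon> j + \<gamma>" "0 < ks_rate l j / b_sym l \<epsilon> j + \<gamma>"
    "\<bar>f_sym l \<epsilon> j / b_sym l \<epsilon> j\<bar> * wt j \<le> \<delta> * (ks_rate l j / b_sym l \<epsilon> j + \<gamma>)"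
proof -
  have b1: "1 \<le> b_sym l \<epsilon> j" using b_sym_bounds(1)[of \<epsilon> l j] e by simp
  have "\<gamma> / b_sym l \<epsilon> j \<le> \<gamma> / 1" using b1 \<gamma> by (intro divide_left_mono) auto
  then show 1: "(ks_rate l j + \<gamma>) / b_sym l \<epsilon> j \<le> ks_rate l j / b_sym l \<epsilon> j + \<gamma>"
    by (simp add: add_divide_distrib)
  have "0 < (ks_rate l j + \<gamma>) / b_sym l \<epsilon> j" using \<gamma>(2)[of j] b1 by simp
  then show "0 < ks_rate l j / b_sym l \<epsilon> j + \<gamma>" using 1 by linarith
  have "\<bar>f_sym l \<epsilon> j / b_sym l \<epsilon> j\<bar> * wt j = (\<bar>f_sym l \<epsilon> j\<bar> * wt j) / b_sym l \<epsilon> j" using b1 by simp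
  also have "\<dots> \<le> (\<delta> * (ks_rate l j + \<gamma>)) / b_sym l \<epsilon> j" using b1 by (intro divide_right_mono f_sym) simp
  also have "\<dots> = \<delta> * ((ks_rate l j + \<gamma>) / b_sym l \<epsilon> j)" by simp
  also have "\<dots> \<le> \<delta> * (ks_rate l j / b_sym l \<epsilon> j + \<gamma>)" by (intro mult_left_mono 1 \<delta>)
  finally show "\<bar>f_sym l \<epsilon> j / b_sym l \<epsilon> j\<bar> * wt j \<le> \<delta> * (ks_rate l j / b_sym l \<epsilon> j + \<gamma>)" .
qed

section \<open>Residual and existence of the rescaled solution\<close>

context
  fixes l T A :: real and \<Phi>0 :: "real \<Rightarrow> real" and \<Phi> :: "real \<Rightarrow> real \<Rightarrow> real" and c c' q :: "real \<Rightarrow> int \<Rightarrow> complex"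
    and w :: real
  assumes l: "l > 0" and T: "T > 0" and ks: "ks_sol l T \<Phi>0 \<Phi>"
    and A: "\<And>t j. t \<in> {0..T} \<Longrightarrow> norm (fcoeff l (\<Phi> t) j) \<le> A / wt j ^ 10"
  defines "c \<equiv> \<lambda>t. fcoeff l (\<Phi> t)"
    and "q \<equiv> \<lambda>t. conv (fderiv l (fcoeff l (\<Phi> t))) (fderiv l (fcoeff l (\<Phi> t)))"
    and "c' \<equiv> \<lambda>t j. - of_real (ks_rate l j) * fcoeff l (\<Phi> t) j + - (1/2) * conv (fderiv l (fcoeff l (\<Phi> t))) (fderiv l (fcoeff l (\<Phi> t))) j"
    and "w \<equiv> 2 * pi / l"
begin

private lemma residual_eq:
  fixes \<epsilon> :: real
  shows "residual l \<epsilon> (c t) j = of_real (1 - b_sym l \<epsilon> j) * c' t j + of_real (f_sym l \<epsilon> j + 1/2) * q t j"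
  by (simp add: residual_def c_def c'_def q_def)

private lemma w_pos: "0 < w" using l by (simp add: w_def)

private lemma A_nonneg: "0 \<le> A" using order_trans[OF norm_ge_zero A[of 0 0]] T by (simp add: wt_0)

private lemma c_deriv: "t \<in> {0..T} \<Longrightarrow> ((\<lambda>s. c s j) has_vector_derivative c' t j) (at t within {0..T})"
  unfolding c_def c'_def by (rule ks_fcoeff_deriv[OF l T ks])

private lemma c_cont: "continuous_on {0..T} (\<lambda>t. c t j)"
  using c_deriv has_vector_derivative_continuous continuous_on_eq_continuous_within by blast

private lemma P_bound: "t \<in> {0..T} \<Longrightarrow> norm (fderiv l (c t) j) \<le> (w * A) / wt j ^ 9"
  unfolding c_def w_def by (rule fderiv_bound[OF l]) (use A in simp)

private lemma P_bound': "t \<in> {0..T} \<Longrightarrow> p \<le> 9 \<Longrightarrow> norm (fderiv l (c t) j) \<le> (w * A) / wt j ^ p"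
  using order_trans[OF P_bound[of t j], of "(w * A) / wt j ^ p"] mult_left_mono[OF wt_powr_mono[of p 9 j], of "w * A"] w_pos A_nonneg
  by simp

private lemma P_cont: "continuous_on {0..T} (\<lambda>t. fderiv l (c t) j)"
  unfolding fderiv_def by (intro continuous_intros c_cont)

private lemma q_bound: "t \<in> {0..T} \<Longrightarrow> norm (q t j) \<le> (conv_const 9 * (w * A) * (w * A)) / wt j ^ 9"
  unfolding q_def by (rule conv_bound) (use P_bound in \<open>auto simp: c_def\<close>)

private lemma q_cont: "continuous_on {0..T} (\<lambda>t. q t j)"
  unfolding q_def by (rule conv_continuous[OF _ P_bound P_bound P_cont P_cont, unfolded c_def]) auto

private lemma ks_rate_bound: "\<bar>ks_rate l j\<bar> \<le> (4 * w ^ 4 + w\<^sup>2) * wt j ^ 4"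
proof -
  have L: "Lam l j \<le> w\<^sup>2 * wt j ^ 2" using Lam_le unfolding w_def .
  have "(Lam l j)\<^sup>2 \<le> (w\<^sup>2 * wt j ^ 2)\<^sup>2" by (intro power_mono L Lam_nonneg)
  also have "\<dots> = w ^ 4 * wt j ^ 4" by (simp add: power_mult_distrib flip: power_mult)
  finally have 1: "(Lam l j)\<^sup>2 \<le> w ^ 4 * wt j ^ 4" .
  have "wt j ^ 2 \<le> wt j ^ 4" by (intro power_increasing wt_ge1) auto
  then have "w\<^sup>2 * wt j ^ 2 \<le> w\<^sup>2 * wt j ^ 4" by (intro mult_left_mono) auto
  then have "Lam l j \<le> w\<^sup>2 * wt j ^ 4" using L by linarith
  then have "4 * (Lam l j)\<^sup>2 + Lam l j \<le> (4 * w ^ 4 + w\<^sup>2) * wt j ^ 4" using 1 by (simp add: distrib_right)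
  moreover have "\<bar>ks_rate l j\<bar> \<le> 4 * (Lam l j)\<^sup>2 + Lam l j" unfolding ks_rate_def using Lam_nonneg[of l j] by (simp add: abs_le_iff)
  ultimately show ?thesis by linarith
qed

text \<open>Count of powers: of decay 10 the time derivative \<open>c'\<close> keeps 6, and
  \<open>1 - b\<close> takes 2 more. The convolution \<open>q\<close> has decay at least 8, of which
  \<open>f + 1/2\<close> takes 4. Both contributions are left with decay 4 and one factor
  \<epsilon>.\<close>

lemma residual_bound:
  obtains C where "0 \<le> C"
    "\<And>(\<epsilon>::real) t j. 0 \<le> \<epsilon> \<Longrightarrow> \<epsilon> \<le> 1 \<Longrightarrow> t \<in> {0..T} \<Longrightarrow> norm (residual l \<epsilon> (c t) j) \<le> C * \<epsilon> / wt j ^ 4"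
proof -
  define Cq where "Cq = conv_const 9 * (w * A) * (w * A)"
  have Cq: "0 \<le> Cq" unfolding Cq_def using conv_const_pos[of 9] w_pos A_nonneg by simp
  define C1 where "C1 = (4 * w ^ 4 + w\<^sup>2) * A + Cq"
  have C1: "0 \<le> C1" unfolding C1_def using w_pos A_nonneg Cq by simp
  define C where "C = 8 * w\<^sup>2 * C1 + 6 * w\<^sup>2 * (1 + 4 * w\<^sup>2) * Cq"
  show ?thesis
  proof (rule that[of C])
    show "0 \<le> C" unfolding C_def using w_pos C1 Cq by simp
    fix \<epsilon> :: real and t j assume e: "0 \<le> \<epsilon>" "\<epsilon> \<le> 1" and t: "t \<in> {0..T}"
    define n where "n = wt j"
    have n: "1 \<le> n" "0 < n" using wt_ge1[of j] wt_pos[of j] by (simp_all add: n_def)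
    have L: "Lam l j \<le> w\<^sup>2 * n\<^sup>2" using Lam_le unfolding w_def n_def .
    note L0 = Lam_nonneg[of l j]
    have np: "1 / n ^ a \<le> 1 / n ^ b" if "b \<le> a" for a b using wt_powr_mono[OF that, of j] by (simp add: n_def)
    have qb: "norm (q t j) \<le> Cq / n ^ p" if "p \<le> 9" for p
      using q_bound[OF t, of j] mult_left_mono[OF np[OF that] Cq] by (simp add: Cq_def n_def)
    have c'b: "norm (c' t j) \<le> C1 / n ^ 6"
    proof -
      have "norm (- of_real (ks_rate l j) * c t j) \<le> ((4 * w ^ 4 + w\<^sup>2) * n ^ 4) * (A / n ^ 10)"
        using ks_rate_bound[of j] A[OF t, of j] w_pos n unfolding norm_mult norm_minus_cancel norm_of_real c_def n_def
        by (intro mult_mono) auto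
      also have "\<dots> = (4 * w ^ 4 + w\<^sup>2) * A / n ^ 6" using n by (simp add: field_simps flip: power_add)
      finally have 1: "norm (- of_real (ks_rate l j) * c t j) \<le> (4 * w ^ 4 + w\<^sup>2) * A / n ^ 6" .
      have "norm (- (1/2) * q t j) \<le> norm (q t j)" by (simp add: norm_mult)
      also have "\<dots> \<le> Cq / n ^ 6" by (rule qb) simp
      finally have 2: "norm (- (1/2) * q t j) \<le> Cq / n ^ 6" .
      show ?thesis using norm_triangle_mono[OF 1 2] unfolding c'_def C1_def c_def q_def by (simp add: add_divide_distrib)
    qed
    have "norm (of_real (1 - b_sym l \<epsilon> j) * c' t j) \<le> (8 * \<epsilon> * (w\<^sup>2 * n\<^sup>2)) * (C1 / n ^ 6)"
      unfolding norm_mult norm_of_real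
    proof (rule mult_mono[OF _ c'b])
      show "\<bar>1 - b_sym l \<epsilon> j\<bar> \<le> 8 * \<epsilon> * (w\<^sup>2 * n\<^sup>2)"
        using b_sym_bounds(2)[OF e, of l j] mult_left_mono[OF L, of "8 * \<epsilon>"] e by linarith
    qed (use e in auto)
    also have "\<dots> = 8 * w\<^sup>2 * C1 * \<epsilon> / n ^ 4" using n by (simp add: field_simps eval_nat_numeral)
    finally have 1: "norm (of_real (1 - b_sym l \<epsilon> j) * c' t j) \<le> 8 * w\<^sup>2 * C1 * \<epsilon> / n ^ 4" .
    have "norm (of_real (f_sym l \<epsilon> j + 1/2) * q t j) \<le> (6 * \<epsilon> * (w\<^sup>2 * n\<^sup>2) * ((1 + 4 * w\<^sup>2) * n\<^sup>2)) * (Cq / n ^ 8)"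
      unfolding norm_mult norm_of_real
    proof (rule mult_mono)
      have "1 \<le> n\<^sup>2" using n by simp
      then have "1 + 4 * Lam l j \<le> (1 + 4 * w\<^sup>2) * n\<^sup>2" using L unfolding distrib_right by simp
      then have "6 * \<epsilon> * Lam l j * (1 + 4 * Lam l j) \<le> 6 * \<epsilon> * (w\<^sup>2 * n\<^sup>2) * ((1 + 4 * w\<^sup>2) * n\<^sup>2)"
        using L L0 e by (intro mult_mono mult_nonneg_nonneg) auto
      then show "\<bar>f_sym l \<epsilon> j + 1/2\<bar> \<le> 6 * \<epsilon> * (w\<^sup>2 * n\<^sup>2) * ((1 + 4 * w\<^sup>2) * n\<^sup>2)"
        using f_sym_residual[OF e, of l j] by linarith
      show "norm (q t j) \<le> Cq / n ^ 8" by (rule qb) simp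
    qed (use e in auto)
    also have "\<dots> = 6 * w\<^sup>2 * (1 + 4 * w\<^sup>2) * Cq * \<epsilon> / n ^ 4" using n by (simp add: field_simps eval_nat_numeral)
    finally have 2: "norm (of_real (f_sym l \<epsilon> j + 1/2) * q t j) \<le> 6 * w\<^sup>2 * (1 + 4 * w\<^sup>2) * Cq * \<epsilon> / n ^ 4" .
    have "norm (residual l \<epsilon> (c t) j) \<le> 8 * w\<^sup>2 * C1 * \<epsilon> / n ^ 4 + 6 * w\<^sup>2 * (1 + 4 * w\<^sup>2) * Cq * \<epsilon> / n ^ 4"
      unfolding residual_eq by (rule norm_triangle_mono[OF 1 2])
    also have "\<dots> = C * \<epsilon> / wt j ^ 4"
      by (simp add: C_def n_def add_divide_distrib distrib_right)
    finally show "norm (residual l \<epsilon> (c t) j) \<le> C * \<epsilon> / wt j ^ 4" .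
  qed
qed

private lemma \<Phi>_reg: obtains \<Phi>t where "classical_reg T \<Phi> \<Phi>t"
  using ks unfolding ks_sol_def by blast

private lemma \<Phi>_per: "t \<in> {0..T} \<Longrightarrow> periodic_on_R l (\<Phi> t)"
  using ks unfolding ks_sol_def by blast

private lemma c_sym: "t \<in> {0..T} \<Longrightarrow> c t (- j) = cnj (c t j)"
  unfolding c_def by (rule \<Phi>_reg) (rule fcoeff_cnj, rule classical_reg_cont(1))

text \<open>The solution is \<Phi> plus the real series whose coefficients are the fixed point. The
  last conclusion records the bound on the derivative that the uniqueness argument asks of its
  reference solution.\<close>

lemma rescaled_existence:
  fixes \<epsilon> \<gamma> \<delta> \<kappa> :: real
  assumes e: "0 < \<epsilon>" "\<epsilon> \<le> 1" and \<gamma>: "0 \<le> \<gamma>" "\<And>j. 0 < ks_rate l j + \<gamma>" and \<delta>: "0 \<le> \<delta>" and \<kappa>: "0 \<le> \<kappa>"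
    and f_sym: "\<And>j. \<bar>f_sym l \<epsilon> j\<bar> * wt j \<le> \<delta> * (ks_rate l j + \<gamma>)"
    and res: "\<And>t j. t \<in> {0..T} \<Longrightarrow> norm (residual l \<epsilon> (c t) j) \<le> \<kappa> * (ks_rate l j + \<gamma>) / wt j ^ 6"
    and small: "conv_const 5 * \<delta> * w * (2 * (w * A) + 1) \<le> 1/2" "4 * \<kappa> * w * exp (\<gamma> * T) \<le> 1"
  obtains \<Psi> where "rescaled_sol l T \<epsilon> \<Psi>" "\<And>y. \<Psi> 0 y = \<Phi>0 y"
    "\<And>t y. t \<in> {0..T} \<Longrightarrow> \<bar>\<Psi> t y - \<Phi> t y\<bar> \<le> 2 * \<kappa> * exp (\<gamma> * T) * conv_const 2"
    "\<And>t j. t \<in> {0..T} \<Longrightarrow> norm (fderiv l (fcoeff l (\<Psi> t)) j) \<le> (w * A + 1/2) / wt j ^ 3"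
proof -
  have b1: "1 \<le> b_sym l \<epsilon> j" for j using b_sym_bounds(1)[of \<epsilon> l j] e by simp
  have b0: "b_sym l \<epsilon> j \<noteq> 0" for j using b1[of j] by simp
  define a where "a j = ks_rate l j / b_sym l \<epsilon> j" for j
  define M where "M j = f_sym l \<epsilon> j / b_sym l \<epsilon> j" for j
  define G where "G t j = residual l \<epsilon> (c t) j / of_real (b_sym l \<epsilon> j)" for t j
  note rate = rate_bounds[OF e \<gamma> \<delta> f_sym, folded a_def M_def]
  have ag: "(ks_rate l j + \<gamma>) / b_sym l \<epsilon> j \<le> a j + \<gamma>" for j by (rule rate(1))
  have a0: "0 < a j + \<gamma>" for j by (rule rate(2))
  have Mb: "\<bar>M j\<bar> * wt j \<le> \<delta> * (a j + \<gamma>)" for j by (rule rate(3))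
  have Gb: "norm (G t j) \<le> \<kappa> * (a j + \<gamma>) / wt j ^ 6" if "t \<in> {0..T}" for t j
  proof -
    have "norm (G t j) = norm (residual l \<epsilon> (c t) j) / b_sym l \<epsilon> j" using b1[of j] by (simp add: G_def norm_divide)
    also have "\<dots> \<le> (\<kappa> * (ks_rate l j + \<gamma>) / wt j ^ 6) / b_sym l \<epsilon> j" using b1[of j] by (intro divide_right_mono res that) simp
    also have "\<dots> = \<kappa> / wt j ^ 6 * ((ks_rate l j + \<gamma>) / b_sym l \<epsilon> j)" by simp
    also have "\<dots> \<le> \<kappa> / wt j ^ 6 * (a j + \<gamma>)" using wt_pos[of j] by (intro mult_left_mono ag divide_nonneg_pos \<kappa>) simp
    finally show ?thesis by simp
  qed
  have qsym: "q t (- j) = cnj (q t j)" if "t \<in> {0..T}" for t j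
    unfolding q_def by (rule conv_cnj) (intro fderiv_cnj c_sym[OF that, unfolded c_def])+
  have c'sym: "c' t (- j) = cnj (c' t j)" if "t \<in> {0..T}" for t j
    using qsym[OF that, of j] c_sym[OF that, of j] unfolding c'_def q_def c_def by (simp add: symbol_even)
  have rsym: "residual l \<epsilon> (c t) (- j) = cnj (residual l \<epsilon> (c t) j)" if "t \<in> {0..T}" for t j
    by (simp add: residual_eq symbol_even qsym[OF that] c'sym[OF that])
  have c'cont: "continuous_on {0..T} (\<lambda>t. c' t j)" for j
    unfolding c'_def using c_cont[unfolded c_def] q_cont[unfolded q_def] by (intro continuous_intros)
  have rcont: "continuous_on {0..T} (\<lambda>t. residual l \<epsilon> (c t) j)" for j
    unfolding residual_eq by (intro continuous_intros c'cont q_cont)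
  have Gc: "continuous_on {0..T} (\<lambda>t. G t j)" for j
    unfolding G_def using b0 by (intro continuous_intros rcont) simp
  have sm: "conv_const 5 * \<delta> * (2 * pi / l) * (2 * (w * A) + 4 * \<kappa> * (2 * pi / l) * exp (\<gamma> * T)) \<le> 1/2"
  proof -
    have "conv_const 5 * \<delta> * w * (2 * (w * A) + 4 * \<kappa> * w * exp (\<gamma> * T)) \<le> conv_const 5 * \<delta> * w * (2 * (w * A) + 1)"
      using small(2) conv_const_pos[of 5] \<delta> w_pos by (intro mult_left_mono) auto
    then show ?thesis using small(1) unfolding w_def by linarith
  qed
  obtain R where R0: "\<And>j. R 0 j = 0"
    and Rb: "\<And>t j. t \<in> {0..T} \<Longrightarrow> norm (R t j) \<le> 2 * \<kappa> * exp (\<gamma> * T) / wt j ^ 6"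
    and Rs: "\<And>t j. t \<in> {0..T} \<Longrightarrow> R t (- j) = cnj (R t j)"
    and Rd: "\<And>t j. t \<in> {0..T} \<Longrightarrow> ((\<lambda>s. R s j) has_vector_derivative
      (- of_real (a j) * R t j + (of_real (M j) * conv (\<lambda>i. 2 * fderiv l (c t) i + fderiv l (R t) i) (fderiv l (R t)) j + G t j))) (at t within {0..T})"
  proof (rule coefficient_fixpoint[OF l T \<gamma>(1) \<delta> \<kappa> a0 Mb _ _ _ P_cont _ Gb Gc _ sm])
    show "norm (fderiv l (c t) j) \<le> w * A / wt j ^ 5" if "t \<in> {0..T}" for t j by (rule P_bound'[OF that]) simp
  qed (auto simp: a_def M_def G_def symbol_even rsym fderiv_cnj c_sym)

  define E where "E = 2 * \<kappa> * exp (\<gamma> * T)"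
  have E: "0 \<le> E" using \<kappa> by (simp add: E_def)
  have wE: "2 * (w * E) \<le> 1" using small(2) by (simp add: E_def mult_ac)
  define N where "N t j = conv (\<lambda>i. 2 * fderiv l (c t) i + fderiv l (R t) i) (fderiv l (R t)) j" for t j
  define R' where "R' t j = - of_real (a j) * R t j + (of_real (M j) * N t j + G t j)" for t j
  have Rd': "((\<lambda>s. R s j) has_vector_derivative R' t j) (at t within {0..T})" if "t \<in> {0..T}" for t j
    unfolding R'_def N_def by (rule Rd[OF that])
  have Rb6: "norm (R t j) \<le> E / wt j ^ 6" if "t \<in> {0..T}" for t j using Rb[OF that] by (simp add: E_def)
  have dR: "norm (fderiv l (R t) j) \<le> (w * E) / wt j ^ 5" if "t \<in> {0..T}" for t j
    unfolding w_def by (rule fderiv_bound[OF l]) (use Rb6[OF that] in simp)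
  have P2: "norm (2 * fderiv l (c t) j + fderiv l (R t) j) \<le> (2 * (w * A) + w * E) / wt j ^ 5" if "t \<in> {0..T}" for t j
  proof -
    have "norm (2 * fderiv l (c t) j) \<le> 2 * (w * A / wt j ^ 5)" using P_bound'[OF that, of 5 j] by (simp add: norm_mult)
    from norm_triangle_mono[OF this dR[OF that, of j]] show ?thesis by (simp add: add_divide_distrib)
  qed
  have Rc: "continuous_on {0..T} (\<lambda>t. R t j)" for j
    using Rd' has_vector_derivative_continuous continuous_on_eq_continuous_within by blast
  have dRc: "continuous_on {0..T} (\<lambda>t. fderiv l (R t) j)" for j
    unfolding fderiv_def by (intro continuous_intros Rc)
  have Nc: "continuous_on {0..T} (\<lambda>t. N t j)" for j
    unfolding N_def by (rule conv_continuous[OF _ P2 dR]) (auto intro!: continuous_intros P_cont dRc)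
  have R'c: "continuous_on {0..T} (\<lambda>t. R' t j)" for j
    unfolding R'_def by (intro continuous_intros Rc Nc Gc)
  define D where "D = conv_const 5 * (2 * (w * A) + w * E) * (w * E)"
  have D: "0 \<le> D" using conv_const_pos[of 5] w_pos A_nonneg E by (simp add: D_def)
  have Nb: "norm (N t j) \<le> D / wt j ^ 5" if "t \<in> {0..T}" for t j
    unfolding N_def D_def by (rule conv_bound[OF _ P2[OF that] dR[OF that]]) simp
  \<comment> \<open>Regularity of the remainder in time needs the rate bounded from above: it has
    order at most 4, so \<open>R'\<close> keeps two of the six powers.\<close>
  define C4 where "C4 = (4 * w ^ 4 + w\<^sup>2) + \<gamma>"
  have C4: "\<bar>a j\<bar> \<le> C4 * wt j ^ 4" "a j + \<gamma> \<le> C4 * wt j ^ 4" for j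
  proof -
    have "\<bar>a j\<bar> = \<bar>ks_rate l j\<bar> / b_sym l \<epsilon> j" using b1[of j] by (simp add: a_def)
    also have "\<dots> \<le> \<bar>ks_rate l j\<bar> / 1" by (rule divide_left_mono) (use b1[of j] in auto)
    also have "\<dots> \<le> (4 * w ^ 4 + w\<^sup>2) * wt j ^ 4" using ks_rate_bound by simp
    finally have 1: "\<bar>a j\<bar> \<le> (4 * w ^ 4 + w\<^sup>2) * wt j ^ 4" .
    have "\<gamma> * 1 \<le> \<gamma> * wt j ^ 4" by (intro mult_left_mono one_le_power wt_ge1 \<gamma>)
    with 1 show "\<bar>a j\<bar> \<le> C4 * wt j ^ 4" "a j + \<gamma> \<le> C4 * wt j ^ 4"
      using \<gamma>(1) unfolding C4_def distrib_right by linarith+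
  qed
  have C40: "0 \<le> C4" unfolding C4_def using \<gamma> w_pos by simp
  have R'b: "norm (R' t j) \<le> (C4 * E + \<delta> * C4 * D + \<kappa> * C4) / wt j ^ 2" if t: "t \<in> {0..T}" for t j
  proof -
    define n where "n = wt j"
    have n: "1 \<le> n" "0 < n" using wt_ge1[of j] wt_pos[of j] by (simp_all add: n_def)
    have "norm (- of_real (a j) * R t j) \<le> (C4 * n ^ 4) * (E / n ^ 6)"
      unfolding norm_mult norm_minus_cancel norm_of_real n_def
      using C4(1)[of j] C40 Rb6[OF t] wt_pos[of j] by (intro mult_mono) auto
    also have "\<dots> = C4 * E / n\<^sup>2" using n by (simp add: field_simps eval_nat_numeral)
    finally have 1: "norm (- of_real (a j) * R t j) \<le> C4 * E / n\<^sup>2" .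
    have "norm (of_real (M j) * N t j) \<le> \<bar>M j\<bar> * (D / n ^ 5)"
      unfolding norm_mult norm_of_real n_def by (intro mult_left_mono Nb t) auto
    also have "\<dots> = (\<bar>M j\<bar> * n) * (D / n ^ 6)" using n by (simp add: field_simps eval_nat_numeral)
    also have "\<dots> \<le> (\<delta> * (C4 * n ^ 4)) * (D / n ^ 6)"
      using Mb[of j] mult_left_mono[OF C4(2)[of j] \<delta>] D n unfolding n_def[symmetric] by (intro mult_right_mono) auto
    also have "\<dots> = \<delta> * C4 * D / n\<^sup>2" using n by (simp add: field_simps eval_nat_numeral)
    finally have 2: "norm (of_real (M j) * N t j) \<le> \<delta> * C4 * D / n\<^sup>2" .
    have "norm (G t j) \<le> \<kappa> * (C4 * n ^ 4) / n ^ 6"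
      using Gb[OF t, of j] mult_left_mono[OF C4(2)[of j] \<kappa>] n unfolding n_def[symmetric]
      by (meson divide_right_mono order_trans zero_le_power less_imp_le)
    also have "\<dots> = \<kappa> * C4 / n\<^sup>2" using n by (simp add: field_simps eval_nat_numeral)
    finally have 3: "norm (G t j) \<le> \<kappa> * C4 / n\<^sup>2" .
    show ?thesis
      using norm_triangle_mono[OF 1 norm_triangle_mono[OF 2 3]] unfolding R'_def n_def
      by (simp add: add_divide_distrib add.assoc)
  qed
  define \<Psi> where "\<Psi> t y = \<Phi> t y + fseries l (R t) y" for t y
  obtain \<Phi>t where reg\<Phi>: "classical_reg T \<Phi> \<Phi>t" by (rule \<Phi>_reg)
  have reg: "classical_reg T \<Psi> (\<lambda>t y. \<Phi>t t y + fseries l (R' t) y)"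
    unfolding \<Psi>_def[abs_def] by (intro classical_reg_add[OF reg\<Phi> classical_reg_fseries[OF l T Rb6 R'b R'c Rd']])
  have per: "periodic_on_R l (\<Psi> t)" if "t \<in> {0..T}" for t
    using \<Phi>_per[OF that] fseries_periodic[OF l, of "R t"] by (simp add: periodic_on_R_def \<Psi>_def)
  have fcoeff\<Psi>: "fcoeff l (\<Psi> t) j = c t j + R t j" if t: "t \<in> {0..T}" for t j
  proof -
    have "fcoeff l (\<Psi> t) j = fcoeff l (\<Phi> t) j + fcoeff l (fseries l (R t)) j"
      unfolding \<Psi>_def[abs_def] by (rule fcoeff_add[OF classical_reg_cont(1)[OF reg\<Phi> t] fseries_continuous_y[OF _ Rb6[OF t]]]) simp
    also have "fcoeff l (fseries l (R t)) j = R t j" by (rule fcoeff_fseries[OF l _ Rb6[OF t] Rs[OF t]]) simp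
    finally show ?thesis by (simp add: c_def)
  qed
  have fderiv\<Psi>: "fderiv l (fcoeff l (\<Psi> t)) = (\<lambda>j. fderiv l (c t) j + fderiv l (R t) j)" if "t \<in> {0..T}" for t
    by (simp add: fun_eq_iff fderiv_def fcoeff\<Psi>[OF that] distrib_left)
  show ?thesis
  proof (rule that[of \<Psi>])
    show "rescaled_sol l T \<epsilon> \<Psi>"
      unfolding spectral_sol_def
    proof (intro conjI ballI allI)
      fix t j assume t: "t \<in> {0..T}"
      have "fcoeff l (\<lambda>y. (deriv (\<Psi> t) y)\<^sup>2) j = conv (\<lambda>j. fderiv l (c t) j + fderiv l (R t) j) (\<lambda>j. fderiv l (c t) j + fderiv l (R t) j) j"
        using reg_fcoeff_sq[OF l per reg t, of j] fderiv\<Psi>[OF t] by simp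
      also have "\<dots> = q t j + N t j"
        using conv_square_add[OF _ P_bound'[OF t] dR[OF t], of j] by (simp add: q_def N_def c_def)
      finally have sq: "fcoeff l (\<lambda>y. (deriv (\<Psi> t) y)\<^sup>2) j = q t j + N t j" .
      have "((\<lambda>s. of_real (b_sym l \<epsilon> j) * (c s j + R s j)) has_vector_derivative of_real (b_sym l \<epsilon> j) * (c' t j + R' t j)) (at t within {0..T})"
        by (intro bounded_linear.has_vector_derivative[OF bounded_linear_mult_right] has_vector_derivative_add c_deriv Rd' t)
      moreover have "of_real (b_sym l \<epsilon> j) * (c' t j + R' t j) =
          of_real (- ks_rate l j) * (c t j + R t j) + of_real (f_sym l \<epsilon> j) * (q t j + N t j)"
      proof -
        \<comment> \<open>Multiplication by \<open>b\<close> clears the denominators in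
          \<open>a\<close>, \<open>M\<close> and \<open>G\<close>. The residual contains
          \<open>(1 - b) * c'\<close>, which completes \<open>b * c'\<close> to \<open>c'\<close>;
          its term \<open>q / 2\<close> cancels the nonlinearity of the Kuramoto--Sivashinsky
          equation.\<close>
        have "of_real (b_sym l \<epsilon> j) * R' t j = - of_real (ks_rate l j) * R t j + of_real (f_sym l \<epsilon> j) * N t j + residual l \<epsilon> (c t) j"
          using b0[of j] by (simp add: R'_def a_def M_def G_def field_simps)
        then have 1: "of_real (b_sym l \<epsilon> j) * (c' t j + R' t j) = c' t j + 1/2 * q t j
            - of_real (ks_rate l j) * R t j + of_real (f_sym l \<epsilon> j) * (N t j + q t j)"
          unfolding residual_eq distrib_left by (simp add: algebra_simps)
        have 2: "c' t j = - of_real (ks_rate l j) * c t j + - (1/2) * q t j" by (simp add: c'_def c_def q_def)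
        show ?thesis unfolding 1 unfolding 2 by (simp add: algebra_simps)
      qed
      ultimately have "((\<lambda>s. of_real (b_sym l \<epsilon> j) * (c s j + R s j)) has_vector_derivative
          of_real (- ks_rate l j) * fcoeff l (\<Psi> t) j + of_real (f_sym l \<epsilon> j) * fcoeff l (\<lambda>y. (deriv (\<Psi> t) y)\<^sup>2) j) (at t within {0..T})"
        by (simp only: sq fcoeff\<Psi>[OF t])
      then show "((\<lambda>s. of_real (b_sym l \<epsilon> j) * fcoeff l (\<Psi> s) j) has_vector_derivative
          of_real (- ks_rate l j) * fcoeff l (\<Psi> t) j + of_real (f_sym l \<epsilon> j) * fcoeff l (\<lambda>y. (deriv (\<Psi> t) y)\<^sup>2) j) (at t within {0..T})"
        by (rule has_vector_derivative_transform[OF t, rotated]) (simp only: fcoeff\<Psi>)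
    qed (use per reg in blast)+
    have "fseries l (R 0) y = 0" for y by (simp add: fseries_def R0)
    then show "\<Psi> 0 y = \<Phi>0 y" for y using ks by (simp add: \<Psi>_def ks_sol_def)
    fix t assume t: "t \<in> {0..T}"
    have "norm (R t i) \<le> E / wt i ^ 2" for i
      using Rb6[OF t, of i] mult_left_mono[OF wt_powr_mono[of 2 6 i] E] by simp
    then have "\<bar>fseries l (R t) y\<bar> \<le> E * conv_const 2" for y by (rule fseries_bound)
    then show "\<bar>\<Psi> t y - \<Phi> t y\<bar> \<le> 2 * \<kappa> * exp (\<gamma> * T) * conv_const 2" for y by (simp add: \<Psi>_def E_def)
    fix j
    have "norm (fderiv l (R t) j) \<le> (w * E) / wt j ^ 3"
      using dR[OF t, of j] mult_left_mono[OF wt_powr_mono[of 3 5 j], of "w * E"] w_pos E by simp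
    also have "\<dots> \<le> (1/2) / wt j ^ 3" using wE wt_pos[of j] by (intro divide_right_mono) auto
    finally have "norm (fderiv l (R t) j) \<le> (1/2) / wt j ^ 3" .
    from norm_triangle_mono[OF P_bound'[OF t, of 3 j] this]
    show "norm (fderiv l (fcoeff l (\<Psi> t)) j) \<le> (w * A + 1/2) / wt j ^ 3"
      unfolding fderiv\<Psi>[OF t] by (simp add: add_divide_distrib)
  qed
qed

end

text \<open>The competitor \<open>v\<close> is not assumed to be close to \<open>u\<close>. By uniform continuity in time the two stay close on
  a time step of fixed length after any time up to which they agree, and there \<open>coefficient_unique\<close> applies.\<close>

lemma rescaled_uniqueness:
  fixes \<epsilon> \<gamma> \<delta> K :: real
  assumes l: "l > 0" and T: "T > 0" and e: "0 < \<epsilon>" "\<epsilon> \<le> 1" and \<gamma>: "0 \<le> \<gamma>" "\<And>j. 0 < ks_rate l j + \<gamma>" and \<delta>: "0 \<le> \<delta>"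
    and f_sym: "\<And>j. \<bar>f_sym l \<epsilon> j\<bar> * wt j \<le> \<delta> * (ks_rate l j + \<gamma>)"
    and small: "conv_const 3 * \<delta> * (2 * pi / l) * (2 * K + 1) \<le> 1/2"
    and u: "rescaled_sol l T \<epsilon> u" and v: "rescaled_sol l T \<epsilon> v"
    and K: "\<And>t j. t \<in> {0..T} \<Longrightarrow> norm (fderiv l (fcoeff l (u t)) j) \<le> K / wt j ^ 3"
    and init: "\<And>y. u 0 y = v 0 y" and t: "t \<in> {0..T}"
  shows "v t y = u t y"
proof -
  obtain ut vt where reg: "classical_reg T u ut" "classical_reg T v vt" using u v unfolding spectral_sol_def by blast
  have per: "periodic_on_R l (u t)" "periodic_on_R l (v t)" if "t \<in> {0..T}" for t
    using u v that unfolding spectral_sol_def by blast+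
  have b1: "1 \<le> b_sym l \<epsilon> j" for j using b_sym_bounds(1)[of \<epsilon> l j] e by simp
  have b0: "b_sym l \<epsilon> j \<noteq> 0" for j using b1[of j] by simp
  define a where "a j = ks_rate l j / b_sym l \<epsilon> j" for j
  define M where "M j = f_sym l \<epsilon> j / b_sym l \<epsilon> j" for j
  note rate = rate_bounds[OF e \<gamma> \<delta> f_sym, folded a_def M_def]
  have a0: "0 < a j + \<gamma>" for j by (rule rate(2))
  have Mb: "\<bar>M j\<bar> * wt j \<le> \<delta> * (a j + \<gamma>)" for j by (rule rate(3))
  define z where "z t j = fcoeff l (v t) j - fcoeff l (u t) j" for t j
  have z0: "z 0 j = 0" for j
  proof -
    have "u 0 = v 0" using init by blast
    then show ?thesis by (simp add: z_def)
  qed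
  \<comment> \<open>Chosen such that a difference bounded by \<open>2 * \<eta>\<close> has a
    derivative bounded by 1: this is the summand 1 beside \<open>2 * K\<close> in the smallness
    assumption.\<close>
  define \<eta> where "\<eta> = l / (4 * pi)"
  have \<eta>: "0 < \<eta>" using l by (simp add: \<eta>_def)
  obtain hu where hu: "hu > 0" "\<And>t s j. t \<in> {0..T} \<Longrightarrow> s \<in> {0..T} \<Longrightarrow> \<bar>t - s\<bar> < hu \<Longrightarrow> norm (fcoeff l (u t) j - fcoeff l (u s) j) \<le> \<eta> / wt j ^ 4"
    using reg_fcoeff_uniform[OF l per(1) reg(1) \<eta>] by blast
  obtain hv where hv: "hv > 0" "\<And>t s j. t \<in> {0..T} \<Longrightarrow> s \<in> {0..T} \<Longrightarrow> \<bar>t - s\<bar> < hv \<Longrightarrow> norm (fcoeff l (v t) j - fcoeff l (v s) j) \<le> \<eta> / wt j ^ 4"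
    using reg_fcoeff_uniform[OF l per(2) reg(2) \<eta>] by blast
  define h where "h = min hu hv / 2"
  have h: "0 < h" "h < hu" "h < hv" using hu(1) hv(1) by (auto simp: h_def min_def)
  have zd: "((\<lambda>s. z s j) has_vector_derivative
      (- of_real (a j) * z t j + of_real (M j) * conv (\<lambda>i. 2 * fderiv l (fcoeff l (u t)) i + fderiv l (z t) i) (fderiv l (z t)) j)) (at t within {0..T})"
    if t: "t \<in> {0..T}" and zb: "\<And>j. norm (z t j) \<le> 2 * \<eta> / wt j ^ 4" for t j
  proof -
    have dz: "norm (fderiv l (z t) j) \<le> (2 * pi / l * (2 * \<eta>)) / wt j ^ 3" for j
      by (rule fderiv_bound[OF l]) (use zb in simp)
    have dv: "fderiv l (fcoeff l (v t)) = (\<lambda>j. fderiv l (fcoeff l (u t)) j + fderiv l (z t) j)"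
      by (simp add: fun_eq_iff fderiv_def z_def right_diff_distrib)
    let ?N = "conv (\<lambda>i. 2 * fderiv l (fcoeff l (u t)) i + fderiv l (z t) i) (fderiv l (z t)) j"
    have "fcoeff l (\<lambda>y. (deriv (v t) y)\<^sup>2) j = fcoeff l (\<lambda>y. (deriv (u t) y)\<^sup>2) j + ?N"
      using reg_fcoeff_sq[OF l per(1) reg(1) t, of j] reg_fcoeff_sq[OF l per(2) reg(2) t, of j]
        conv_square_add[OF _ K[OF t] dz, of j] by (simp add: dv)
    moreover have "((\<lambda>s. of_real (b_sym l \<epsilon> j) * fcoeff l (v s) j - of_real (b_sym l \<epsilon> j) * fcoeff l (u s) j) has_vector_derivative
        (of_real (- ks_rate l j) * fcoeff l (v t) j + of_real (f_sym l \<epsilon> j) * fcoeff l (\<lambda>y. (deriv (v t) y)\<^sup>2) j)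
        - (of_real (- ks_rate l j) * fcoeff l (u t) j + of_real (f_sym l \<epsilon> j) * fcoeff l (\<lambda>y. (deriv (u t) y)\<^sup>2) j)) (at t within {0..T})"
      using u v t unfolding spectral_sol_def by (intro has_vector_derivative_diff) blast+
    ultimately have "((\<lambda>s. of_real (b_sym l \<epsilon> j) * z s j) has_vector_derivative
        (of_real (- ks_rate l j) * z t j + of_real (f_sym l \<epsilon> j) * ?N)) (at t within {0..T})"
      by (simp add: z_def algebra_simps)
    from bounded_linear.has_vector_derivative[OF bounded_linear_divide this, of "of_real (b_sym l \<epsilon> j)"]
    show ?thesis using b0[of j] by (simp add: a_def M_def add_divide_distrib diff_divide_distrib)
  qed
  have step: "z t j = 0" if "t \<in> {0..T}" "t \<le> real n * h" for n t j
    using that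
  proof (induction n arbitrary: t j)
    case 0
    then show ?case using z0 by simp
  next
    case (Suc n)
    have near: "norm (z s j) \<le> 2 * \<eta> / wt j ^ 4" if s: "s \<in> {0..t}" for s j
    proof -
      \<comment> \<open>A time not after s at which \<open>z\<close> is already known to vanish. So
        \<open>z s\<close> is a difference of increments of v and u over a time of at most h, each
        bounded by \<eta>.\<close>
      define s0 where "s0 = min s (real n * h)"
      have s0: "s0 \<in> {0..T}" "s0 \<le> real n * h" "\<bar>s - s0\<bar> \<le> h"
        using s Suc.prems h by (auto simp: s0_def min_def algebra_simps)
      have sT: "s \<in> {0..T}" using s Suc.prems by auto
      have "z s0 j = 0" by (rule Suc.IH[OF s0(1,2)])
      then have "z s j = (fcoeff l (v s) j - fcoeff l (v s0) j) - (fcoeff l (u s) j - fcoeff l (u s0) j)"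
        by (simp add: z_def)
      also have "norm \<dots> \<le> \<eta> / wt j ^ 4 + \<eta> / wt j ^ 4"
        using s0 h by (intro order_trans[OF norm_triangle_ineq4] add_mono hu(2) hv(2) sT) auto
      finally show ?thesis by simp
    qed
    have sub: "{0..t} \<subseteq> {0..T}" using Suc.prems by auto
    have dz: "norm (fderiv l (z s) j) \<le> 1 / wt j ^ 3" if "s \<in> {0..t}" for s j
    proof -
      have "norm (fderiv l (z s) j) \<le> (2 * pi / l * (2 * \<eta>)) / wt j ^ 3"
        by (rule fderiv_bound[OF l]) (use near[OF that] in simp)
      then show ?thesis using l by (simp add: \<eta>_def)
    qed
    show ?case
    proof (rule coefficient_unique[OF l a0 Mb small \<delta> \<gamma>(1)])
      fix s i assume s: "s \<in> {0..t}"
      then have sT: "s \<in> {0..T}" using sub by blast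
      have "norm (2 * fderiv l (fcoeff l (u s)) i) \<le> 2 * (K / wt i ^ 3)" using K[OF sT, of i] by (simp add: norm_mult)
      from norm_triangle_mono[OF this dz[OF s, of i]]
      show "norm (2 * fderiv l (fcoeff l (u s)) i + fderiv l (z s) i) \<le> (2 * K + 1) / wt i ^ 3" by (simp add: add_divide_distrib)
      show "norm (z s i) \<le> 2 * \<eta> / wt i ^ 4" by (rule near[OF s])
      show "((\<lambda>s. z s i) has_vector_derivative
        (- of_real (a i) * z s i + of_real (M i) * conv (\<lambda>i. 2 * fderiv l (fcoeff l (u s)) i + fderiv l (z s) i) (fderiv l (z s)) i)) (at s within {0..t})"
        by (rule has_vector_derivative_within_subset[OF zd[OF sT near[OF s]] sub])
    qed (use z0 Suc.prems in auto)
  qed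
  obtain n where "t / h < real n" using reals_Archimedean2 by blast
  then have n: "t \<le> real n * h" using h by (simp add: field_simps)
  have c: "continuous_on {-l/2..l/2} (u t)" "continuous_on {-l/2..l/2} (v t)"
    using classical_reg_cont(1)[OF reg(1) t] classical_reg_cont(1)[OF reg(2) t] by auto
  show ?thesis
  proof (rule periodic_on_R_eqI[OF l per(2)[OF t] per(1)[OF t]])
    fix y assume y: "y \<in> {-l/2..l/2}"
    have "v t y - u t y = 0"
      by (rule fcoeff_inj[OF l _ _ y, of "\<lambda>y. v t y - u t y"])
        (use step[OF t n] c in \<open>auto simp: fcoeff_diff z_def intro!: continuous_on_diff\<close>)
    then show "v t y = u t y" by simp
  qed
qed

text \<open>The constants are chosen in the order \<open>A\<close>, \<delta>, \<gamma>,
  \<open>Cr\<close>, \<open>\<epsilon>0\<close>, each from earlier ones. \<delta> bounds the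
  nonlinearity relative to the rate, and \<gamma> may be large, since only
  \<open>\<epsilon>0\<close> and the error constant suffer from exp(\<gamma> T).\<close>

lemma rescaled_solutions:
  assumes l: "l > 0" and T: "T > 0" and ks: "ks_sol l T \<Phi>0 \<Phi>" and H: "\<Phi>0 \<in> Hsharp m l" and m: "10 \<le> m"
  obtains \<epsilon>0 C where "0 < \<epsilon>0" "\<epsilon>0 < 1" "0 < C"
    "\<And>\<epsilon>. 0 < \<epsilon> \<Longrightarrow> \<epsilon> \<le> \<epsilon>0 \<Longrightarrow> \<exists>\<Psi>. rescaled_sol l T \<epsilon> \<Psi> \<and> (\<forall>y. \<Psi> 0 y = \<Phi>0 y)
      \<and> (\<forall>t\<in>{0..T}. \<forall>y. \<bar>\<Psi> t y - \<Phi> t y\<bar> \<le> C * \<epsilon>)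
      \<and> (\<forall>v. rescaled_sol l T \<epsilon> v \<longrightarrow> (\<forall>y. v 0 y = \<Phi>0 y)
          \<longrightarrow> (\<forall>t\<in>{0..T}. \<forall>y. v t y = \<Psi> t y))"
proof -
  define w where "w = 2 * pi / l"
  have w: "0 < w" using l by (simp add: w_def)
  obtain \<Phi>t where reg: "classical_reg T \<Phi> \<Phi>t" using ks unfolding ks_sol_def by blast
  have \<Phi>00: "\<Phi> 0 = \<Phi>0" using ks unfolding ks_sol_def by blast
  have "continuous_on {-l/2..l/2} \<Phi>0"
    using classical_reg_cont(1)[OF reg, of 0 "{-l/2..l/2}"] T \<Phi>00 by simp
  then obtain A0 where A0: "\<And>j. norm (fcoeff l \<Phi>0 j) \<le> A0 / wt j ^ m"
    using Hsharp_fcoeff_decay[OF l _ H] by blast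
  obtain A where A: "\<And>t j. t \<in> {0..T} \<Longrightarrow> norm (fcoeff l (\<Phi> t) j) \<le> A / wt j ^ 10"
    using ks_fcoeff_decay[OF l T ks m A0] by blast
  have A_pos: "0 \<le> A" using order_trans[OF norm_ge_zero A[of 0 0]] T by (simp add: wt_0)
  \<comment> \<open>One \<delta> for two purposes: the fixed point needs \<open>conv_const 5\<close>
    with \<open>2 * (w * A) + 1\<close>, uniqueness needs \<open>conv_const 3\<close> with
    \<open>2 * (w * A + 1/2) + 1\<close>.\<close>
  define \<delta> where "\<delta> = 1 / (2 * w * (2 * (w * A) + 2) * (conv_const 3 + conv_const 5))"
  have cc: "0 < conv_const 3 + conv_const 5" using conv_const_pos[of 3] conv_const_pos[of 5] by simp
  have wA: "0 \<le> w * A" using w A_pos by simp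
  have \<delta>: "0 < \<delta>" using cc w wA unfolding \<delta>_def by (intro divide_pos_pos mult_pos_pos) auto
  have small: "conv_const p * \<delta> * w * x \<le> 1/2" if "p = 3 \<or> p = 5" "0 \<le> x" "x \<le> 2 * (w * A) + 2" for p x
  proof -
    have "conv_const p * (w * x) \<le> (conv_const 3 + conv_const 5) * (w * (2 * (w * A) + 2))"
      using that w cc conv_const_pos[of 3] conv_const_pos[of 5] by (intro mult_mono) auto
    then have "conv_const p * (w * x) * \<delta> \<le> (conv_const 3 + conv_const 5) * (w * (2 * (w * A) + 2)) * \<delta>"
      using \<delta> by (intro mult_right_mono) auto
    also have "\<dots> = 1/2"
      using cc w wA unfolding \<delta>_def by (simp add: divide_simps)
    finally show ?thesis by (simp add: mult_ac)
  qed
  obtain \<gamma>0 \<epsilon>1 where \<epsilon>1: "0 < \<epsilon>1" "\<epsilon>1 < 1"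
    and fe0: "\<And>\<gamma> \<epsilon> j. \<gamma>0 \<le> \<gamma> \<Longrightarrow> 0 \<le> \<epsilon> \<Longrightarrow> \<epsilon> \<le> \<epsilon>1 \<Longrightarrow> \<bar>f_sym l \<epsilon> j\<bar> * wt j \<le> \<delta> * (ks_rate l j + \<gamma>)"
    by (rule f_sym_dominated[OF l \<delta>]) (rule that)
  define \<gamma> where "\<gamma> = max \<gamma>0 (1/2 + 6 * w ^ 4)"
  have \<gamma>: "\<gamma>0 \<le> \<gamma>" "1/2 + 6 * w ^ 4 \<le> \<gamma>" by (auto simp: \<gamma>_def)
  have "0 \<le> w ^ 4" using w by simp
  then have \<gamma>pos: "0 < \<gamma>" using \<gamma>(2) by linarith
  define c where "c = 3/8 * w ^ 4"
  have c: "0 < c" using w by (simp add: c_def)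
  have low: "c * wt j ^ 4 \<le> ks_rate l j + \<gamma>" "0 < ks_rate l j + \<gamma>" for j
  proof -
    have "c * wt j ^ 4 + \<gamma> / 2 \<le> ks_rate l j + \<gamma>"
      using ks_rate_lower[OF l, of \<gamma> j] \<gamma>(2) by (simp add: c_def w_def)
    moreover have "0 < c * wt j ^ 4" using c wt_pos[of j] by simp
    ultimately show "c * wt j ^ 4 \<le> ks_rate l j + \<gamma>" "0 < ks_rate l j + \<gamma>" using \<gamma>pos by linarith+
  qed
  obtain Cr where Cr: "0 \<le> Cr"
    and res0: "\<And>(\<epsilon>::real) t j. 0 \<le> \<epsilon> \<Longrightarrow> \<epsilon> \<le> 1 \<Longrightarrow> t \<in> {0..T} \<Longrightarrow> norm (residual l \<epsilon> (fcoeff l (\<Phi> t)) j) \<le> Cr * \<epsilon> / wt j ^ 4"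
    by (rule residual_bound[OF l T ks A]) (assumption, rule that)
  \<comment> \<open>Converts the residual into a multiple of the rate, whose lower bound is
    \<open>c * wt j ^ 4\<close>; adding 1 keeps k positive when \<open>Cr\<close> is 0.\<close>
  define k where "k = (Cr + 1) / c"
  have k: "0 < k" using Cr c by (simp add: k_def)
  \<comment> \<open>The second entry makes the coefficients of the derivative of the remainder at
    most 1/2 in the weighted norm, so quadratic interactions of the remainder stay below those with
    \<Phi> allowed for in \<delta>.\<close>
  define \<epsilon>0 where "\<epsilon>0 = min \<epsilon>1 (1 / (4 * k * w * exp (\<gamma> * T)))"
  show ?thesis
  proof (rule that[of \<epsilon>0 "2 * k * exp (\<gamma> * T) * conv_const 2"])
    show "0 < \<epsilon>0" "\<epsilon>0 < 1" using \<epsilon>1 k w by (auto simp: \<epsilon>0_def)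
    show "0 < 2 * k * exp (\<gamma> * T) * conv_const 2" using k conv_const_pos[of 2] by simp
    fix \<epsilon> :: real assume e: "0 < \<epsilon>" "\<epsilon> \<le> \<epsilon>0"
    have e1: "\<epsilon> \<le> 1" "\<epsilon> \<le> \<epsilon>1" using e \<epsilon>1 by (auto simp: \<epsilon>0_def)
    define \<kappa> where "\<kappa> = k * \<epsilon>"
    have \<kappa>: "0 \<le> \<kappa>" using k e by (simp add: \<kappa>_def)
    have fe1: "\<bar>f_sym l \<epsilon> j\<bar> * wt j \<le> \<delta> * (ks_rate l j + \<gamma>)" for j
      using e1 e by (intro fe0 \<gamma>) auto
    have res: "norm (residual l \<epsilon> (fcoeff l (\<Phi> t)) j) \<le> \<kappa> * (ks_rate l j + \<gamma>) / wt j ^ 6" if "t \<in> {0..T}" for t j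
    proof -
      have "norm (residual l \<epsilon> (fcoeff l (\<Phi> t)) j) \<le> Cr * \<epsilon> * (1 / wt j ^ 4)"
        using res0[OF _ e1(1) that, of j] e by simp
      also have "\<dots> \<le> ((Cr + 1) * \<epsilon>) * (1 / wt j ^ 2)"
        using Cr e wt_pos[of j] by (intro mult_mono wt_powr_mono) auto
      also have "\<dots> = \<kappa> * (c * wt j ^ 4) / wt j ^ 6"
        using c wt_pos[of j] by (simp add: \<kappa>_def k_def field_simps eval_nat_numeral)
      also have "\<dots> \<le> \<kappa> * (ks_rate l j + \<gamma>) / wt j ^ 6"
        using \<kappa> wt_pos[of j] by (intro divide_right_mono mult_left_mono low) auto
      finally show ?thesis .
    qed
    have s2: "4 * \<kappa> * w * exp (\<gamma> * T) \<le> 1"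
    proof -
      have "(4 * k * w * exp (\<gamma> * T)) * \<epsilon> \<le> (4 * k * w * exp (\<gamma> * T)) * (1 / (4 * k * w * exp (\<gamma> * T)))"
        using e k w by (intro mult_left_mono) (auto simp: \<epsilon>0_def)
      also have "\<dots> = 1" using k w by simp
      finally show ?thesis by (simp add: \<kappa>_def mult_ac)
    qed
    have s1: "conv_const 5 * \<delta> * w * (2 * (w * A) + 1) \<le> 1/2" by (rule small) (use wA in auto)
    have s3: "conv_const 3 * \<delta> * w * (2 * (w * A + 1/2) + 1) \<le> 1/2" by (rule small) (use wA in auto)
    obtain \<Psi> where \<Psi>: "rescaled_sol l T \<epsilon> \<Psi>" "\<And>y. \<Psi> 0 y = \<Phi>0 y"
      "\<And>t y. t \<in> {0..T} \<Longrightarrow> \<bar>\<Psi> t y - \<Phi> t y\<bar> \<le> 2 * \<kappa> * exp (\<gamma> * T) * conv_const 2"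
      "\<And>t j. t \<in> {0..T} \<Longrightarrow> norm (fderiv l (fcoeff l (\<Psi> t)) j) \<le> (w * A + 1/2) / wt j ^ 3"
      using rescaled_existence[OF l T ks A e(1) e1(1) less_imp_le[OF \<gamma>pos] low(2) less_imp_le[OF \<delta>] \<kappa> fe1 res, folded w_def, OF _ _ s1 s2]
      by blast
    have uniq: "v t y = \<Psi> t y" if "rescaled_sol l T \<epsilon> v" "\<forall>y. v 0 y = \<Phi>0 y" "t \<in> {0..T}" for v t y
      by (rule rescaled_uniqueness[OF l T e(1) e1(1) less_imp_le[OF \<gamma>pos] low(2) less_imp_le[OF \<delta>] fe1 s3[unfolded w_def] \<Psi>(1) that(1) \<Psi>(4)[unfolded w_def]])
        (use that \<Psi>(2) in auto)
    show "\<exists>\<Psi>. rescaled_sol l T \<epsilon> \<Psi> \<and> (\<forall>y. \<Psi> 0 y = \<Phi>0 y)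
      \<and> (\<forall>t\<in>{0..T}. \<forall>y. \<bar>\<Psi> t y - \<Phi> t y\<bar> \<le> 2 * k * exp (\<gamma> * T) * conv_const 2 * \<epsilon>)
      \<and> (\<forall>v. rescaled_sol l T \<epsilon> v \<longrightarrow> (\<forall>y. v 0 y = \<Phi>0 y)
          \<longrightarrow> (\<forall>t\<in>{0..T}. \<forall>y. v t y = \<Psi> t y))"
    proof (intro exI conjI ballI allI impI)
      show "\<bar>\<Psi> t y - \<Phi> t y\<bar> \<le> 2 * k * exp (\<gamma> * T) * conv_const 2 * \<epsilon>" if "t \<in> {0..T}" for t y
        using \<Psi>(3)[OF that, of y] by (simp add: \<kappa>_def mult_ac)
    qed (use \<Psi>(1,2) uniq in auto)
  qed
qed

lemma spectral_sol_imp_classical_sol: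
  assumes e: "0 < \<epsilon>" and l: "0 < l" and g: "rescaled_sol l T \<epsilon> \<Psi>"
  shows "classical_sol (1 + \<epsilon>) (l / sqrt \<epsilon>) (T / \<epsilon>\<^sup>2) (\<lambda>t y. \<epsilon> * \<Psi> (\<epsilon>\<^sup>2 * t) (sqrt \<epsilon> * y))"
proof -
  have r: "sqrt \<epsilon> > 0" "(sqrt \<epsilon>)\<^sup>2 = \<epsilon>" using e by auto
  have "\<epsilon>\<^sup>2 / (\<epsilon> * (sqrt \<epsilon>)\<^sup>2) = 1" using e by (simp add: r power2_eq_square)
  with spectral_sol_scale[OF g l e zero_less_power[OF e, of 2] r(1)]
  show ?thesis
    unfolding classical_sol_iff_spectral_sol[OF e l] by simp
qed

lemma classical_sol_imp_spectral_sol: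
  assumes e: "0 < \<epsilon>" and l: "0 < l" and s: "classical_sol (1 + \<epsilon>) (l / sqrt \<epsilon>) (T / \<epsilon>\<^sup>2) \<phi>"
  shows "rescaled_sol l T \<epsilon> (\<lambda>t y. (1 / \<epsilon>) * \<phi> (1 / \<epsilon>\<^sup>2 * t) (1 / sqrt \<epsilon> * y))"
proof -
  have r: "1 / sqrt \<epsilon> > 0" "(sqrt \<epsilon>)\<^sup>2 = \<epsilon>" "0 < 1 / \<epsilon>" "0 < 1 / \<epsilon>\<^sup>2" "0 < l / sqrt \<epsilon>" using e l by auto
  have "spectral_sol (l / sqrt \<epsilon>) (T / \<epsilon>\<^sup>2) (b_sym l \<epsilon>) (\<lambda>j. - \<epsilon>\<^sup>2 * ks_rate l j) (f_sym l \<epsilon>) \<phi>"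
    using s unfolding classical_sol_iff_spectral_sol[OF e l] .
  from spectral_sol_scale[OF this r(5,3,4,1)]
  have "spectral_sol (l / sqrt \<epsilon> / (1 / sqrt \<epsilon>)) (T / \<epsilon>\<^sup>2 / (1 / \<epsilon>\<^sup>2)) (b_sym l \<epsilon>) (\<lambda>j. 1 / \<epsilon>\<^sup>2 * (- \<epsilon>\<^sup>2 * ks_rate l j))
     (\<lambda>j. 1 / \<epsilon>\<^sup>2 / (1 / \<epsilon> * (1 / sqrt \<epsilon>)\<^sup>2) * f_sym l \<epsilon> j) (\<lambda>t y. (1 / \<epsilon>) * \<phi> (1 / \<epsilon>\<^sup>2 * t) (1 / sqrt \<epsilon> * y))" .
  moreover have "l / sqrt \<epsilon> / (1 / sqrt \<epsilon>) = l" "T / \<epsilon>\<^sup>2 / (1 / \<epsilon>\<^sup>2) = T" "1 / \<epsilon>\<^sup>2 * (- \<epsilon>\<^sup>2 * ks_rate l j) = - ks_rate l j"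
    "1 / \<epsilon>\<^sup>2 / (1 / \<epsilon> * (1 / sqrt \<epsilon>)\<^sup>2) * f_sym l \<epsilon> j = f_sym l \<epsilon> j" for j
    using e by (simp_all add: power_divide r(2) power2_eq_square)
  ultimately show "rescaled_sol l T \<epsilon> (\<lambda>t y. (1 / \<epsilon>) * \<phi> (1 / \<epsilon>\<^sup>2 * t) (1 / sqrt \<epsilon> * y))"
    by (simp only:)
qed

text \<open>The initial condition is prescribed on one period only; periodicity of both sides
  extends it to the line, as the comparison of rescaled solutions requires.\<close>

lemma classical_sol_initial:
  assumes e: "0 < \<epsilon>" and l: "0 < l" and T: "0 < T" and s: "classical_sol (1 + \<epsilon>) (l / sqrt \<epsilon>) (T / \<epsilon>\<^sup>2) \<phi>"
    and per: "periodic_on_R l \<Phi>0"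
    and init: "\<And>y. \<bar>y\<bar> \<le> l / (2 * sqrt \<epsilon>) \<Longrightarrow> \<phi> 0 y = \<epsilon> * \<Phi>0 (y * sqrt \<epsilon>)"
  shows "\<phi> 0 y = \<epsilon> * \<Phi>0 (y * sqrt \<epsilon>)"
proof (rule periodic_on_R_eqI[of "l / sqrt \<epsilon>" "\<phi> 0" "\<lambda>y. \<epsilon> * \<Phi>0 (y * sqrt \<epsilon>)"])
  show "0 < l / sqrt \<epsilon>" using e l by simp
  show "periodic_on_R (l / sqrt \<epsilon>) (\<phi> 0)" using s T e unfolding classical_sol_def by simp
  show "periodic_on_R (l / sqrt \<epsilon>) (\<lambda>y. \<epsilon> * \<Phi>0 (y * sqrt \<epsilon>))"
    using per e by (simp add: periodic_on_R_def distrib_right)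
  show "\<phi> 0 y = \<epsilon> * \<Phi>0 (y * sqrt \<epsilon>)" if "y \<in> {- (l / sqrt \<epsilon>) / 2..(l / sqrt \<epsilon>) / 2}" for y
    using that by (intro init) (auto simp: abs_le_iff mult.commute)
qed

theorem theorem1p2:
  shows "\<exists>m0::nat. \<forall>m\<ge>m0. \<forall>(l0::real) (T::real) \<Phi>0 \<Phi>.
    l0 > 4 * pi \<longrightarrow> T > 0 \<longrightarrow> \<Phi>0 \<in> Hsharp m l0 \<longrightarrow> ks_sol l0 T \<Phi>0 \<Phi> \<longrightarrow>
    (\<exists>\<epsilon>0. 0 < \<epsilon>0 \<and> \<epsilon>0 < 1 \<and>
      (\<forall>\<epsilon>. 0 < \<epsilon> \<and> \<epsilon> \<le> \<epsilon>0 \<longrightarrow>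
        (\<exists>\<phi>. classical_sol (1 + \<epsilon>) (l0 / sqrt \<epsilon>) (T / \<epsilon>^2) \<phi>
              \<and> (\<forall>y. \<bar>y\<bar> \<le> l0 / (2 * sqrt \<epsilon>) \<longrightarrow> \<phi> 0 y = \<epsilon> * \<Phi>0 (y * sqrt \<epsilon>))
              \<and> (\<forall>\<psi>. classical_sol (1 + \<epsilon>) (l0 / sqrt \<epsilon>) (T / \<epsilon>^2) \<psi>
                    \<and> (\<forall>y. \<bar>y\<bar> \<le> l0 / (2 * sqrt \<epsilon>) \<longrightarrow> \<psi> 0 y = \<epsilon> * \<Phi>0 (y * sqrt \<epsilon>))
                    \<longrightarrow> (\<forall>t\<in>{0..T / \<epsilon>^2}. \<forall>y. \<psi> t y = \<phi> t y))))
      \<and> (\<exists>C>0. \<forall>\<epsilon> \<phi>. 0 < \<epsilon> \<and> \<epsilon> \<le> \<epsilon>0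
              \<and> classical_sol (1 + \<epsilon>) (l0 / sqrt \<epsilon>) (T / \<epsilon>^2) \<phi>
              \<and> (\<forall>y. \<bar>y\<bar> \<le> l0 / (2 * sqrt \<epsilon>) \<longrightarrow> \<phi> 0 y = \<epsilon> * \<Phi>0 (y * sqrt \<epsilon>))
              \<longrightarrow> (\<forall>t\<in>{0..T / \<epsilon>^2}. \<forall>y. \<bar>y\<bar> \<le> l0 / (2 * sqrt \<epsilon>) \<longrightarrow>
                     \<bar>\<phi> t y - \<epsilon> * \<Phi> (t * \<epsilon>^2) (y * sqrt \<epsilon>)\<bar> \<le> C * \<epsilon>^2)))"
\<comment> \<open>10 is the decay to which \<Phi> is bootstrapped, and its initial datum has to
  share it.\<close>
proof (rule exI[of _ 10], intro allI impI, goal_cases)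
  case (1 m l T \<Phi>0 \<Phi>)
  note m = 1(1) and l4 = 1(2) and T = 1(3) and H = 1(4) and ks = 1(5)
  have l: "0 < l" using l4 pi_gt_zero by linarith
  have per: "periodic_on_R l \<Phi>0" using H by (simp add: Hsharp_def)
  obtain \<epsilon>0 C where \<epsilon>0: "0 < \<epsilon>0" "\<epsilon>0 < 1" and C: "0 < C"
    and ex: "\<And>\<epsilon>. 0 < \<epsilon> \<Longrightarrow> \<epsilon> \<le> \<epsilon>0 \<Longrightarrow> \<exists>\<Psi>. rescaled_sol l T \<epsilon> \<Psi> \<and> (\<forall>y. \<Psi> 0 y = \<Phi>0 y)
      \<and> (\<forall>t\<in>{0..T}. \<forall>y. \<bar>\<Psi> t y - \<Phi> t y\<bar> \<le> C * \<epsilon>)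
      \<and> (\<forall>v. rescaled_sol l T \<epsilon> v \<longrightarrow> (\<forall>y. v 0 y = \<Phi>0 y)
          \<longrightarrow> (\<forall>t\<in>{0..T}. \<forall>y. v t y = \<Psi> t y))"
    using rescaled_solutions[OF l T ks H m] by blast
  let ?A = "\<lambda>\<epsilon>. classical_sol (1 + \<epsilon>) (l / sqrt \<epsilon>) (T / \<epsilon>\<^sup>2)"
  let ?B = "\<lambda>\<epsilon> \<phi>. \<forall>y. \<bar>y\<bar> \<le> l / (2 * sqrt \<epsilon>) \<longrightarrow> \<phi> 0 y = \<epsilon> * \<Phi>0 (y * sqrt \<epsilon>)"
  let ?S = "\<lambda>\<epsilon> \<phi>. ?A \<epsilon> \<phi> \<and> ?B \<epsilon> \<phi>"
  \<comment> \<open>Scaling turns the error \<open>C * \<epsilon>\<close> of the rescaled problem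
    into \<open>C * \<epsilon>^2\<close>. Competitors are scaled back to the fixed period, where
    uniqueness is known.\<close>
  have main: "\<exists>\<phi>. ?S \<epsilon> \<phi> \<and> (\<forall>t\<in>{0..T / \<epsilon>\<^sup>2}. \<forall>y. \<bar>\<phi> t y - \<epsilon> * \<Phi> (t * \<epsilon>\<^sup>2) (y * sqrt \<epsilon>)\<bar> \<le> C * \<epsilon>\<^sup>2)
      \<and> (\<forall>\<psi>. ?S \<epsilon> \<psi> \<longrightarrow> (\<forall>t\<in>{0..T / \<epsilon>\<^sup>2}. \<forall>y. \<psi> t y = \<phi> t y))"
    if e: "0 < \<epsilon>" "\<epsilon> \<le> \<epsilon>0" for \<epsilon>
  proof -
    obtain \<Psi> where \<Psi>: "rescaled_sol l T \<epsilon> \<Psi>" "\<And>y. \<Psi> 0 y = \<Phi>0 y"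
      "\<And>t y. t \<in> {0..T} \<Longrightarrow> \<bar>\<Psi> t y - \<Phi> t y\<bar> \<le> C * \<epsilon>"
      "\<And>v t y. rescaled_sol l T \<epsilon> v \<Longrightarrow> (\<And>y. v 0 y = \<Phi>0 y) \<Longrightarrow> t \<in> {0..T} \<Longrightarrow> v t y = \<Psi> t y"
      using ex[OF e] by blast
    have in_T: "\<epsilon>\<^sup>2 * t \<in> {0..T}" if "t \<in> {0..T / \<epsilon>\<^sup>2}" for t
      using that e by (auto simp: field_simps)
    let ?\<phi> = "\<lambda>t y. \<epsilon> * \<Psi> (\<epsilon>\<^sup>2 * t) (sqrt \<epsilon> * y)"
    show ?thesis
    proof (intro exI[of _ ?\<phi>] conjI allI impI ballI)
      show "classical_sol (1 + \<epsilon>) (l / sqrt \<epsilon>) (T / \<epsilon>\<^sup>2) ?\<phi>"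
        by (rule spectral_sol_imp_classical_sol[OF e(1) l \<Psi>(1)])
      show "\<epsilon> * \<Psi> (\<epsilon>\<^sup>2 * 0) (sqrt \<epsilon> * y) = \<epsilon> * \<Phi>0 (y * sqrt \<epsilon>)" for y
        using \<Psi>(2) by (simp add: mult.commute)
    next
      fix t y assume t: "t \<in> {0..T / \<epsilon>\<^sup>2}"
      have "\<bar>\<epsilon> * \<Psi> (\<epsilon>\<^sup>2 * t) (sqrt \<epsilon> * y) - \<epsilon> * \<Phi> (t * \<epsilon>\<^sup>2) (y * sqrt \<epsilon>)\<bar>
          = \<epsilon> * \<bar>\<Psi> (\<epsilon>\<^sup>2 * t) (sqrt \<epsilon> * y) - \<Phi> (\<epsilon>\<^sup>2 * t) (sqrt \<epsilon> * y)\<bar>"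
        using e by (simp add: mult.commute abs_mult flip: right_diff_distrib)
      also have "\<dots> \<le> \<epsilon> * (C * \<epsilon>)" using e by (intro mult_left_mono \<Psi>(3) in_T t) auto
      finally show "\<bar>\<epsilon> * \<Psi> (\<epsilon>\<^sup>2 * t) (sqrt \<epsilon> * y) - \<epsilon> * \<Phi> (t * \<epsilon>\<^sup>2) (y * sqrt \<epsilon>)\<bar> \<le> C * \<epsilon>\<^sup>2"
        by (simp add: power2_eq_square mult_ac)
    next
      fix \<psi> t y assume \<psi>: "?S \<epsilon> \<psi>" and t: "t \<in> {0..T / \<epsilon>\<^sup>2}"
      have g: "rescaled_sol l T \<epsilon> (\<lambda>t y. (1 / \<epsilon>) * \<psi> (1 / \<epsilon>\<^sup>2 * t) (1 / sqrt \<epsilon> * y))"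
        using \<psi> by (intro classical_sol_imp_spectral_sol[OF e(1) l]) blast
      have i: "\<psi> 0 y = \<epsilon> * \<Phi>0 (y * sqrt \<epsilon>)" for y
      proof (rule classical_sol_initial[OF e(1) l T _ per])
        show "classical_sol (1 + \<epsilon>) (l / sqrt \<epsilon>) (T / \<epsilon>\<^sup>2) \<psi>" using \<psi> by blast
        show "\<psi> 0 y = \<epsilon> * \<Phi>0 (y * sqrt \<epsilon>)" if "\<bar>y\<bar> \<le> l / (2 * sqrt \<epsilon>)" for y using \<psi> that by blast
      qed
      have "(1 / \<epsilon>) * \<psi> (1 / \<epsilon>\<^sup>2 * (\<epsilon>\<^sup>2 * t)) (1 / sqrt \<epsilon> * (sqrt \<epsilon> * y)) = \<Psi> (\<epsilon>\<^sup>2 * t) (sqrt \<epsilon> * y)"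
        by (rule \<Psi>(4)[OF g _ in_T[OF t]]) (use e i in simp)
      then show "\<psi> t y = \<epsilon> * \<Psi> (\<epsilon>\<^sup>2 * t) (sqrt \<epsilon> * y)" using e by (simp add: field_simps)
    qed
  qed
  \<comment> \<open>The error estimate is claimed for every solution; uniqueness transfers it from
    the constructed one.\<close>
  have bound: "\<bar>\<phi> t y - \<epsilon> * \<Phi> (t * \<epsilon>\<^sup>2) (y * sqrt \<epsilon>)\<bar> \<le> C * \<epsilon>\<^sup>2"
    if h: "0 < \<epsilon>" "\<epsilon> \<le> \<epsilon>0" "?S \<epsilon> \<phi>" "t \<in> {0..T / \<epsilon>\<^sup>2}" for \<epsilon> \<phi> t y
  proof -
    obtain \<phi>' where \<phi>': "\<forall>t\<in>{0..T / \<epsilon>\<^sup>2}. \<forall>y. \<bar>\<phi>' t y - \<epsilon> * \<Phi> (t * \<epsilon>\<^sup>2) (y * sqrt \<epsilon>)\<bar> \<le> C * \<epsilon>\<^sup>2"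
      and u: "\<And>\<psi>. ?S \<epsilon> \<psi> \<Longrightarrow> \<forall>t\<in>{0..T / \<epsilon>\<^sup>2}. \<forall>y. \<psi> t y = \<phi>' t y"
      using main[OF h(1,2)] by blast
    show ?thesis using \<phi>' u[OF h(3)] h(4) by simp
  qed
  have "\<forall>\<epsilon>. 0 < \<epsilon> \<and> \<epsilon> \<le> \<epsilon>0 \<longrightarrow> (\<exists>\<phi>. ?A \<epsilon> \<phi> \<and> ?B \<epsilon> \<phi> \<and>
      (\<forall>\<psi>. ?A \<epsilon> \<psi> \<and> ?B \<epsilon> \<psi> \<longrightarrow> (\<forall>t\<in>{0..T / \<epsilon>\<^sup>2}. \<forall>y. \<psi> t y = \<phi> t y)))"
    using main by blast
  moreover have "\<forall>\<epsilon> \<phi>. 0 < \<epsilon> \<and> \<epsilon> \<le> \<epsilon>0 \<and> ?A \<epsilon> \<phi> \<and> ?B \<epsilon> \<phi> \<longrightarrow> (\<forall>t\<in>{0..T / \<epsilon>\<^sup>2}. \<forall>y. \<bar>y\<bar> \<le> l / (2 * sqrt \<epsilon>) \<longrightarrow>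
      \<bar>\<phi> t y - \<epsilon> * \<Phi> (t * \<epsilon>\<^sup>2) (y * sqrt \<epsilon>)\<bar> \<le> C * \<epsilon>\<^sup>2)"
    using bound by blast
  ultimately show ?case
    using \<epsilon>0 C by - (rule exI[of _ \<epsilon>0], intro conjI exI[of _ C])
qed

end
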